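(* Let $(F,v)$ be a Henselian valued field of characteristic $p>0$. Let $D$ be a finite-dimensional division algebra with center $F$ whose degree is a power of $p$, equipped with the valuation (again denoted $v$) extending the valuation on $F$. Assume that $(D,v)$ is semi-ramified, that the residue field extension $\overline{D}/\overline{F}$ is separable, and that $(D,v)$ is not strongly degenerate. If $L\subset D$ is a subfield which is Galois over $F$ with group $G'$, then $L$ is inertial over $F$ and, in particular, $G'$ is an image (homomorphic quotient) of $G=\mathrm{Gal}(\overline{D}/\overline{F})$.
   Context: For a valued division algebra $(D,v)$ with center $F$ (finite-dimensional over $F$), $\overline{D}$ denotes the residue division algebra, $\Gamma_D=v(D^* )$ the value group (a totally ordered abelian group), and similarly for sub-division algebras such as $F$ and subfields $L$ (with the restricted valuation). $(D,v)$ is semi-ramified if $\overline{D}$ is a field and $[\overline{D}:\overline{F}]=|\Gamma_D:\Gamma_F|=\sqrt{[D:F]}$. If $(D,v)$ is semi-ramified with $\overline D/\overline F$ separable, then $\overline D/\overline F$ is abelian Galois and the map $\theta_D:\Gamma_D/\Gamma_F\to\mathrm{Gal}(\overline D/\overline F)$, where $\theta_D(v(x)+\Gamma_F)$ is the automorphism $\overline d\mapsto\overline{xdx^{-1}}$, is an isomorphism. Choose a basis $\sigma_1,\dots,\sigma_r$ of the finite abelian group $G=\mathrm{Gal}(\overline D/\overline F)$ (so $G=\langle\sigma_1\rangle\times\cdots\times\langle\sigma_r\rangle$) and $\pi_i\in D^*$ with $\theta_D(v(\pi_i)+\Gamma_F)=\sigma_i$. For $\overline m=(m_1,\dots,m_r)\in\mathbb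 N^r$ put $\sigma^{\overline m}=\sigma_1^{m_1}\cdots\sigma_r^{m_r}$, $\pi^{\overline m}=\pi_1^{m_1}\cdots\pi_r^{m_r}$, and let $\bar u_{\overline m,\overline n}\in\overline D^*$ be the residue of $\pi^{\overline m}\pi^{\overline n}(\pi^{\overline m})^{-1}(\pi^{\overline n})^{-1}$; write $\bar u_{i,\overline m}$ for $\bar u_{e_i,\overline m}$, with $e_i$ the $i$-th standard basis vector. $(D,v)$ is strongly degenerate if there exist $\sigma^{\overline m}\in G$ of prime order and $l,k_1,\dots,k_r\in\overline D^*$ such that for all $1\le i\le r$, $\bar u_{i,\overline m}=\sigma^{\overline m}(k_i)k_i^{-1}\,\sigma_i(l)l^{-1}$. (This does not depend on the choices made.) A valued field extension $L/F$ is inertial if $[L:F]=[\overline L:\overline F]$ and $\overline L/\overline F$ is separable. *)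

theory Defs
  imports "HOL-Algebra.Algebra" "HOL-Computational_Algebra.Primes"
begin

section \<open>Division rings, characteristic, Galois groups, separability\<close>

locale skew_field = ring R for R (structure) +
  assumes one_neq_zero: "\<one> \<noteq> \<zero>"
    and units_eq: "Units R = carrier R - {\<zero>}"

definition ring_center :: "('a, 'b) ring_scheme \<Rightarrow> 'a set" where
  "ring_center R = {x \<in> carrier R. \<forall>y\<in>carrier R. x \<otimes>\<^bsub>R\<^esub> y = y \<otimes>\<^bsub>R\<^esub> x}"

text \<open>The degree of a central division algebra is the square root of its dimension.\<close>

definition central_division_algebra :: "('a, 'b) ring_scheme \<Rightarrow> 'a set \<Rightarrow> nat \<Rightarrow> bool" where
  "central_division_algebra D F d \<longleftrightarrow>
     skew_field D \<and> F = ring_center D \<and> ring.dimension D (d\<^sup>2) F (carrier D)"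

definition has_characteristic :: "('a, 'b) ring_scheme \<Rightarrow> nat \<Rightarrow> bool" where
  "has_characteristic R p \<longleftrightarrow> (\<forall>n::nat. [n] \<cdot>\<^bsub>R\<^esub> \<one>\<^bsub>R\<^esub> = \<zero>\<^bsub>R\<^esub> \<longleftrightarrow> p dvd n)"

definition gal_group :: "('a, 'b) ring_scheme \<Rightarrow> 'a set \<Rightarrow> ('a \<Rightarrow> 'a) monoid" where
  "gal_group E K = (BijGroup (carrier E))
     \<lparr>carrier := {f \<in> ring_iso E E \<inter> extensional (carrier E). \<forall>x\<in>K. f x = x}\<rparr>"

definition galois_extension :: "('a, 'b) ring_scheme \<Rightarrow> 'a set \<Rightarrow> bool" where
  "galois_extension E K \<longleftrightarrow>
     field E \<and> subfield K E \<and> ring.finite_dimension E K (carrier E) \<and>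
     {x \<in> carrier E. \<forall>f\<in>carrier (gal_group E K). f x = x} = K"

text \<open>Polynomials are lists of coefficients, leading coefficient first. The result of
  \<open>formal_deriv\<close> may have leading zeros.\<close>

fun formal_deriv :: "('a, 'b) ring_scheme \<Rightarrow> 'a list \<Rightarrow> 'a list" where
  "formal_deriv R [] = []"
| "formal_deriv R [a] = []"
| "formal_deriv R (a # b # p) = [Suc (length p)] \<cdot>\<^bsub>R\<^esub> a # formal_deriv R (b # p)"

definition separable_poly :: "('a, 'b) ring_scheme \<Rightarrow> 'a set \<Rightarrow> 'a list \<Rightarrow> bool" where
  "separable_poly R K f \<longleftrightarrow>
     (\<forall>d\<in>carrier (K[X]\<^bsub>R\<^esub>). d divides\<^bsub>K[X]\<^bsub>R\<^esub>\<^esub> f \<and>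
        d divides\<^bsub>K[X]\<^bsub>R\<^esub>\<^esub> ring.normalize R (formal_deriv R f) \<longrightarrow> d \<in> Units (K[X]\<^bsub>R\<^esub>))"

text \<open>Here \<open>K\<close> and \<open>E\<close> are subfields of the field \<open>R\<close>; \<open>ring.Irr\<close> is the minimal polynomial.\<close>

definition separable_extension :: "('a, 'b) ring_scheme \<Rightarrow> 'a set \<Rightarrow> 'a set \<Rightarrow> bool" where
  "separable_extension R K E \<longleftrightarrow>
     (\<forall>x\<in>E. \<not> ring.transcendental R K x \<and> separable_poly R K (ring.Irr R K x))"


section \<open>Valuations\<close>

text \<open>The valuation is written additively; its value at zero (conventionally infinity)
  is left unspecified and never used.\<close>

definition valuation :: "('a, 'b) ring_scheme \<Rightarrow> ('a \<Rightarrow> 'g::linordered_ab_group_add) \<Rightarrow> bool" where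
  "valuation R v \<longleftrightarrow>
     (\<forall>x\<in>carrier R - {\<zero>\<^bsub>R\<^esub>}. \<forall>y\<in>carrier R - {\<zero>\<^bsub>R\<^esub>}.
        v (x \<otimes>\<^bsub>R\<^esub> y) = v x + v y \<and>
        (x \<oplus>\<^bsub>R\<^esub> y \<noteq> \<zero>\<^bsub>R\<^esub> \<longrightarrow> min (v x) (v y) \<le> v (x \<oplus>\<^bsub>R\<^esub> y)))"

definition val_ring :: "('a, 'b) ring_scheme \<Rightarrow> ('a \<Rightarrow> 'g::linordered_ab_group_add) \<Rightarrow> 'a set" where
  "val_ring R v = {x \<in> carrier R. x = \<zero>\<^bsub>R\<^esub> \<or> 0 \<le> v x}"

definition val_ideal :: "('a, 'b) ring_scheme \<Rightarrow> ('a \<Rightarrow> 'g::linordered_ab_group_add) \<Rightarrow> 'a set" where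
  "val_ideal R v = {x \<in> carrier R. x = \<zero>\<^bsub>R\<^esub> \<or> 0 < v x}"

definition residue_ring :: "('a, 'b) ring_scheme \<Rightarrow> ('a \<Rightarrow> 'g::linordered_ab_group_add) \<Rightarrow> 'a set ring" where
  "residue_ring R v = R\<lparr>carrier := val_ring R v\<rparr> Quot val_ideal R v"

definition residue :: "('a, 'b) ring_scheme \<Rightarrow> ('a \<Rightarrow> 'g::linordered_ab_group_add) \<Rightarrow> 'a \<Rightarrow> 'a set" where
  "residue R v x = val_ideal R v +>\<^bsub>R\<^esub> x"

text \<open>The residue ring of a sub-division ring \<open>K\<close> of \<open>R\<close>, embedded into the residue ring of \<open>R\<close>.\<close>

definition sub_residue :: "('a, 'b) ring_scheme \<Rightarrow> ('a \<Rightarrow> 'g::linordered_ab_group_add) \<Rightarrow> 'a set \<Rightarrow> 'a set set" where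
  "sub_residue R v K = residue R v ` (val_ring R v \<inter> K)"

definition value_group :: "('a, 'b) ring_scheme \<Rightarrow> ('a \<Rightarrow> 'g::linordered_ab_group_add) \<Rightarrow> 'g monoid" where
  "value_group R v = \<lparr>carrier = v ` (carrier R - {\<zero>\<^bsub>R\<^esub>}), monoid.mult = (+), one = 0\<rparr>"

definition value_index :: "('a, 'b) ring_scheme \<Rightarrow> ('a \<Rightarrow> 'g::linordered_ab_group_add) \<Rightarrow> 'a set \<Rightarrow> nat" where
  "value_index R v K =
     card (rcosets\<^bsub>value_group R v\<^esub> (carrier (value_group (R\<lparr>carrier := K\<rparr>) v)))"

definition henselian :: "('a, 'b) ring_scheme \<Rightarrow> ('a \<Rightarrow> 'g::linordered_ab_group_add) \<Rightarrow> bool" where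
  "henselian K v \<longleftrightarrow>
     field K \<and> valuation K v \<and>
     (\<forall>f\<in>carrier ((val_ring K v)[X]\<^bsub>K\<^esub>). \<forall>a\<in>val_ring K v.
        f \<noteq> [] \<and> lead_coeff f = \<one>\<^bsub>K\<^esub> \<and>
        ring.eval K f a \<in> val_ideal K v \<and>
        ring.eval K (formal_deriv K f) a \<notin> val_ideal K v \<longrightarrow>
        (\<exists>b\<in>val_ring K v. ring.eval K f b = \<zero>\<^bsub>K\<^esub> \<and> b \<ominus>\<^bsub>K\<^esub> a \<in> val_ideal K v))"

definition inertial :: "('a, 'b) ring_scheme \<Rightarrow> ('a \<Rightarrow> 'g::linordered_ab_group_add) \<Rightarrow> 'a set \<Rightarrow> 'a set \<Rightarrow> bool" where
  "inertial D v F L \<longleftrightarrow>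
     (\<exists>n. ring.dimension D n F L \<and>
          ring.dimension (residue_ring D v) n (sub_residue D v F) (sub_residue D v L)) \<and>
     separable_extension (residue_ring D v) (sub_residue D v F) (sub_residue D v L)"

definition semi_ramified :: "('a, 'b) ring_scheme \<Rightarrow> ('a \<Rightarrow> 'g::linordered_ab_group_add) \<Rightarrow> 'a set \<Rightarrow> bool" where
  "semi_ramified D v F \<longleftrightarrow>
     field (residue_ring D v) \<and>
     (\<exists>n. ring.dimension (residue_ring D v) n (sub_residue D v F) (carrier (residue_ring D v)) \<and>
          value_index D v F = n \<and>
          ring.dimension D (n\<^sup>2) F (carrier D))"

definition residue_gal :: "('a, 'b) ring_scheme \<Rightarrow> ('a \<Rightarrow> 'g::linordered_ab_group_add) \<Rightarrow> 'a set \<Rightarrow> ('a set \<Rightarrow> 'a set) monoid" where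
  "residue_gal D v F = gal_group (residue_ring D v) (sub_residue D v F)"


section \<open>Strong degeneracy\<close>

text \<open>The product of the powers of \<open>x 0, \<dots>, x (r - 1)\<close> with exponents \<open>m\<close>, in this order; the factors
  need not commute.\<close>

primrec monomial :: "('c, 'd) monoid_scheme \<Rightarrow> nat \<Rightarrow> (nat \<Rightarrow> 'c) \<Rightarrow> (nat \<Rightarrow> nat) \<Rightarrow> 'c" where
  "monomial M 0 x m = \<one>\<^bsub>M\<^esub>"
| "monomial M (Suc r) x m = monomial M r x m \<otimes>\<^bsub>M\<^esub> x r [^]\<^bsub>M\<^esub> m r"

definition internal_basis :: "('c, 'd) monoid_scheme \<Rightarrow> nat \<Rightarrow> (nat \<Rightarrow> 'c) \<Rightarrow> bool" where
  "internal_basis G r \<sigma> \<longleftrightarrow>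
     (\<forall>i<r. \<sigma> i \<in> carrier G) \<and>
     (\<lambda>y. \<Otimes>\<^bsub>G\<^esub>i\<in>{..<r}. y i) \<in> iso (product_group {..<r} (\<lambda>i. subgroup_generated G {\<sigma> i})) G"

text \<open>A basis \<open>\<sigma>\<close> of the Galois group of the residue extension together with elements \<open>\<pi> i\<close>
  such that \<open>\<theta>\<^sub>D\<close> maps the class of \<open>v (\<pi> i)\<close> to \<open>\<sigma> i\<close>: the last clause says that \<open>\<sigma> i\<close> is the
  automorphism induced on residues by conjugation with \<open>\<pi> i\<close>.\<close>

definition basis_with_lifts ::
  "('a, 'b) ring_scheme \<Rightarrow> ('a \<Rightarrow> 'g::linordered_ab_group_add) \<Rightarrow> 'a set \<Rightarrow>
   nat \<Rightarrow> (nat \<Rightarrow> 'a set \<Rightarrow> 'a set) \<Rightarrow> (nat \<Rightarrow> 'a) \<Rightarrow> bool" where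
  "basis_with_lifts D v F r \<sigma> \<pi> \<longleftrightarrow>
     internal_basis (residue_gal D v F) r \<sigma> \<and>
     (\<forall>i<r. \<pi> i \<in> carrier D - {\<zero>\<^bsub>D\<^esub>} \<and>
        (\<forall>d\<in>val_ring D v. \<sigma> i (residue D v d) = residue D v (\<pi> i \<otimes>\<^bsub>D\<^esub> d \<otimes>\<^bsub>D\<^esub> inv\<^bsub>D\<^esub> \<pi> i)))"

definition u_bar ::
  "('a, 'b) ring_scheme \<Rightarrow> ('a \<Rightarrow> 'g::linordered_ab_group_add) \<Rightarrow> nat \<Rightarrow> (nat \<Rightarrow> 'a) \<Rightarrow>
   (nat \<Rightarrow> nat) \<Rightarrow> (nat \<Rightarrow> nat) \<Rightarrow> 'a set" where
  "u_bar D v r \<pi> m n =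
     residue D v (monomial D r \<pi> m \<otimes>\<^bsub>D\<^esub> monomial D r \<pi> n \<otimes>\<^bsub>D\<^esub>
       inv\<^bsub>D\<^esub> (monomial D r \<pi> m) \<otimes>\<^bsub>D\<^esub> inv\<^bsub>D\<^esub> (monomial D r \<pi> n))"

definition unit_vec :: "nat \<Rightarrow> nat \<Rightarrow> nat" where
  "unit_vec i = (\<lambda>j. if j = i then 1 else 0)"

text \<open>Strong degeneracy with respect to a choice of \<open>\<sigma>\<close> and \<open>\<pi>\<close>. The name \<open>prime\<close> is qualified
  because HOL-Algebra has its own constant of that name.\<close>

definition strongly_degenerate ::
  "('a, 'b) ring_scheme \<Rightarrow> ('a \<Rightarrow> 'g::linordered_ab_group_add) \<Rightarrow> 'a set \<Rightarrow>
   nat \<Rightarrow> (nat \<Rightarrow> 'a set \<Rightarrow> 'a set) \<Rightarrow> (nat \<Rightarrow> 'a) \<Rightarrow> bool" where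
  "strongly_degenerate D v F r \<sigma> \<pi> \<longleftrightarrow>
     (let G = residue_gal D v F; E = residue_ring D v in
      \<exists>m l k.
        Factorial_Ring.prime (group.ord G (monomial G r \<sigma> m)) \<and>
        l \<in> carrier E - {\<zero>\<^bsub>E\<^esub>} \<and>
        (\<forall>i<r. k i \<in> carrier E - {\<zero>\<^bsub>E\<^esub>} \<and>
           u_bar D v r \<pi> (unit_vec i) m =
             (monomial G r \<sigma> m) (k i) \<otimes>\<^bsub>E\<^esub> inv\<^bsub>E\<^esub> (k i) \<otimes>\<^bsub>E\<^esub> (\<sigma> i l \<otimes>\<^bsub>E\<^esub> inv\<^bsub>E\<^esub> l)))"

end

(* Every g in G' preserves v on L: by Wedderburn's factorization the minimal polynomial of a over F splits
   over D into conjugates of a, so g(a) is conjugate to a in D. The same factorization shows that the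
   fixed field of conjugation on the residue field is that of F, hence conjugation identifies the value
   group modulo that of F with the residue Galois group.
   Suppose L has a value outside the value group of F. Some such value becomes a value of F after
   multiplication by p. Since the residue characteristic is p, Hilbert 90 for the reduction of G' gives
   an element a of that value with g(a)/a of residue 1 for all g in G'; then a^p equals an element of F up
   to a unit of residue 1. In the associated graded ring the leading term of a therefore has a central
   p-th power, and Hilbert 90 for conjugation by a shows that it commutes with suitable homogeneous
   elements of every degree. This is strong degeneracy. Hence L is unramified, and
   [D:F] = e f together with [D:L] >= e f for D/L makes L inertial. Finally the residue field of L has
   at most [L:F] embeddings, so the reductions of G' are exactly the restrictions of the residue
   automorphisms. *)

theory Submission
  imports Defs
begin

section \<open>Polynomials over division rings\<close>

text \<open>The obstacle is that L might be ramified, so its Galois group need not act faithfully on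
  the residue field of L, while Hilbert 90 needs a cocycle on the group that acts there. If the p-th
  power of \<open>a\<close> has a value in that of F, the residues of \<open>g(a)/a\<close> form a
  cocycle on the full Galois group. Their p-th powers depend only on the action of g on one residue,
  and Frobenius is injective, so the cocycle itself descends to the reduced group.

  Fixed fields of residues are found by one argument, used for conjugation in D and for the Galois
  group of L: a lift of an invariant residue e is a root of a polynomial over F that splits into
  factors \<open>t - c\<close> with every c of residue e. It reduces to a power of
  \<open>t - e\<close>, and separability puts e into the residue field of F. For this double use the
  splitting lemma allows any family of endomorphisms.

  The graded ring is not built: residues of commutators carry the part of its structure that strong
  degeneracy speaks about. Equalities of groups come from playing Artin's lower bound against
  Dedekind's upper bound.\<close>

context skew_field
begin

lemma nonzero_unit: "x \<in> carrier R \<Longrightarrow> x \<noteq> \<zero> \<Longrightarrow> x \<in> Units R"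
  using units_eq by auto

lemma inv_carrier [simp]: "x \<in> carrier R \<Longrightarrow> x \<noteq> \<zero> \<Longrightarrow> inv x \<in> carrier R"
  using nonzero_unit by auto

lemma inv_right [simp]: "x \<in> carrier R \<Longrightarrow> x \<noteq> \<zero> \<Longrightarrow> x \<otimes> inv x = \<one>"
  using nonzero_unit by auto

lemma inv_left [simp]: "x \<in> carrier R \<Longrightarrow> x \<noteq> \<zero> \<Longrightarrow> inv x \<otimes> x = \<one>"
  using nonzero_unit by auto

lemma inv_nonzero [simp]: "x \<in> carrier R \<Longrightarrow> x \<noteq> \<zero> \<Longrightarrow> inv x \<noteq> \<zero>"
  by (metis inv_carrier inv_right one_neq_zero r_null)

lemma mult_nonzero [simp]:
  assumes "x \<in> carrier R" "x \<noteq> \<zero>" "y \<in> carrier R" "y \<noteq> \<zero>"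
  shows "x \<otimes> y \<noteq> \<zero>"
proof
  assume "x \<otimes> y = \<zero>"
  then have "inv x \<otimes> (x \<otimes> y) = \<zero>" using assms by simp
  then show False using assms by (simp add: m_assoc[symmetric])
qed

lemma inv_cancel [simp]:
  assumes "x \<in> carrier R" "x \<noteq> \<zero>" "y \<in> carrier R"
  shows "x \<otimes> (inv x \<otimes> y) = y" "inv x \<otimes> (x \<otimes> y) = y"
  using assms by (simp_all add: m_assoc[symmetric])

lemma inv_unique_right:
  assumes "x \<in> carrier R" "y \<in> carrier R" "x \<otimes> y = \<one>" shows "inv x = y"
proof -
  have "x \<noteq> \<zero>" using assms one_neq_zero by auto
  then have "inv x \<otimes> (x \<otimes> y) = y" using assms(1,2) inv_cancel by blast
  then show ?thesis using assms \<open>x \<noteq> \<zero>\<close> by simp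
qed

lemma inv_mult_nonzero [simp]:
  assumes "x \<in> carrier R" "x \<noteq> \<zero>" "y \<in> carrier R" "y \<noteq> \<zero>"
  shows "inv (x \<otimes> y) = inv y \<otimes> inv x"
  by (rule inv_unique_right) (use assms in \<open>simp_all add: m_assoc\<close>)

lemma inv_inv_nonzero [simp]: "x \<in> carrier R \<Longrightarrow> x \<noteq> \<zero> \<Longrightarrow> inv (inv x) = x"
  by (rule inv_unique_right) auto

lemma pow_nonzero [simp]: "x \<in> carrier R \<Longrightarrow> x \<noteq> \<zero> \<Longrightarrow> x [^] (n::nat) \<noteq> \<zero>"
  by (induction n) (auto simp: one_neq_zero)

end

text \<open>A polynomial over a noncommutative ring is a list of coefficients, constant term first,
  together with a separate leading coefficient \<open>l\<close>; coefficients are written to the left of the unknown.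
  \<open>peval l p y b\<close> is the sum of the terms \<open>a\<^sub>i y b\<^sup>i\<close>, that is, the polynomial acting on \<open>y\<close> when the
  unknown acts as right multiplication by \<open>b\<close>.\<close>

fun (in ring) peval :: "'a \<Rightarrow> 'a list \<Rightarrow> 'a \<Rightarrow> 'a \<Rightarrow> 'a" where
  "peval l [] y b = l \<otimes> y"
| "peval l (a # p) y b = a \<otimes> y \<oplus> peval l p y b \<otimes> b"

text \<open>For monic \<open>q\<close>, \<open>rlin c s q\<close> is \<open>q (t - c) + s\<close>, \<open>llin c s q\<close> is \<open>(t - c) q + s\<close>, and
  \<open>lquot c q\<close> is the quotient in the division of \<open>q\<close> by \<open>t - c\<close> from the right.\<close>

fun (in ring) rlin :: "'a \<Rightarrow> 'a \<Rightarrow> 'a list \<Rightarrow> 'a list" where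
  "rlin c s [] = [s \<ominus> c]"
| "rlin c s (a # p) = (s \<ominus> a \<otimes> c) # rlin c a p"

fun (in ring) llin :: "'a \<Rightarrow> 'a \<Rightarrow> 'a list \<Rightarrow> 'a list" where
  "llin c s [] = [s \<ominus> c]"
| "llin c s (a # p) = (s \<ominus> c \<otimes> a) # llin c a p"

fun (in ring) lquot :: "'a \<Rightarrow> 'a list \<Rightarrow> 'a list" where
  "lquot c [] = []"
| "lquot c [a] = []"
| "lquot c (a # b # p) = peval \<one> (b # p) \<one> c # lquot c (b # p)"

text \<open>The leading coefficient is implicit, so the seed \<open>[]\<close> is the constant
  polynomial 1. The head of \<open>cs\<close> becomes the rightmost factor, which acts first under
  \<open>peval\<close>.\<close>

definition (in ring) linear_product :: "'a list \<Rightarrow> 'a list" where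
  "linear_product cs = foldr (\<lambda>c. rlin c \<zero>) cs []"

section \<open>Evaluation, synthetic division and products of linear factors\<close>

context ring
begin

lemma add_diff_add_left:
  assumes "a \<in> carrier R" "s \<in> carrier R" "e \<in> carrier R"
  shows "a \<oplus> s \<ominus> (a \<oplus> e) = s \<ominus> e"
proof -
  have "a \<oplus> s \<ominus> (a \<oplus> e) = (a \<oplus> \<ominus> a) \<oplus> (s \<oplus> \<ominus> e)"
    using assms by (simp add: minus_eq minus_add a_ac)
  then show ?thesis using assms by (simp add: r_neg minus_eq)
qed

lemma peval_closed [simp]:
  "l \<in> carrier R \<Longrightarrow> set p \<subseteq> carrier R \<Longrightarrow> y \<in> carrier R \<Longrightarrow> b \<in> carrier R \<Longrightarrow>
   peval l p y b \<in> carrier R"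
  by (induction p) auto

lemma rlin_closed:
  "c \<in> carrier R \<Longrightarrow> s \<in> carrier R \<Longrightarrow> set q \<subseteq> carrier R \<Longrightarrow> set (rlin c s q) \<subseteq> carrier R"
  by (induction q arbitrary: s) auto

lemma llin_closed:
  "c \<in> carrier R \<Longrightarrow> s \<in> carrier R \<Longrightarrow> set q \<subseteq> carrier R \<Longrightarrow> set (llin c s q) \<subseteq> carrier R"
  by (induction q arbitrary: s) auto

lemma linear_product_closed: "set cs \<subseteq> carrier R \<Longrightarrow> set (linear_product cs) \<subseteq> carrier R"
proof (induction cs)
  case (Cons c cs)
  then show ?case using rlin_closed[of c \<zero> "linear_product cs"] by (simp add: linear_product_def)
qed (simp add: linear_product_def)

lemma length_llin [simp]: "length (llin c s q) = Suc (length q)"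
  by (induction q arbitrary: s) auto

lemma lquot_closed: "c \<in> carrier R \<Longrightarrow> set q \<subseteq> carrier R \<Longrightarrow> set (lquot c q) \<subseteq> carrier R"
proof (induction q rule: lquot.induct)
  case (3 c a b p)
  then show ?case using peval_closed[of \<one> "b # p" \<one> c] by auto
qed auto

lemma length_lquot [simp]: "length (lquot c q) = length q - 1"
  by (induction q rule: lquot.induct) auto

text \<open>Coefficients multiply from the left and the unknown from the right; these operations
  commute, so a product of polynomials acts as the composite of its factors. Evaluation at a point
  alone is not multiplicative over a noncommutative ring, hence the extra argument
  \<open>y\<close>.\<close>

lemma peval_rlin:
  assumes "c \<in> carrier R" "s \<in> carrier R" "set q \<subseteq> carrier R" "y \<in> carrier R" "b \<in> carrier R"
  shows "peval \<one> (rlin c s q) y b = s \<otimes> y \<oplus> peval \<one> q (y \<otimes> b \<ominus> c \<otimes> y) b"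
  using assms
proof (induction q arbitrary: s)
  case Nil
  then show ?case by (simp add: l_distr r_distr minus_eq l_minus r_minus a_ac)
next
  case (Cons a q)
  have "peval \<one> q (y \<otimes> b \<ominus> c \<otimes> y) b \<in> carrier R" using Cons.prems by simp
  then show ?case using Cons by (simp add: l_distr r_distr minus_eq minus_add l_minus r_minus a_ac m_assoc)
qed

text \<open>The new left factor \<open>t - c\<close> acts on the value that \<open>q\<close> has
  already produced.\<close>

lemma peval_llin:
  assumes "c \<in> carrier R" "s \<in> carrier R" "set q \<subseteq> carrier R" "b \<in> carrier R"
  shows "peval \<one> (llin c s q) \<one> b = s \<oplus> (peval \<one> q \<one> b \<otimes> b \<ominus> c \<otimes> peval \<one> q \<one> b)"
  using assms
proof (induction q arbitrary: s)
  case Nil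
  then show ?case by (simp add: l_distr r_distr minus_eq l_minus r_minus a_ac)
next
  case (Cons a q)
  have "peval \<one> q \<one> b \<in> carrier R" using Cons.prems by simp
  then show ?case using Cons by (simp add: l_distr r_distr minus_eq minus_add l_minus r_minus a_ac m_assoc)
qed

text \<open>The relation \<open>c \<otimes> z = z \<otimes> b\<close> propagates to all powers of
  \<open>b\<close> and \<open>c\<close>. In the factorization \<open>z\<close> is the value of a
  right factor at \<open>b\<close>, and the lemma turns it into a root \<open>c\<close> of the left
  factor.\<close>

lemma peval_transport:
  assumes "l \<in> carrier R" "set q \<subseteq> carrier R" "z \<in> carrier R" "b \<in> carrier R" "c \<in> carrier R"
    and "c \<otimes> z = z \<otimes> b"
  shows "peval l q z b = peval l q \<one> c \<otimes> z"
  using assms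
proof (induction q)
  case (Cons a q)
  then have "peval l q \<one> c \<in> carrier R" by simp
  then show ?case using Cons by (simp add: l_distr m_assoc)
qed simp

text \<open>Horner's scheme: the quotient coefficients are the values at \<open>c\<close> of the
  tails. The shift \<open>s\<close> is general because \<open>rlin\<close> passes the previous
  quotient coefficient to its recursive call, where it cancels the remainder of the tail
  exactly.\<close>

lemma rlin_lquot:
  assumes "c \<in> carrier R" "s \<in> carrier R" "set (a # q) \<subseteq> carrier R"
  shows "rlin c s (lquot c (a # q)) = (a \<oplus> s \<ominus> peval \<one> (a # q) \<one> c) # q"
  using assms
proof (induction q arbitrary: a s)
  case Nil
  then show ?case
    by (simp add: add_diff_add_left)
next
  case (Cons b q)
  define e where "e = peval \<one> (b # q) \<one> c"
  have e: "e \<in> carrier R" unfolding e_def using Cons.prems by (intro peval_closed) auto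
  have "rlin c e (lquot c (b # q)) = (b \<oplus> e \<ominus> e) # q"
    using Cons.IH[of e b] e Cons.prems unfolding e_def by simp
  also have "b \<oplus> e \<ominus> e = b" using e Cons.prems by (simp add: minus_eq a_assoc r_neg)
  finally have "rlin c e (lquot c (b # q)) = b # q" .
  moreover have "a \<oplus> s \<ominus> (a \<oplus> e \<otimes> c) = s \<ominus> e \<otimes> c"
    using Cons.prems e by (simp add: add_diff_add_left)
  ultimately show ?case using Cons.prems e unfolding e_def by simp
qed

lemma rlin_lquot_root:
  assumes "c \<in> carrier R" "set q \<subseteq> carrier R" "q \<noteq> []" "peval \<one> q \<one> c = \<zero>"
  shows "rlin c \<zero> (lquot c q) = q"
proof -
  obtain a p where q: "q = a # p" using assms(3) by (cases q) auto
  show ?thesis using rlin_lquot[of c \<zero> a p] assms unfolding q by (simp add: minus_eq)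
qed

lemma peval_diff:
  assumes "length p = length q" "l \<in> carrier R" "l' \<in> carrier R" "set p \<subseteq> carrier R" "set q \<subseteq> carrier R"
    "y \<in> carrier R" "b \<in> carrier R"
  shows "peval (l \<ominus> l') (map2 (\<lambda>x y. x \<ominus> y) p q) y b = peval l p y b \<ominus> peval l' q y b"
  using assms
proof (induction p q rule: list_induct2)
  case Nil
  then show ?case by (simp add: minus_eq l_distr l_minus)
next
  case (Cons x xs z zs)
  then show ?case
    by (simp add: minus_eq l_distr l_minus minus_add a_ac)
qed

lemma peval_smult:
  assumes "u \<in> carrier R" "l \<in> carrier R" "set p \<subseteq> carrier R" "y \<in> carrier R" "b \<in> carrier R"
  shows "peval (u \<otimes> l) (map ((\<otimes>) u) p) y b = u \<otimes> peval l p y b"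
  using assms by (induction p) (simp_all add: r_distr m_assoc)

lemma peval_append_single:
  assumes "set p \<subseteq> carrier R" "a \<in> carrier R" "y \<in> carrier R" "b \<in> carrier R"
  shows "peval \<zero> (p @ [a]) y b = peval a p y b"
  using assms by (induction p) simp_all

text \<open>With implicit leading coefficient \<open>\<zero>\<close> a list is an arbitrary
  polynomial; removing zeros from its end exposes the true leading coefficient, which then leaves
  the list.\<close>

lemma peval_leading_coeff:
  assumes "set p \<subseteq> carrier R" "\<not> set p \<subseteq> {\<zero>}"
  obtains q a where "set q \<subseteq> set p" "a \<in> set p" "a \<noteq> \<zero>" "length q < length p"
    "\<And>y b. y \<in> carrier R \<Longrightarrow> b \<in> carrier R \<Longrightarrow> peval a q y b = peval \<zero> p y b"
  using assms
proof (induction p arbitrary: thesis rule: rev_induct)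
  case (snoc a p)
  show ?case
  proof (cases "a = \<zero>")
    case True
    have p: "set p \<subseteq> carrier R" "\<not> set p \<subseteq> {\<zero>}" using snoc.prems True by auto
    show ?thesis
    proof (rule snoc.IH[OF _ p])
      fix q a' assume q: "set q \<subseteq> set p" "a' \<in> set p" "a' \<noteq> \<zero>" "length q < length p"
        "\<And>y b. y \<in> carrier R \<Longrightarrow> b \<in> carrier R \<Longrightarrow> peval a' q y b = peval \<zero> p y b"
      show thesis
        by (rule snoc.prems(1)[of q a']) (use q p True in \<open>auto simp: peval_append_single\<close>)
    qed
  next
    case False
    show ?thesis
      by (rule snoc.prems(1)[of p a]) (use False snoc.prems in \<open>auto simp: peval_append_single\<close>)
  qed
qed simp

end

context skew_field
begin

text \<open>In monic form the list is strictly shorter, as arguments by least degree require. That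
  \<open>inv u\<close> is one of the coefficients lets a caller keep \<open>u\<close> inside a
  subfield.\<close>

lemma peval_normalise:
  assumes "set p \<subseteq> carrier R" "\<not> set p \<subseteq> {\<zero>}"
  obtains q u where "u \<in> carrier R" "u \<noteq> \<zero>" "inv u \<in> set p" "set q \<subseteq> (\<otimes>) u ` set p" "length q < length p"
    "\<And>y b. y \<in> carrier R \<Longrightarrow> b \<in> carrier R \<Longrightarrow> peval \<one> q y b = u \<otimes> peval \<zero> p y b"
proof -
  obtain q a where q: "set q \<subseteq> set p" "a \<in> set p" "a \<noteq> \<zero>" "length q < length p"
    "\<And>y b. y \<in> carrier R \<Longrightarrow> b \<in> carrier R \<Longrightarrow> peval a q y b = peval \<zero> p y b"
    using peval_leading_coeff[OF assms] by metis
  have a: "a \<in> carrier R" using q assms by auto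
  show thesis
  proof (rule that[of "inv a" "map ((\<otimes>) (inv a)) q"])
    fix y b assume yb: "y \<in> carrier R" "b \<in> carrier R"
    have "peval (inv a \<otimes> a) (map ((\<otimes>) (inv a)) q) y b = inv a \<otimes> peval a q y b"
      by (rule peval_smult) (use a q yb assms in auto)
    then show "peval \<one> (map ((\<otimes>) (inv a)) q) y b = inv a \<otimes> peval \<zero> p y b"
      using a q yb by simp
  qed (use a q in auto)
qed

text \<open>Apply the factors to \<open>y\<close> one at a time, starting with the rightmost. The
  factor \<open>t - c\<close> that first annihilates the current nonzero element \<open>z\<close>
  yields \<open>z \<otimes> b = c \<otimes> z\<close>; without such a factor the final result would
  be nonzero.\<close>

lemma peval_linear_product_root:
  assumes "set cs \<subseteq> carrier R" "y \<in> carrier R" "y \<noteq> \<zero>" "b \<in> carrier R"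
    and "peval \<one> (linear_product cs) y b = \<zero>"
  obtains c z where "c \<in> set cs" "z \<in> carrier R" "z \<noteq> \<zero>" "z \<otimes> b = c \<otimes> z"
proof -
  have "\<exists>c\<in>set cs. \<exists>z\<in>carrier R - {\<zero>}. z \<otimes> b = c \<otimes> z"
    using assms
  proof (induction cs arbitrary: y)
    case Nil
    then show ?case by (simp add: linear_product_def)
  next
    case (Cons c cs)
    have cl: "set (linear_product cs) \<subseteq> carrier R"
      using Cons.prems(1) linear_product_closed by simp
    have "peval \<one> (linear_product cs) (y \<otimes> b \<ominus> c \<otimes> y) b = \<zero>"
      using Cons.prems cl peval_rlin[of c \<zero> "linear_product cs" y b] by (simp add: linear_product_def)
    then show ?case
    proof (cases "y \<otimes> b \<ominus> c \<otimes> y = \<zero>")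
      case True
      then have "y \<otimes> b = c \<otimes> y" using Cons.prems by (simp add: r_right_minus_eq)
      then show ?thesis using Cons.prems by auto
    next
      case False
      then show ?thesis using Cons.IH[of "y \<otimes> b \<ominus> c \<otimes> y"] Cons.prems \<open>peval \<one> (linear_product cs) _ b = \<zero>\<close>
        by auto
    qed
  qed
  then show thesis using that by blast
qed

section \<open>Wedderburn's factorization\<close>

definition vanishes_on :: "'a list \<Rightarrow> 'a set \<Rightarrow> bool" where
  "vanishes_on f A \<longleftrightarrow> set f \<subseteq> carrier R \<and> (\<forall>b\<in>A. peval \<one> f \<one> b = \<zero>)"

text \<open>The source of uniqueness in least degree: the leading terms of two monic candidates
  cancel in the difference, which is nonzero and becomes monic after division.\<close>

lemma shorter_vanishing:
  assumes "vanishes_on f A" "vanishes_on g A" "length f = length g" "f \<noteq> g" "A \<subseteq> carrier R"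
  shows "\<exists>h. vanishes_on h A \<and> length h < length f"
proof -
  have car: "set f \<subseteq> carrier R" "set g \<subseteq> carrier R" using assms by (auto simp: vanishes_on_def)
  define d where "d = map2 (\<lambda>x y. x \<ominus> y) f g"
  have d: "set d \<subseteq> carrier R"
  proof
    fix x assume "x \<in> set d"
    then obtain a b where "(a, b) \<in> set (zip f g)" "x = a \<ominus> b" unfolding d_def by auto
    then show "x \<in> carrier R" using car set_zip_leftD[of a b f g] set_zip_rightD[of a b f g] by auto
  qed
  have "\<not> set d \<subseteq> {\<zero>}"
  proof
    assume *: "set d \<subseteq> {\<zero>}"
    have "f = g"
    proof (rule nth_equalityI)
      fix i assume i: "i < length f"
      have "i < length d" using i assms(3) by (simp add: d_def)
      then have "d ! i \<in> set d" by (rule nth_mem)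
      moreover have "d ! i = f ! i \<ominus> g ! i" using i assms(3) by (simp add: d_def)
      ultimately have "f ! i \<ominus> g ! i = \<zero>" using * by auto
      moreover have "f ! i \<in> carrier R" "g ! i \<in> carrier R" using car i assms(3) by auto
      ultimately show "f ! i = g ! i" by (simp add: r_right_minus_eq)
    qed (use assms in auto)
    then show False using assms by simp
  qed
  then obtain q u where q: "u \<in> carrier R" "u \<noteq> \<zero>" "set q \<subseteq> (\<otimes>) u ` set d" "length q < length d"
    "\<And>y b. y \<in> carrier R \<Longrightarrow> b \<in> carrier R \<Longrightarrow> peval \<one> q y b = u \<otimes> peval \<zero> d y b"
    using peval_normalise[OF d] by metis
  have "peval \<one> q \<one> b = \<zero>" if "b \<in> A" for b
  proof -
    have "peval (\<one> \<ominus> \<one>) d \<one> b = peval \<one> f \<one> b \<ominus> peval \<one> g \<one> b"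
      unfolding d_def by (rule peval_diff) (use assms car that in auto)
    then have "peval \<zero> d \<one> b = \<zero>" using assms that by (simp add: vanishes_on_def minus_eq r_neg)
    then show ?thesis using q that assms by auto
  qed
  moreover have "set q \<subseteq> carrier R"
  proof
    fix x assume "x \<in> set q"
    then obtain w where "w \<in> set d" "x = u \<otimes> w" using q(3) by blast
    then show "x \<in> carrier R" using q(1) d by auto
  qed
  moreover have "length d = length f" using assms by (simp add: d_def)
  ultimately show ?thesis using q unfolding vanishes_on_def by metis
qed

text \<open>Wedderburn's factorization: whenever a proper right factor \<open>h\<close> of \<open>f\<close> does not vanish at some
  \<open>b \<in> A\<close>, the cofactor has the conjugate of \<open>b\<close> by \<open>h(b)\<close> as a right root.\<close>

lemma minimal_vanishing_splits:
  assumes min: "\<And>h. vanishes_on h A \<Longrightarrow> m \<le> length h" and A: "A \<subseteq> carrier R"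
    and "vanishes_on f A" "length f = m"
  obtains cs where "f = linear_product cs"
    "\<And>c. c \<in> set cs \<Longrightarrow> \<exists>b\<in>A. \<exists>z\<in>carrier R - {\<zero>}. c = z \<otimes> b \<otimes> inv z"
proof -
  \<comment> \<open>\<open>h\<close> collects the linear factors already split off, and
    \<open>q\<close> is the cofactor still to be split. Recording only that \<open>q\<close>
    annihilates the values of \<open>h\<close> avoids forming the product of \<open>q\<close> and
    \<open>h\<close>.\<close>
  have "\<exists>cs. q = linear_product cs \<and> (\<forall>c\<in>set cs. \<exists>b\<in>A. \<exists>z\<in>carrier R - {\<zero>}. c = z \<otimes> b \<otimes> inv z)"
    if "length q + length h = m" "set q \<subseteq> carrier R" "set h \<subseteq> carrier R"
      "\<forall>b\<in>A. peval \<one> q (peval \<one> h \<one> b) b = \<zero>" for q h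
    using that
  proof (induction "length q" arbitrary: q h)
    case 0
    then show ?case by (intro exI[of _ "[]"]) (simp add: linear_product_def)
  next
    case (Suc n)
    \<comment> \<open>\<open>h\<close> has degree below the minimum \<open>m\<close> because
      \<open>q\<close> still has positive degree, so some value \<open>z\<close> of \<open>h\<close>
      on \<open>A\<close> is nonzero and can be inverted.\<close>
    have "\<not> vanishes_on h A" using min[of h] Suc by auto
    then obtain b where b: "b \<in> A" "peval \<one> h \<one> b \<noteq> \<zero>" using Suc.prems by (auto simp: vanishes_on_def)
    define z where "z = peval \<one> h \<one> b"
    have z: "z \<in> carrier R" "z \<noteq> \<zero>" "b \<in> carrier R" using b Suc.prems A by (auto simp: z_def)
    define c where "c = z \<otimes> b \<otimes> inv z"
    have c: "c \<in> carrier R" "c \<otimes> z = z \<otimes> b" using z by (auto simp: c_def m_assoc)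
    have "peval \<one> q \<one> c \<otimes> z = \<zero>"
      using peval_transport[of \<one> q z b c] Suc.prems b z c by (auto simp: z_def)
    then have "peval \<one> q \<one> c = \<zero>" using z c Suc.prems mult_nonzero[of "peval \<one> q \<one> c" z] by auto
    then have q: "rlin c \<zero> (lquot c q) = q" using rlin_lquot_root[of c q] c Suc.prems(2) Suc.hyps(2) by fastforce
    have lq: "set (lquot c q) \<subseteq> carrier R" using lquot_closed c Suc.prems by auto
    have "peval \<one> (lquot c q) (peval \<one> (llin c \<zero> h) \<one> b') b' = \<zero>" if b': "b' \<in> A" for b'
    proof -
      define y where "y = peval \<one> h \<one> b'"
      have y: "y \<in> carrier R" "b' \<in> carrier R" using Suc.prems b' A by (auto simp: y_def)
      have "peval \<one> (lquot c q) (peval \<one> (llin c \<zero> h) \<one> b') b' = peval \<one> (lquot c q) (y \<otimes> b' \<ominus> c \<otimes> y) b'"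
        using peval_llin[of c \<zero> h b'] c Suc.prems y by (simp add: y_def)
      also have "\<dots> = peval \<one> q y b'" using peval_rlin[of c \<zero> "lquot c q" y b'] q c lq y by simp
      finally show ?thesis using Suc.prems b' by (simp add: y_def)
    qed
    moreover have "length (lquot c q) + length (llin c \<zero> h) = m" "n = length (lquot c q)"
      using Suc by auto
    ultimately obtain cs where cs: "lquot c q = linear_product cs"
      "\<forall>c\<in>set cs. \<exists>b\<in>A. \<exists>z\<in>carrier R - {\<zero>}. c = z \<otimes> b \<otimes> inv z"
      using Suc.hyps(1)[of "lquot c q" "llin c \<zero> h"] lq c Suc.prems llin_closed[of c \<zero> h] by auto
    have "q = linear_product (c # cs)" using q cs by (simp add: linear_product_def)
    moreover have "\<exists>b\<in>A. \<exists>z\<in>carrier R - {\<zero>}. c = z \<otimes> b \<otimes> inv z" using b z unfolding c_def by auto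
    ultimately show ?case using cs by (intro exI[of _ "c # cs"]) auto
  qed
  from this[of f "[]"] assms A show thesis
    by (auto simp: vanishes_on_def subset_eq intro!: that)
qed

lemma peval_ring_hom:
  assumes "\<phi> \<in> ring_hom R S" "ring S" "set p \<subseteq> carrier R" "l \<in> carrier R" "y \<in> carrier R" "b \<in> carrier R"
  shows "ring.peval S (\<phi> l) (map \<phi> p) (\<phi> y) (\<phi> b) = \<phi> (peval l p y b)"
  using assms(3-)
  by (induction p) (simp_all add: ring.peval.simps[OF assms(2)] ring_hom_mult[OF assms(1)] ring_hom_add[OF assms(1)])

text \<open>The unique monic polynomial of least degree vanishing on a set is fixed by every automorphism
  that preserves the set.\<close>

lemma invariant_splitting_polynomial:
  assumes A: "A \<subseteq> carrier R" and ex: "vanishes_on f\<^sub>0 A"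
    and \<Phi>: "\<And>\<phi>. \<phi> \<in> \<Phi> \<Longrightarrow> \<phi> \<in> ring_hom R R" "\<And>\<phi>. \<phi> \<in> \<Phi> \<Longrightarrow> A \<subseteq> \<phi> ` A"
  obtains cs where "vanishes_on (linear_product cs) A"
    "\<And>\<phi> a. \<phi> \<in> \<Phi> \<Longrightarrow> a \<in> set (linear_product cs) \<Longrightarrow> \<phi> a = a"
    "\<And>c. c \<in> set cs \<Longrightarrow> \<exists>b\<in>A. \<exists>z\<in>carrier R - {\<zero>}. c = z \<otimes> b \<otimes> inv z"
proof -
  define m where "m = (LEAST n. \<exists>f. vanishes_on f A \<and> length f = n)"
  have "\<exists>f. vanishes_on f A \<and> length f = m"
    unfolding m_def by (rule LeastI_ex) (use ex in blast)
  then obtain f where f: "vanishes_on f A" "length f = m" by blast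
  have min: "m \<le> length h" if "vanishes_on h A" for h
    unfolding m_def by (rule Least_le) (use that in blast)
  obtain cs where cs: "f = linear_product cs"
    "\<And>c. c \<in> set cs \<Longrightarrow> \<exists>b\<in>A. \<exists>z\<in>carrier R - {\<zero>}. c = z \<otimes> b \<otimes> inv z"
    using minimal_vanishing_splits[OF min A f] by metis
  have fixed: "map \<phi> f = f" if "\<phi> \<in> \<Phi>" for \<phi>
  proof (rule ccontr)
    assume ne: "map \<phi> f \<noteq> f"
    have \<phi>: "\<phi> \<in> \<Phi>" by (rule that)
    have hom: "\<phi> \<in> ring_hom R R" by (rule \<Phi>(1)[OF \<phi>])
    have "vanishes_on (map \<phi> f) A"
      unfolding vanishes_on_def
    proof (intro conjI ballI)
      show "set (map \<phi> f) \<subseteq> carrier R" using f ring_hom_closed[OF hom] by (auto simp: vanishes_on_def)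
      fix b assume "b \<in> A"
      \<comment> \<open>This is why the image of \<open>A\<close> under \<open>\<phi>\<close> must
        contain \<open>A\<close>: a point of \<open>A\<close> is written as \<open>\<phi> a\<close>,
        and there the image polynomial takes the value \<open>\<phi> \<zero>\<close>.\<close>
      then obtain a where a: "a \<in> A" "b = \<phi> a" using \<Phi>(2)[OF \<phi>] by auto
      have "peval (\<phi> \<one>) (map \<phi> f) (\<phi> \<one>) (\<phi> a) = \<phi> (peval \<one> f \<one> a)"
        by (rule peval_ring_hom[OF hom ring_axioms]) (use f a A in \<open>auto simp: vanishes_on_def\<close>)
      then show "peval \<one> (map \<phi> f) \<one> b = \<zero>"
        using f a ring_hom_one[OF hom] ring_hom_zero[OF hom ring_axioms ring_axioms] by (simp add: vanishes_on_def)
    qed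
    then show False using shorter_vanishing[of "map \<phi> f" A f] f ne A min by (metis leD length_map)
  qed
  have fixed': "\<phi> a = a" if "\<phi> \<in> \<Phi>" "a \<in> set f" for \<phi> a
    using fixed[OF that(1)] that(2) by (metis map_eq_conv map_ident)
  show thesis by (rule that[of cs]) (use f cs fixed' in auto)
qed

end

section \<open>Galois groups and independence of characters\<close>

lemma gal_group_carrier:
  "f \<in> carrier (gal_group E K) \<longleftrightarrow> f \<in> ring_iso E E \<and> f \<in> extensional (carrier E) \<and> (\<forall>x\<in>K. f x = x)"
  by (auto simp: gal_group_def)

lemma gal_group_one: "\<one>\<^bsub>gal_group E K\<^esub> = (\<lambda>x\<in>carrier E. x)"
  by (simp add: gal_group_def BijGroup_def)

lemma gal_group_Bij: "f \<in> carrier (gal_group E K) \<Longrightarrow> f \<in> Bij (carrier E)"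
  by (auto simp: gal_group_carrier Bij_def ring_iso_def)

lemma gal_group_mult:
  assumes "f \<in> carrier (gal_group E K)" "g \<in> carrier (gal_group E K)"
  shows "f \<otimes>\<^bsub>gal_group E K\<^esub> g = compose (carrier E) f g"
  using gal_group_Bij[OF assms(1)] gal_group_Bij[OF assms(2)] by (simp add: gal_group_def BijGroup_def)

lemma gal_group_apply:
  assumes "f \<in> carrier (gal_group E K)" "g \<in> carrier (gal_group E K)" "x \<in> carrier E"
  shows "(f \<otimes>\<^bsub>gal_group E K\<^esub> g) x = f (g x)"
  using gal_group_mult[OF assms(1,2)] assms(3) by (simp add: compose_def)

lemma gal_group_closed: "f \<in> carrier (gal_group E K) \<Longrightarrow> x \<in> carrier E \<Longrightarrow> f x \<in> carrier E"
  by (auto simp: gal_group_carrier dest: ring_iso_memE)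

lemma gal_group_ring_hom: "f \<in> carrier (gal_group E K) \<Longrightarrow> f \<in> ring_hom E E"
  by (auto simp: gal_group_carrier ring_iso_def)

lemma gal_group_eqI:
  assumes "f \<in> carrier (gal_group E K)" "g \<in> carrier (gal_group E K)"
    and "\<And>x. x \<in> carrier E \<Longrightarrow> f x = g x"
  shows "f = g"
  by (rule extensionalityI[of f "carrier E" g]) (use assms in \<open>auto simp: gal_group_carrier\<close>)

lemma (in ring) gal_group_memI:
  assumes "f \<in> ring_hom R R" "f \<in> extensional (carrier R)" "\<And>x. x \<in> K \<Longrightarrow> f x = x"
    "g \<in> carrier R \<rightarrow> carrier R" "\<And>x. x \<in> carrier R \<Longrightarrow> f (g x) = x" "\<And>x. x \<in> carrier R \<Longrightarrow> g (f x) = x"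
  shows "f \<in> carrier (gal_group R K)"
proof -
  have "bij_betw f (carrier R) (carrier R)"
    by (rule bij_betw_byWitness[of _ g]) (use assms ring_hom_closed[OF assms(1)] in auto)
  then show ?thesis using assms by (auto simp: gal_group_carrier ring_iso_def)
qed

lemma (in ring) group_gal_group:
  assumes "K \<subseteq> carrier R"
  shows "group (gal_group R K)"
proof -
  let ?H = "carrier (gal_group R K)"
  let ?B = "BijGroup (carrier R)"
  interpret B: group ?B by (rule group_BijGroup)
  have "subgroup ?H ?B"
  proof (rule B.subgroupI)
    show "?H \<subseteq> carrier ?B" using gal_group_Bij by (auto simp: BijGroup_def)
    have "(\<lambda>x\<in>carrier R. x) \<in> ?H"
      by (rule gal_group_memI[where g = "\<lambda>x. x"]) (use assms in \<open>auto simp: ring_hom_def\<close>)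
    then show "?H \<noteq> {}" by blast
  next
    fix f assume f: "f \<in> ?H"
    then have fB: "f \<in> Bij (carrier R)" by (rule gal_group_Bij)
    then have bij: "bij_betw f (carrier R) (carrier R)" by (simp add: Bij_def)
    define g where "g = (\<lambda>x\<in>carrier R. inv_into (carrier R) f x)"
    have "g \<in> Bij (carrier R)" unfolding g_def by (rule restrict_inv_into_Bij[OF fB])
    then have inv: "inv\<^bsub>?B\<^esub> f = g"
      using Bij_compose_restrict_eq[OF fB] fB
      by (intro B.inv_unique'[symmetric] B.inv_equality) (auto simp: BijGroup_def g_def intro!: B.inv_equality)
    have gf: "g (f x) = x" "f (g x) = x" "g x \<in> carrier R" "f x \<in> carrier R" if "x \<in> carrier R" for x
      using bij that by (auto simp: g_def bij_betw_def inv_into_f_f f_inv_into_f inv_into_into)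
    have fh: "f \<in> ring_hom R R" using f by (rule gal_group_ring_hom)
    have gh: "g \<in> ring_hom R R"
    proof (rule ring_hom_memI)
      fix x y assume xy: "x \<in> carrier R" "y \<in> carrier R"
      have "g (x \<otimes> y) = g (f (g x \<otimes> g y))" using xy gf ring_hom_mult[OF fh] by simp
      then show "g (x \<otimes> y) = g x \<otimes> g y" using xy gf by simp
      have "g (x \<oplus> y) = g (f (g x \<oplus> g y))" using xy gf ring_hom_add[OF fh] by simp
      then show "g (x \<oplus> y) = g x \<oplus> g y" using xy gf by simp
    next
      have "g \<one> = g (f \<one>)" using ring_hom_one[OF fh] by simp
      then show "g \<one> = \<one>" using gf by simp
    qed (use gf in auto)
    have "g x = x" if "x \<in> K" for x
    proof -
      have "f x = x" "x \<in> carrier R" using that f assms by (auto simp: gal_group_carrier)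
      then show ?thesis using gf(1)[of x] by simp
    qed
    then show "inv\<^bsub>?B\<^esub> f \<in> ?H" unfolding inv
      by (intro gal_group_memI[where g = f]) (use gf gh in \<open>auto simp: g_def\<close>)
  next
    fix f g assume fg: "f \<in> ?H" "g \<in> ?H"
    have "f \<otimes>\<^bsub>?B\<^esub> g = compose (carrier R) f g"
      using fg gal_group_Bij[of f R K] gal_group_Bij[of g R K] by (simp add: BijGroup_def)
    moreover have "compose (carrier R) f g \<in> ?H"
    proof -
      have "bij_betw (compose (carrier R) f g) (carrier R) (carrier R)"
        using fg by (intro bij_betw_compose) (auto simp: gal_group_carrier ring_iso_def)
      moreover have "compose (carrier R) f g \<in> ring_hom R R"
        using gal_group_ring_hom[OF fg(1)] gal_group_ring_hom[OF fg(2)]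
        by (auto simp: ring_hom_def compose_def Pi_iff)
      moreover have "compose (carrier R) f g x = x" if "x \<in> K" for x
        using that assms fg by (auto simp: compose_def gal_group_carrier)
      ultimately show ?thesis by (auto simp: gal_group_carrier ring_iso_def)
    qed
    ultimately show "f \<otimes>\<^bsub>?B\<^esub> g \<in> ?H" by simp
  qed
  then have "group (?B \<lparr>carrier := ?H\<rparr>)" by (rule subgroup.subgroup_is_group) (rule B.is_group)
  then show ?thesis by (simp add: gal_group_def)
qed

lemma (in field) is_skew_field: "skew_field R"
  by unfold_locales (auto simp: field_Units)

section \<open>Linear systems and bounds for numbers of embeddings\<close>

lemma (in ring) nth_in_carrier: "set Us \<subseteq> carrier R \<Longrightarrow> i < length Us \<Longrightarrow> Us ! i \<in> carrier R"
  by (meson nth_mem subsetD)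

lemma (in ring) combine_eq_finsum:
  assumes "length Ks = length Us" "set Ks \<subseteq> carrier R" "set Us \<subseteq> carrier R"
  shows "combine Ks Us = (\<Oplus>i\<in>{..<length Us}. Ks ! i \<otimes> Us ! i)"
  using assms
proof (induction Ks Us rule: rev_induct2)
  case (4 x xs y ys)
  have "combine (xs @ [x]) (ys @ [y]) = combine xs ys \<oplus> combine [x] [y]"
    using 4 by (intro combine_append[symmetric]) auto
  also have "combine xs ys = (\<Oplus>i\<in>{..<length ys}. (xs @ [x]) ! i \<otimes> (ys @ [y]) ! i)"
    using 4 by (auto simp: nth_append intro!: finsum_cong' m_closed nth_in_carrier)
  also have "\<dots> \<oplus> combine [x] [y] = (\<Oplus>i\<in>{..<length (ys @ [y])}. (xs @ [x]) ! i \<otimes> (ys @ [y]) ! i)"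
  proof -
    have "(\<Oplus>i\<in>insert (length ys) {..<length ys}. (xs @ [x]) ! i \<otimes> (ys @ [y]) ! i) =
      (xs @ [x]) ! length ys \<otimes> (ys @ [y]) ! length ys \<oplus> (\<Oplus>i\<in>{..<length ys}. (xs @ [x]) ! i \<otimes> (ys @ [y]) ! i)"
      using 4 by (intro finsum_insert) (auto simp: nth_append intro!: m_closed nth_in_carrier)
    moreover have "(\<Oplus>i\<in>{..<length ys}. (xs @ [x]) ! i \<otimes> (ys @ [y]) ! i) \<in> carrier R"
      using 4 by (auto simp: nth_append intro!: finsum_closed m_closed nth_in_carrier)
    moreover have "(xs @ [x]) ! length ys = x" using 4 by (simp add: nth_append)
    ultimately show ?thesis using 4 by (simp add: lessThan_Suc a_comm)
  qed
  finally show ?case .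
qed auto

lemma (in ring) independent_finsum_trivial:
  assumes "subfield K R" "independent K Us" "t \<in> {..<length Us} \<rightarrow> K"
    "(\<Oplus>i\<in>{..<length Us}. t i \<otimes> Us ! i) = \<zero>" "j < length Us"
  shows "t j = \<zero>"
proof -
  let ?Ks = "map t [0..<length Us]"
  have K: "K \<subseteq> carrier R" using subfieldE(3)[OF assms(1)] .
  have Ks: "set ?Ks \<subseteq> K" using assms(3) by auto
  have Us: "set Us \<subseteq> carrier R" using independent_in_carrier[OF assms(2)] .
  have "combine ?Ks Us = (\<Oplus>i\<in>{..<length Us}. ?Ks ! i \<otimes> Us ! i)"
    by (rule combine_eq_finsum) (use Ks K Us in auto)
  also have "\<dots> = \<zero>" using assms(3,4) K Us by (subst finsum_cong'[OF refl]) (auto intro!: nth_in_carrier)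
  finally have "set (take (length Us) ?Ks) \<subseteq> {\<zero>}"
    using independent_imp_trivial_combine[OF assms(1,2) Ks] by simp
  then have "t ` {..<length Us} \<subseteq> {\<zero>}" by (simp add: lessThan_atLeast0)
  then show ?thesis using assms(5) by blast
qed

text \<open>Elimination: one equation and one unknown disappear together, so an excess of unknowns
  survives until no equation is left.\<close>

lemma (in field) linear_system:
  assumes "finite I" "finite J" "card I < card J" "\<And>i j. i \<in> I \<Longrightarrow> j \<in> J \<Longrightarrow> a i j \<in> carrier R"
  obtains c where "c \<in> J \<rightarrow> carrier R" "\<exists>j\<in>J. c j \<noteq> \<zero>"
    "\<And>i. i \<in> I \<Longrightarrow> (\<Oplus>j\<in>J. a i j \<otimes> c j) = \<zero>"
proof -
  have "\<exists>c. c \<in> J \<rightarrow> carrier R \<and> (\<exists>j\<in>J. c j \<noteq> \<zero>) \<and> (\<forall>i\<in>I. (\<Oplus>j\<in>J. a i j \<otimes> c j) = \<zero>)"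
    using assms
  proof (induction I arbitrary: J a rule: finite_induct)
    case empty
    then have "J \<noteq> {}" by auto
    then show ?case by (intro exI[of _ "\<lambda>_. \<one>"]) auto
  next
    case (insert m I)
    note a = insert.prems(3)
    show ?case
    proof (cases "\<forall>j\<in>J. a m j = \<zero>")
      case True
      obtain c where c: "c \<in> J \<rightarrow> carrier R" "\<exists>j\<in>J. c j \<noteq> \<zero>" "\<forall>i\<in>I. (\<Oplus>j\<in>J. a i j \<otimes> c j) = \<zero>"
        using insert.IH[of J a] insert.prems insert.hyps by auto
      have "(\<Oplus>j\<in>J. a m j \<otimes> c j) = (\<Oplus>j\<in>J. \<zero>)" using True c by (intro finsum_cong') (auto simp: Pi_iff)
      then show ?thesis using c by (intro exI[of _ c]) auto
    next
      case False
      then obtain k where k: "k \<in> J" "a m k \<noteq> \<zero>" by blast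
      define J' where "J' = J - {k}"
      have J: "J = insert k J'" "k \<notin> J'" "finite J'" using k insert.prems by (auto simp: J'_def)
      define u where "u = inv (a m k)"
      have amk: "a m k \<in> carrier R" using a k by auto
      have u: "u \<in> carrier R" "a m k \<otimes> u = \<one>" using amk k field_Units unfolding u_def by auto
      \<comment> \<open>Coefficients after eliminating the unknown \<open>k\<close> by means of
        equation \<open>m\<close>; the value of that unknown is restored in
        \<open>d\<close>.\<close>
      define b where "b i j = a i j \<ominus> a i k \<otimes> u \<otimes> a m j" for i j
      have "\<exists>c. c \<in> J' \<rightarrow> carrier R \<and> (\<exists>j\<in>J'. c j \<noteq> \<zero>) \<and> (\<forall>i\<in>I. (\<Oplus>j\<in>J'. b i j \<otimes> c j) = \<zero>)"
      proof (rule insert.IH)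
        show "card I < card J'" using insert.prems insert.hyps J by auto
      qed (use J a u in \<open>auto simp: b_def\<close>)
      then obtain c where c: "c \<in> J' \<rightarrow> carrier R" "\<exists>j\<in>J'. c j \<noteq> \<zero>"
        "\<And>i. i \<in> I \<Longrightarrow> (\<Oplus>j\<in>J'. b i j \<otimes> c j) = \<zero>" by blast
      define s where "s = (\<Oplus>j\<in>J'. a m j \<otimes> c j)"
      have s: "s \<in> carrier R" unfolding s_def using a c J by (intro finsum_closed) auto
      define d where "d = c(k := \<ominus> (u \<otimes> s))"
      have d: "d \<in> J \<rightarrow> carrier R" using c u s J by (auto simp: d_def)
      have sum: "(\<Oplus>j\<in>J. a i j \<otimes> d j) = a i k \<otimes> d k \<oplus> (\<Oplus>j\<in>J'. a i j \<otimes> c j)"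
        if i: "i \<in> insert m I" for i
      proof -
        have "(\<Oplus>j\<in>J. a i j \<otimes> d j) = a i k \<otimes> d k \<oplus> (\<Oplus>j\<in>J'. a i j \<otimes> d j)"
          unfolding J(1) using J a i d by (intro finsum_insert) auto
        also have "(\<Oplus>j\<in>J'. a i j \<otimes> d j) = (\<Oplus>j\<in>J'. a i j \<otimes> c j)"
          using J a i c by (intro finsum_cong') (auto simp: d_def)
        finally show ?thesis .
      qed
      have "(\<Oplus>j\<in>J. a i j \<otimes> d j) = \<zero>" if i: "i \<in> insert m I" for i
      proof (cases "i = m")
        case True
        have "a m k \<otimes> (u \<otimes> s) = s" using u amk s by (simp add: m_assoc[symmetric])
        then show ?thesis using sum[OF i, unfolded True, folded s_def] True s u amk
          by (simp add: d_def r_minus l_neg)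
      next
        case False
        then have iI: "i \<in> I" using i by auto
        have aik: "a i k \<in> carrier R" using a i k by auto
        have "(\<Oplus>j\<in>J'. a i j \<otimes> c j) = (\<Oplus>j\<in>J'. b i j \<otimes> c j \<oplus> (a i k \<otimes> u) \<otimes> (a m j \<otimes> c j))"
        proof (rule finsum_cong'[OF refl])
          fix j assume j: "j \<in> J'"
          have *: "a i j \<in> carrier R" "a m j \<in> carrier R" "c j \<in> carrier R" using a i c j J by auto
          then show "a i j \<otimes> c j = b i j \<otimes> c j \<oplus> (a i k \<otimes> u) \<otimes> (a m j \<otimes> c j)"
            unfolding b_def using aik u
            by (simp add: minus_eq l_distr l_minus m_assoc a_assoc l_neg)
        qed (use a i c J u aik in \<open>auto simp: b_def Pi_iff\<close>)
        also have "\<dots> = (\<Oplus>j\<in>J'. b i j \<otimes> c j) \<oplus> (\<Oplus>j\<in>J'. (a i k \<otimes> u) \<otimes> (a m j \<otimes> c j))"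
          using a i c J u aik by (intro finsum_addf) (auto simp: b_def Pi_iff)
        also have "(\<Oplus>j\<in>J'. (a i k \<otimes> u) \<otimes> (a m j \<otimes> c j)) = (a i k \<otimes> u) \<otimes> s"
          unfolding s_def using a c J u aik by (intro finsum_rdistr[symmetric]) auto
        finally have "(\<Oplus>j\<in>J'. a i j \<otimes> c j) = a i k \<otimes> u \<otimes> s"
          using c(3)[OF iI] u aik s by simp
        then show ?thesis using sum[OF i] u aik s by (simp add: d_def r_minus m_assoc l_neg)
      qed
      moreover have "\<exists>j\<in>J. d j \<noteq> \<zero>" using c(2) J by (auto simp: d_def)
      ultimately show ?thesis using d by blast
    qed
  qed
  then show thesis using that by blast
qed

text \<open>Dedekind's argument: the relation at the product of \<open>b\<close> and
  \<open>a\<close>, minus \<open>\<xi> b\<close> times the relation at \<open>a\<close>, loses the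
  character \<open>\<xi>\<close> and has one term fewer. Extensionality makes distinct characters
  differ somewhere on the carrier, which supplies \<open>b\<close>.\<close>

lemma (in field) characters_independent:
  fixes S :: "('c, 'd) monoid_scheme"
  assumes S: "monoid S" and "finite C"
    and C: "\<And>\<chi>. \<chi> \<in> C \<Longrightarrow> \<chi> \<in> hom S R" "\<And>\<chi>. \<chi> \<in> C \<Longrightarrow> \<chi> \<one>\<^bsub>S\<^esub> = \<one>"
      "\<And>\<chi>. \<chi> \<in> C \<Longrightarrow> \<chi> \<in> extensional (carrier S)"
    and "c \<in> C \<rightarrow> carrier R"
    and "\<And>a. a \<in> carrier S \<Longrightarrow> (\<Oplus>\<chi>\<in>C. c \<chi> \<otimes> \<chi> a) = \<zero>"
    and "\<chi> \<in> C"
  shows "c \<chi> = \<zero>"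
  using assms(2-)
proof (induction C arbitrary: c \<chi> rule: finite_induct)
  case (insert \<xi> C)
  interpret S: monoid S by (rule S)
  note C = insert.prems(1-3) and c = insert.prems(4) and sum = insert.prems(5)
  have Xc: "\<chi> a \<in> carrier R" if "\<chi> \<in> insert \<xi> C" "a \<in> carrier S" for \<chi> a
    using C(1)[OF that(1)] that(2) by (auto simp: hom_def)
  have Xm: "\<chi> (a \<otimes>\<^bsub>S\<^esub> b) = \<chi> a \<otimes> \<chi> b" if "\<chi> \<in> insert \<xi> C" "a \<in> carrier S" "b \<in> carrier S" for \<chi> a b
    using C(1)[OF that(1)] that(2,3) by (auto simp: hom_def)
  have zero: "c \<eta> = \<zero>" if \<eta>: "\<eta> \<in> C" for \<eta>
  proof -
    have "\<eta> \<noteq> \<xi>" using insert.hyps \<eta> by auto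
    then obtain b where b: "b \<in> carrier S" "\<eta> b \<noteq> \<xi> b"
      using C(3)[of \<eta>] C(3)[of \<xi>] \<eta> extensionalityI[of \<eta> "carrier S" \<xi>] by blast
    define c' where "c' \<chi> = c \<chi> \<otimes> (\<chi> b \<ominus> \<xi> b)" for \<chi>
    have "c' \<eta> = \<zero>"
    proof (rule insert.IH[of c' \<eta>])
      fix a assume a: "a \<in> carrier S"
      have ba: "b \<otimes>\<^bsub>S\<^esub> a \<in> carrier S" using a b by simp
      have "(\<Oplus>\<chi>\<in>C. c' \<chi> \<otimes> \<chi> a)
        = (\<Oplus>\<chi>\<in>C. c \<chi> \<otimes> \<chi> (b \<otimes>\<^bsub>S\<^esub> a) \<oplus> (\<ominus> \<xi> b) \<otimes> (c \<chi> \<otimes> \<chi> a))"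
      proof (rule finsum_cong'[OF refl])
        fix \<chi> assume \<chi>: "\<chi> \<in> C"
        have "c \<chi> \<in> carrier R" "\<chi> a \<in> carrier R" "\<chi> b \<in> carrier R" "\<xi> b \<in> carrier R"
          using \<chi> c Xc a b by auto
        then show "c' \<chi> \<otimes> \<chi> a = c \<chi> \<otimes> \<chi> (b \<otimes>\<^bsub>S\<^esub> a) \<oplus> (\<ominus> \<xi> b) \<otimes> (c \<chi> \<otimes> \<chi> a)"
          using \<chi> a b by (simp add: c'_def Xm minus_eq l_distr r_distr r_minus l_minus m_ac)
      qed (use c Xc a b ba in \<open>auto simp: Pi_iff\<close>)
      also have "\<dots> = (\<Oplus>\<chi>\<in>C. c \<chi> \<otimes> \<chi> (b \<otimes>\<^bsub>S\<^esub> a)) \<oplus> (\<Oplus>\<chi>\<in>C. (\<ominus> \<xi> b) \<otimes> (c \<chi> \<otimes> \<chi> a))"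
        using c Xc a b ba by (intro finsum_addf) (auto simp: Pi_iff)
      also have "(\<Oplus>\<chi>\<in>C. (\<ominus> \<xi> b) \<otimes> (c \<chi> \<otimes> \<chi> a)) = (\<ominus> \<xi> b) \<otimes> (\<Oplus>\<chi>\<in>C. c \<chi> \<otimes> \<chi> a)"
        using c Xc a b insert.hyps by (intro finsum_rdistr[symmetric]) auto
      finally have eq: "(\<Oplus>\<chi>\<in>C. c' \<chi> \<otimes> \<chi> a) =
        (\<Oplus>\<chi>\<in>C. c \<chi> \<otimes> \<chi> (b \<otimes>\<^bsub>S\<^esub> a)) \<oplus> (\<ominus> \<xi> b) \<otimes> (\<Oplus>\<chi>\<in>C. c \<chi> \<otimes> \<chi> a)" .
      have split: "(\<Oplus>\<chi>\<in>C. c \<chi> \<otimes> \<chi> a') = \<ominus> (c \<xi> \<otimes> \<xi> a')" if a': "a' \<in> carrier S" for a'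
      proof -
        have "c \<xi> \<otimes> \<xi> a' \<oplus> (\<Oplus>\<chi>\<in>C. c \<chi> \<otimes> \<chi> a') = \<zero>"
          using sum[OF a'] insert.hyps c Xc a' by (subst (asm) finsum_insert) auto
        moreover have "c \<xi> \<otimes> \<xi> a' \<in> carrier R" "(\<Oplus>\<chi>\<in>C. c \<chi> \<otimes> \<chi> a') \<in> carrier R"
          using c Xc a' by (auto intro!: finsum_closed)
        ultimately show ?thesis by (metis minus_equality a_comm)
      qed
      have "c \<xi> \<in> carrier R" "\<xi> a \<in> carrier R" "\<xi> b \<in> carrier R" using c Xc a b by auto
      then show "(\<Oplus>\<chi>\<in>C. c' \<chi> \<otimes> \<chi> a) = \<zero>"
        unfolding eq using split[of a] split[of "b \<otimes>\<^bsub>S\<^esub> a"] a b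
        by (simp add: Xm r_minus l_minus m_ac l_neg)
    qed (use C c Xc b \<eta> in \<open>auto simp: c'_def\<close>)
    moreover have "\<eta> b \<in> carrier R" "\<xi> b \<in> carrier R" "c \<eta> \<in> carrier R" using Xc \<eta> b c by auto
    ultimately show ?thesis using b integral[of "c \<eta>" "\<eta> b \<ominus> \<xi> b"] by (auto simp: c'_def r_right_minus_eq)
  qed
  \<comment> \<open>Only the term of \<open>\<xi>\<close> is left; evaluation at the unit isolates
    its coefficient.\<close>
  have "(\<Oplus>\<chi>\<in>insert \<xi> C. c \<chi> \<otimes> \<chi> \<one>\<^bsub>S\<^esub>) = c \<xi> \<otimes> \<xi> \<one>\<^bsub>S\<^esub> \<oplus> (\<Oplus>\<chi>\<in>C. c \<chi> \<otimes> \<chi> \<one>\<^bsub>S\<^esub>)"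
    using insert.hyps c Xc by (intro finsum_insert) auto
  also have "(\<Oplus>\<chi>\<in>C. c \<chi> \<otimes> \<chi> \<one>\<^bsub>S\<^esub>) = (\<Oplus>\<chi>\<in>C. \<zero>)"
    using zero Xc by (intro finsum_cong') auto
  finally have "c \<xi> = \<zero>" using sum[of "\<one>\<^bsub>S\<^esub>"] c C(2)[of \<xi>] by simp
  then show ?case using zero insert.prems by auto
qed simp

text \<open>Artin's bound. If \<open>n\<close> exceeded the order of \<open>H\<close>, the
  conjugates of a basis would satisfy a linear system with a nonzero solution; the traces of a
  rescaled solution lie in \<open>K\<close> and give a nontrivial relation over \<open>K\<close>
  between the basis vectors.\<close>

lemma (in field) artin_bound:
  assumes K: "subfield K R" and H: "subgroup H (gal_group R K)" "finite H"
    and fixed_points: "\<And>x. x \<in> carrier R \<Longrightarrow> (\<And>h. h \<in> H \<Longrightarrow> h x = x) \<Longrightarrow> x \<in> K"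
    and dim: "dimension n K (carrier R)"
  shows "n \<le> card H"
proof (rule ccontr)
  assume "\<not> n \<le> card H"
  let ?G = "gal_group R K"
  have KR: "K \<subseteq> carrier R" using subfieldE(3)[OF K] .
  interpret G: group ?G by (rule group_gal_group[OF KR])
  have HG: "H \<subseteq> carrier ?G" using subgroup.subset[OF H(1)] .
  have hom: "h \<in> ring_hom R R" if "h \<in> H" for h using that HG gal_group_ring_hom[of h R K] by auto
  have hc: "h x \<in> carrier R" if "h \<in> H" "x \<in> carrier R" for h x using ring_hom_closed[OF hom] that by auto
  have ext: "h \<in> extensional (carrier R)" if "h \<in> H" for h using that HG by (auto simp: gal_group_carrier)
  obtain Us where Us: "set Us \<subseteq> carrier R" "independent K Us" "length Us = n" "Span K Us = carrier R"
    using exists_base[OF K dim] by blast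
  have Uc: "Us ! j \<in> carrier R" if "j < n" for j using that Us by (auto intro: nth_in_carrier)
  obtain c where c: "c \<in> {..<n} \<rightarrow> carrier R" "\<exists>j\<in>{..<n}. c j \<noteq> \<zero>"
    "\<And>h. h \<in> H \<Longrightarrow> (\<Oplus>j\<in>{..<n}. h (Us ! j) \<otimes> c j) = \<zero>"
    by (rule linear_system[of H "{..<n}" "\<lambda>h j. h (Us ! j)"]) (use H \<open>\<not> n \<le> card H\<close> hc Uc in auto)
  obtain k where k: "k < n" "c k \<noteq> \<zero>" using c by auto
  have "c k \<in> Units R" using c(1) k field_Units by auto
  then have ck: "c k \<in> carrier R" "inv (c k) \<in> carrier R" "inv (c k) \<otimes> c k = \<one>"
    by auto
  \<comment> \<open>The trace is a sum of distinct characters with coefficients 1, so it cannot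
    vanish identically.\<close>
  have "\<exists>e\<in>carrier R. (\<Oplus>h\<in>H. \<one> \<otimes> h e) \<noteq> \<zero>"
  proof (rule ccontr)
    assume *: "\<not> (\<exists>e\<in>carrier R. (\<Oplus>h\<in>H. \<one> \<otimes> h e) \<noteq> \<zero>)"
    have one: "\<one>\<^bsub>?G\<^esub> \<in> H" using subgroup.one_closed[OF H(1)] .
    have "\<one> = \<zero>"
      by (rule characters_independent[OF monoid_axioms H(2), of "\<lambda>_. \<one>" "\<one>\<^bsub>?G\<^esub>"])
        (use one hom hc ext * in \<open>auto simp: hom_def Pi_iff ring_hom_mult ring_hom_one\<close>)
    then show False by simp
  qed
  then obtain e where e: "e \<in> carrier R" "(\<Oplus>h\<in>H. \<one> \<otimes> h e) \<noteq> \<zero>" by blast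
  \<comment> \<open>The solution is scaled so that its coordinate \<open>k\<close> is exactly
    \<open>e\<close>, whose trace is nonzero. This makes \<open>t k\<close>, a coefficient of the
    final relation, nonzero.\<close>
  define d where "d j = c j \<otimes> (inv (c k) \<otimes> e)" for j
  have d: "d j \<in> carrier R" if "j < n" for j using c ck e that by (auto simp: d_def)
  have dk: "d k = e" using ck e unfolding d_def
    by (metis l_one m_assoc m_comm)
  define t where "t j = (\<Oplus>h\<in>H. h (d j))" for j
  have tc: "t j \<in> carrier R" if "j < n" for j unfolding t_def using hc d that by (intro finsum_closed) auto
  have tK: "t j \<in> K" if j: "j < n" for j
  proof (rule fixed_points)
    fix g assume g: "g \<in> H"
    interpret g: ring_hom_ring R R g
      by (intro ring_hom_ringI2 ring_axioms hom[OF g])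
    have "g (t j) = (\<Oplus>h\<in>H. g (h (d j)))"
      unfolding t_def using hc d j by (subst g.hom_finsum) (auto simp: comp_def)
    also have "\<dots> = (\<Oplus>h\<in>H. (g \<otimes>\<^bsub>?G\<^esub> h) (d j))"
      using g HG d[OF j] hc by (intro finsum_cong') (auto simp: gal_group_apply subset_iff)
    also have "\<dots> = (\<Oplus>h\<in>(\<lambda>h. g \<otimes>\<^bsub>?G\<^esub> h) ` H. h (d j))"
    proof (rule finsum_reindex[symmetric])
      show "inj_on (\<lambda>h. g \<otimes>\<^bsub>?G\<^esub> h) H" using g HG by (intro inj_onI) (auto simp: subset_iff)
      show "(\<lambda>h. h (d j)) \<in> (\<lambda>h. g \<otimes>\<^bsub>?G\<^esub> h) ` H \<rightarrow> carrier R"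
        using g subgroup.m_closed[OF H(1)] hc d j by auto
    qed
    also have "(\<lambda>h. g \<otimes>\<^bsub>?G\<^esub> h) ` H = H"
      using endo_inj_surj[OF H(2), of "\<lambda>h. g \<otimes>\<^bsub>?G\<^esub> h"] subgroup.m_closed[OF H(1) g] g HG
      by (auto simp: inj_on_def subset_iff)
    finally show "g (t j) = t j" by (simp add: t_def)
  qed (use tc j in auto)
  \<comment> \<open>The equation used is the one for the inverse \<open>g\<close> of
    \<open>h\<close>; applying \<open>h\<close> moves the automorphism from the basis vectors to the
    coefficients.\<close>
  have zero: "(\<Oplus>j\<in>{..<n}. h (d j) \<otimes> Us ! j) = \<zero>" if h: "h \<in> H" for h
  proof -
    define g where "g = inv\<^bsub>?G\<^esub> h"
    have g: "g \<in> H" unfolding g_def using subgroup.m_inv_closed[OF H(1) h] .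
    have hg: "h (g x) = x" if "x \<in> carrier R" for x
      using gal_group_apply[of h R K g x] h g HG that G.r_inv[of h] by (auto simp: g_def gal_group_one subset_iff)
    interpret h: ring_hom_ring R R h
      by (intro ring_hom_ringI2 ring_axioms hom[OF h])
    have "\<zero> = (\<Oplus>j\<in>{..<n}. g (Us ! j) \<otimes> c j) \<otimes> (inv (c k) \<otimes> e)"
      using c(3)[OF g] ck e by simp
    also have "\<dots> = (\<Oplus>j\<in>{..<n}. g (Us ! j) \<otimes> c j \<otimes> (inv (c k) \<otimes> e))"
      using hc[OF g] Uc c ck e by (intro finsum_ldistr) (auto simp: Pi_iff)
    also have "\<dots> = (\<Oplus>j\<in>{..<n}. d j \<otimes> g (Us ! j))"
      using hc[OF g] Uc c ck e d by (intro finsum_cong') (auto simp: d_def m_ac Pi_iff)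
    finally have "h \<zero> = h (\<Oplus>j\<in>{..<n}. d j \<otimes> g (Us ! j))" by simp
    also have "\<dots> = (\<Oplus>j\<in>{..<n}. h (d j \<otimes> g (Us ! j)))"
      using hc[OF g] Uc d by (subst h.hom_finsum) (auto simp: comp_def)
    also have "\<dots> = (\<Oplus>j\<in>{..<n}. h (d j) \<otimes> Us ! j)"
      using hc[OF g] hc[OF h] Uc d hg by (intro finsum_cong') auto
    finally show ?thesis by simp
  qed
  have add: "(\<Oplus>j\<in>{..<m}. t j \<otimes> Us ! j) = (\<Oplus>h\<in>H. (\<Oplus>j\<in>{..<m}. h (d j) \<otimes> Us ! j))" if "m \<le> n" for m
    using that
  proof (induction m)
    case (Suc m)
    have *: "h (d j) \<otimes> Us ! j \<in> carrier R" if "h \<in> H" "j \<le> m" for h j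
      using that Suc.prems hc d Uc by auto
    have "(\<Oplus>j\<in>{..<Suc m}. t j \<otimes> Us ! j) = t m \<otimes> Us ! m \<oplus> (\<Oplus>j\<in>{..<m}. t j \<otimes> Us ! j)"
      unfolding lessThan_Suc using tc Uc Suc.prems by (intro finsum_insert) auto
    also have "t m \<otimes> Us ! m = (\<Oplus>h\<in>H. h (d m) \<otimes> Us ! m)"
      unfolding t_def using hc d Uc Suc.prems H by (intro finsum_ldistr) auto
    also have "(\<Oplus>h\<in>H. h (d m) \<otimes> Us ! m) \<oplus> (\<Oplus>j\<in>{..<m}. t j \<otimes> Us ! j) =
       (\<Oplus>h\<in>H. h (d m) \<otimes> Us ! m \<oplus> (\<Oplus>j\<in>{..<m}. h (d j) \<otimes> Us ! j))"
      using Suc * by (subst finsum_addf) (auto intro!: finsum_closed)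
    also have "\<dots> = (\<Oplus>h\<in>H. (\<Oplus>j\<in>{..<Suc m}. h (d j) \<otimes> Us ! j))"
    proof (rule finsum_cong'[OF refl])
      fix h assume h: "h \<in> H"
      show "h (d m) \<otimes> Us ! m \<oplus> (\<Oplus>j\<in>{..<m}. h (d j) \<otimes> Us ! j) = (\<Oplus>j\<in>{..<Suc m}. h (d j) \<otimes> Us ! j)"
        unfolding lessThan_Suc using * h by (intro finsum_insert[symmetric]) auto
    qed (use * in \<open>auto intro!: finsum_closed\<close>)
    finally show ?case .
  qed simp
  have "(\<Oplus>h\<in>H. (\<Oplus>j\<in>{..<n}. h (d j) \<otimes> Us ! j)) = (\<Oplus>h\<in>H. \<zero>)"
    using zero by (intro finsum_cong') auto
  then have "(\<Oplus>j\<in>{..<n}. t j \<otimes> Us ! j) = \<zero>" using add[of n] by simp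
  then have "t k = \<zero>"
    using independent_finsum_trivial[OF K Us(2), of t k] Us(3) tK k by auto
  moreover have "(\<Oplus>h\<in>H. \<one> \<otimes> h e) = t k" unfolding t_def dk using hc e by (intro finsum_cong') auto
  ultimately show False using e by simp
qed

text \<open>Dedekind's bound: \<open>n + 1\<close> embeddings would satisfy a common linear relation
  on the \<open>n\<close> basis vectors, hence on all of \<open>A\<close> since they fix
  \<open>K\<close>, against the independence of characters. Finiteness is part of the conclusion, so
  the contradiction starts from a subset of size \<open>n + 1\<close>.\<close>

lemma (in field) embeddings_bound:
  assumes K: "subfield K R" and A: "subfield A R" "K \<subseteq> A" and dim: "dimension n K A"
    and S: "\<And>\<chi>. \<chi> \<in> S \<Longrightarrow> \<chi> \<in> ring_hom (R\<lparr>carrier := A\<rparr>) R" "\<And>\<chi>. \<chi> \<in> S \<Longrightarrow> \<chi> \<in> extensional A"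
      "\<And>\<chi> x. \<chi> \<in> S \<Longrightarrow> x \<in> K \<Longrightarrow> \<chi> x = x"
  shows "finite S \<and> card S \<le> n"
proof (rule ccontr)
  assume "\<not> (finite S \<and> card S \<le> n)"
  then obtain T where T: "T \<subseteq> S" "finite T" "card T = Suc n"
    by (metis Suc_leI infinite_arbitrarily_large not_less obtain_subset_with_card_n)
  have AR: "A \<subseteq> carrier R" using subfieldE(3)[OF A(1)] .
  have KR: "K \<subseteq> carrier R" using subfieldE(3)[OF K] .
  interpret A: ring "R\<lparr>carrier := A\<rparr>" using subring_is_ring[OF subfieldE(1)[OF A(1)]] .
  have hom: "\<chi> \<in> ring_hom (R\<lparr>carrier := A\<rparr>) R" if "\<chi> \<in> T" for \<chi> using T S that by auto
  have hc: "\<chi> x \<in> carrier R" if "\<chi> \<in> T" "x \<in> A" for \<chi> x using ring_hom_closed[OF hom[OF that(1)]] that by auto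
  obtain Us where Us: "set Us \<subseteq> carrier R" "independent K Us" "length Us = n" "Span K Us = A"
    using exists_base[OF K dim] by blast
  have UA: "set Us \<subseteq> A" using Span_base_incl[OF K Us(1)] Us(4) by simp
  have Uc: "Us ! j \<in> A" if "j < n" for j using that UA Us by (meson nth_mem subsetD)
  obtain c where c: "c \<in> T \<rightarrow> carrier R" "\<exists>\<chi>\<in>T. c \<chi> \<noteq> \<zero>"
    "\<And>i. i \<in> {..<n} \<Longrightarrow> (\<Oplus>\<chi>\<in>T. \<chi> (Us ! i) \<otimes> c \<chi>) = \<zero>"
    by (rule linear_system[of "{..<n}" T "\<lambda>i \<chi>. \<chi> (Us ! i)"]) (use T hc Uc in auto)
  have cc: "c \<chi> \<in> carrier R" if "\<chi> \<in> T" for \<chi> using c(1) that by auto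
  have hz: "\<chi> \<zero> = \<zero>" if "\<chi> \<in> T" for \<chi>
    using ring_hom_zero[OF hom[OF that] A.ring_axioms ring_axioms] by simp
  have sum: "(\<Oplus>\<chi>\<in>T. c \<chi> \<otimes> \<chi> (combine Ks Vs)) = \<zero>"
    if "set Ks \<subseteq> K" "set Vs \<subseteq> set Us" for Ks Vs
    using that
  proof (induction Ks Vs rule: combine.induct)
    case (1 k Ks u Vs)
    have k: "k \<in> K" "k \<in> A" "k \<in> carrier R" using 1(2) A(2) AR by auto
    have u: "u \<in> A" "u \<in> set Us" using 1 UA by auto
    have w: "combine Ks Vs \<in> A"
    proof -
      have "set Vs \<subseteq> carrier R" using 1 Us by auto
      then have "combine Ks Vs \<in> Span K Vs" using Span_eq_combine_set[OF K, of Vs] 1 by auto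
      also have "Span K Vs \<subseteq> Span K Us" by (rule mono_Span_sublist[OF K]) (use 1 Us in auto)
      finally show ?thesis using Us by simp
    qed
    have ku: "k \<otimes> u \<in> A" using k u A.m_closed[of k u] by simp
    obtain i where i: "i < n" "u = Us ! i" using u Us by (metis in_set_conv_nth)
    have "(\<Oplus>\<chi>\<in>T. c \<chi> \<otimes> \<chi> (k \<otimes> u \<oplus> combine Ks Vs)) =
      (\<Oplus>\<chi>\<in>T. k \<otimes> (\<chi> u \<otimes> c \<chi>) \<oplus> c \<chi> \<otimes> \<chi> (combine Ks Vs))"
    proof (rule finsum_cong'[OF refl])
      fix \<chi> assume \<chi>: "\<chi> \<in> T"
      have "\<chi> (k \<otimes> u \<oplus> combine Ks Vs) = \<chi> k \<otimes> \<chi> u \<oplus> \<chi> (combine Ks Vs)"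
        using ring_hom_add[OF hom[OF \<chi>], of "k \<otimes> u" "combine Ks Vs"] ring_hom_mult[OF hom[OF \<chi>], of k u] ku w k u
        by simp
      moreover have "\<chi> k = k" using S(3)[of \<chi> k] \<chi> T k by auto
      moreover have "\<chi> u \<in> carrier R" "\<chi> (combine Ks Vs) \<in> carrier R" "c \<chi> \<in> carrier R"
        using hc \<chi> u w cc by auto
      ultimately show "c \<chi> \<otimes> \<chi> (k \<otimes> u \<oplus> combine Ks Vs) = k \<otimes> (\<chi> u \<otimes> c \<chi>) \<oplus> c \<chi> \<otimes> \<chi> (combine Ks Vs)"
        using k by (simp add: r_distr m_ac)
    qed (use hc u w cc k in \<open>simp add: Pi_iff\<close>)
    also have "\<dots> = (\<Oplus>\<chi>\<in>T. k \<otimes> (\<chi> u \<otimes> c \<chi>)) \<oplus> (\<Oplus>\<chi>\<in>T. c \<chi> \<otimes> \<chi> (combine Ks Vs))"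
      using hc u w cc k by (intro finsum_addf) (simp_all add: Pi_iff)
    also have "(\<Oplus>\<chi>\<in>T. k \<otimes> (\<chi> u \<otimes> c \<chi>)) = k \<otimes> (\<Oplus>\<chi>\<in>T. \<chi> u \<otimes> c \<chi>)"
      using hc u cc k T by (intro finsum_rdistr[symmetric]) (simp_all add: Pi_iff)
    finally have "(\<Oplus>\<chi>\<in>T. c \<chi> \<otimes> \<chi> (k \<otimes> u \<oplus> combine Ks Vs)) = k \<otimes> \<zero> \<oplus> \<zero>"
      using c(3)[of i] 1 by (simp add: i)
    then show ?case using k by simp
  next
    case ("2_1" Us)
    have "(\<Oplus>\<chi>\<in>T. c \<chi> \<otimes> \<chi> \<zero>) = (\<Oplus>\<chi>\<in>T. \<zero>)"
    proof (rule finsum_cong'[OF refl])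
      fix \<chi> assume "\<chi> \<in> T"
      then show "c \<chi> \<otimes> \<chi> \<zero> = \<zero>" using cc[of \<chi>] hz[of \<chi>] by simp
    qed simp
    then show ?case by simp
  next
    case ("2_2" Ks)
    have "(\<Oplus>\<chi>\<in>T. c \<chi> \<otimes> \<chi> \<zero>) = (\<Oplus>\<chi>\<in>T. \<zero>)"
    proof (rule finsum_cong'[OF refl])
      fix \<chi> assume "\<chi> \<in> T"
      then show "c \<chi> \<otimes> \<chi> \<zero> = \<zero>" using cc[of \<chi>] hz[of \<chi>] by simp
    qed simp
    then show ?case by simp
  qed
  have all: "(\<Oplus>\<chi>\<in>T. c \<chi> \<otimes> \<chi> a) = \<zero>" if "a \<in> A" for a
    using sum[of _ Us] that Us(4) Span_eq_combine_set[OF K Us(1)] by auto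
  have "c \<chi> = \<zero>" if "\<chi> \<in> T" for \<chi>
  proof (rule characters_independent[OF A.monoid_axioms T(2) _ _ _ c(1) _ that])
    fix \<eta> assume \<eta>: "\<eta> \<in> T"
    show "\<eta> \<in> hom (R\<lparr>carrier := A\<rparr>) R" using hom[OF \<eta>] by (auto simp: ring_hom_def hom_def)
    show "\<eta> \<one>\<^bsub>R\<lparr>carrier := A\<rparr>\<^esub> = \<one>" using ring_hom_one[OF hom[OF \<eta>]] by simp
    show "\<eta> \<in> extensional (carrier (R\<lparr>carrier := A\<rparr>))" using S(2) \<eta> T by auto
  qed (use all in auto)
  then show False using c by blast
qed

section \<open>Separability\<close>

context ring
begin

lemma length_rlin [simp]: "length (rlin c s q) = Suc (length q)"
  by (induction q arbitrary: s) auto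

lemma rlin_map2: "c \<in> carrier R \<Longrightarrow> rlin c s q = map2 (\<lambda>a b. a \<ominus> b \<otimes> c) (s # q) (q @ [\<one>])"
  by (induction q arbitrary: s) auto

text \<open>Bridge between the two encodings: the monic list with constant term first becomes the
  usual list after reversal with \<open>\<one>\<close> in front.\<close>

lemma eval_Cons_rev:
  assumes "set q \<subseteq> carrier R" "b \<in> carrier R"
  shows "eval (\<one> # rev q) b = peval \<one> q \<one> b"
  using assms
proof (induction q)
  case (Cons a q)
  have "eval ((\<one> # rev q) @ [a]) b = eval (\<one> # rev q) b \<otimes> b \<oplus> a"
    by (rule eval_append_aux) (use Cons in auto)
  also have "\<dots> = a \<oplus> peval \<one> q \<one> b \<otimes> b" using Cons by (simp add: a_comm)
  finally show ?case using Cons by simp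
qed simp

lemma formal_deriv_closed: "set p \<subseteq> carrier R \<Longrightarrow> set (formal_deriv R p) \<subseteq> carrier R"
  by (induction p rule: induct_list012) auto

lemma length_formal_deriv [simp]: "length (formal_deriv R p) = length p - 1"
  by (induction p rule: induct_list012) auto

text \<open>Appending \<open>a\<close> turns \<open>p\<close> into \<open>p t + a\<close>, so this
  is the product rule evaluated at \<open>b\<close>.\<close>

lemma eval_formal_deriv_append:
  assumes "set p \<subseteq> carrier R" "a \<in> carrier R" "b \<in> carrier R"
  shows "eval (formal_deriv R (p @ [a])) b = eval (formal_deriv R p) b \<otimes> b \<oplus> eval p b"
  using assms
proof (induction p rule: induct_list012)
  case (3 c d p)
  define E1 E2 where "E1 = eval (formal_deriv R (d # p)) b" and "E2 = eval (d # p) b"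
  have cl: "E1 \<in> carrier R" "E2 \<in> carrier R"
    unfolding E1_def E2_def using 3 formal_deriv_closed[of "d # p"] by (intro eval_in_carrier; simp)+
  have IH: "eval (formal_deriv R (d # p @ [a])) b = E1 \<otimes> b \<oplus> E2"
    using 3 by (simp add: E1_def E2_def del: eval.simps formal_deriv.simps)
  define n where "n = length p"
  have "eval (formal_deriv R ((c # d # p) @ [a])) b
    = [Suc (Suc n)] \<cdot> c \<otimes> b [^] Suc n \<oplus> (E1 \<otimes> b \<oplus> E2)"
    using IH by (simp add: n_def)
  moreover have "eval (formal_deriv R (c # d # p)) b = [Suc n] \<cdot> c \<otimes> b [^] n \<oplus> E1"
    by (simp add: E1_def n_def)
  moreover have "eval (c # d # p) b = c \<otimes> b [^] Suc n \<oplus> E2" by (simp add: E2_def n_def)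
  moreover have "[Suc (Suc n)] \<cdot> c = [Suc n] \<cdot> c \<oplus> c" using 3 by simp
  ultimately show ?case using 3 cl by (simp add: l_distr m_assoc a_ac del: add_pow_def)
qed auto

lemma peval_zero [simp]: "set q \<subseteq> carrier R \<Longrightarrow> l \<in> carrier R \<Longrightarrow> b \<in> carrier R \<Longrightarrow> peval l q \<zero> b = \<zero>"
  by (induction q) auto

text \<open>The derivative of \<open>q (t - x) + s\<close> is \<open>q' (t - x) + q\<close>, and the
  first term dies at \<open>x\<close>. The remainder \<open>s\<close> is general because unfolding
  \<open>rlin\<close> replaces it by a coefficient of \<open>q\<close>.\<close>

lemma eval_formal_deriv_rlin:
  assumes "set q \<subseteq> carrier R" "x \<in> carrier R" "s \<in> carrier R"
  shows "eval (formal_deriv R (\<one> # rev (rlin x s q))) x = eval (\<one> # rev q) x"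
  using assms
proof (induction q arbitrary: s)
  case Nil
  then show ?case by simp
next
  case (Cons a q)
  have q: "set q \<subseteq> carrier R" "a \<in> carrier R" "set (rlin x a q) \<subseteq> carrier R"
    using Cons.prems rlin_closed by auto
  have "eval (formal_deriv R ((\<one> # rev (rlin x a q)) @ [s \<ominus> a \<otimes> x])) x
    = eval (formal_deriv R (\<one> # rev (rlin x a q))) x \<otimes> x \<oplus> eval (\<one> # rev (rlin x a q)) x"
    by (rule eval_formal_deriv_append) (use q Cons.prems in auto)
  also have "eval (formal_deriv R (\<one> # rev (rlin x a q))) x = peval \<one> q \<one> x"
    using Cons.IH[of a] q Cons.prems eval_Cons_rev by simp
  also have "eval (\<one> # rev (rlin x a q)) x = a"
    using eval_Cons_rev[OF q(3)] peval_rlin[of x a q \<one> x] q Cons.prems by (simp add: minus_eq r_neg)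
  also have "peval \<one> q \<one> x \<otimes> x \<oplus> a = eval (\<one> # rev (a # q)) x"
    using eval_Cons_rev[of "a # q" x] q Cons.prems by (simp add: a_comm)
  finally show ?case by simp
qed

end

section \<open>Minimal polynomials dividing a power of a linear polynomial\<close>

context field
begin

lemma monic_poly_carrier: "set q \<subseteq> K \<Longrightarrow> subfield K R \<Longrightarrow> \<one> # rev q \<in> carrier (K[X])"
  using subringE(3)[OF subfieldE(1)] by (auto simp: sym[OF univ_poly_carrier] polynomial_def)

text \<open>In a field the side of the linear factor is immaterial, so \<open>rlin\<close> agrees
  with multiplication in the polynomial ring and root multiplicities become available.\<close>

lemma poly_mult_rlin:
  assumes "x \<in> carrier R" "set q \<subseteq> carrier R"
  shows "[\<one>, \<ominus> x] \<otimes>\<^bsub>poly_ring R\<^esub> (\<one> # rev q) = \<one> # rev (rlin x \<zero> q)"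
proof -
  let ?p = "\<one> # rev q"
  have p: "set ?p \<subseteq> carrier R" using assms by auto
  have "[\<one>, \<ominus> x] \<otimes>\<^bsub>poly_ring R\<^esub> ?p = poly_mult [\<one>, \<ominus> x] ?p" by (simp add: univ_poly_mult)
  also have "\<dots> = poly_add (map ((\<otimes>) \<one>) ?p @ [\<zero>]) (poly_mult [\<ominus> x] ?p)"
    by simp
  also have "map ((\<otimes>) \<one>) ?p = ?p" using p by (intro map_idI) auto
  also have "poly_mult [\<ominus> x] ?p = normalize (map ((\<otimes>) (\<ominus> x)) ?p)"
    using assms p poly_mult_const'[of ?p "\<ominus> x"] by blast
  also have "poly_add (?p @ [\<zero>]) (normalize (map ((\<otimes>) (\<ominus> x)) ?p)) = poly_add (?p @ [\<zero>]) (map ((\<otimes>) (\<ominus> x)) ?p)"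
    by (rule poly_add_normalize(2)[symmetric]) (use p assms in auto)
  also have "\<dots> = normalize (map2 (\<oplus>) (?p @ [\<zero>]) (\<zero> # map ((\<otimes>) (\<ominus> x)) ?p))"
    by simp
  also have "map2 (\<oplus>) (?p @ [\<zero>]) (\<zero> # map ((\<otimes>) (\<ominus> x)) ?p) = \<one> # rev (rlin x \<zero> q)"
  proof -
    let ?z = "zip (rev q @ [\<zero>]) (\<one> # rev q)"
    have "rev (rlin x \<zero> q) = map (\<lambda>(a, b). a \<ominus> b \<otimes> x) ?z"
    proof -
      have "rev (zip (\<zero> # q) (q @ [\<one>])) = zip (rev (\<zero> # q)) (rev (q @ [\<one>]))"
        by (rule zip_rev[symmetric]) simp
      then show ?thesis using assms by (simp add: rlin_map2 rev_map del: zip_Cons_Cons)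
    qed
    also have "\<dots> = map (\<lambda>(a, b). a \<oplus> \<ominus> x \<otimes> b) ?z"
    proof (rule map_cong[OF refl])
      fix y assume y: "y \<in> set ?z"
      obtain a b where ab: "y = (a, b)" by (cases y)
      have "a \<in> carrier R" "b \<in> carrier R"
        using y set_zip_leftD[of a b "rev q @ [\<zero>]" "\<one> # rev q"]
          set_zip_rightD[of a b "rev q @ [\<zero>]" "\<one> # rev q"] assms unfolding ab by auto
      then show "(case y of (a, b) \<Rightarrow> a \<ominus> b \<otimes> x) = (case y of (a, b) \<Rightarrow> a \<oplus> \<ominus> x \<otimes> b)"
        using assms by (simp add: ab minus_eq l_minus r_minus m_comm)
    qed
    also have "\<dots> = map2 (\<oplus>) (rev q @ [\<zero>]) (map ((\<otimes>) (\<ominus> x)) (\<one> # rev q))"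
      by (simp add: zip_map2 comp_def case_prod_beta' del: list.map zip_Cons_Cons)
    finally show ?thesis by simp
  qed
  finally show ?thesis by simp
qed

lemma roots_linear_power:
  assumes "x \<in> carrier R"
  shows "roots (\<one> # rev (linear_product (replicate m x))) = replicate_mset m x"
proof (induction m)
  case 0
  have "[\<one>] \<in> carrier (poly_ring R)" by (auto simp: sym[OF univ_poly_carrier] polynomial_def)
  then show ?case using degree_zero_imp_empty_roots[of "[\<one>]"] by (simp add: linear_product_def)
next
  case (Suc m)
  let ?q = "linear_product (replicate m x)"
  have q: "set ?q \<subseteq> carrier R" by (rule linear_product_closed) (use assms in auto)
  have "roots (\<one> # rev (rlin x \<zero> ?q)) = roots ([\<one>, \<ominus> x] \<otimes>\<^bsub>poly_ring R\<^esub> (\<one> # rev ?q))"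
    using poly_mult_rlin[OF assms q] by simp
  also have "\<dots> = add_mset x (roots (\<one> # rev ?q))"
    by (rule poly_mult_degree_one_monic_imp_same_roots[OF assms])
      (use monic_poly_carrier[OF q carrier_is_subfield] in auto)
  finally show ?case using Suc by (simp add: linear_product_def)
qed

text \<open>The minimal polynomial divides a power of \<open>t - x\<close>, so it splits and
  \<open>x\<close> is its only root. A second factor \<open>t - x\<close> would make its derivative
  vanish at \<open>x\<close>, contrary to separability; hence it is linear and its constant term
  lies in \<open>K\<close>.\<close>

lemma separable_linear_power:
  assumes K: "subfield K R" and x: "x \<in> carrier R" "\<not> transcendental K x" "separable_poly R K (Irr K x)"
    and f: "set (linear_product (replicate m x)) \<subseteq> K" "m > 0"
  shows "x \<in> K"
proof -
  let ?f = "\<one> # rev (linear_product (replicate m x))"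
  let ?I = "Irr K x"
  have alg: "(algebraic over K) x" using x by (simp add: over_def)
  note I = IrrE[OF K x(1) alg]
  have fK: "?f \<in> carrier (K[X])" using monic_poly_carrier[OF f(1) K] .
  have fR: "?f \<in> carrier (poly_ring R)" using carrier_polynomial_shell[OF subfieldE(1)[OF K] fK] .
  have IR: "?I \<in> carrier (poly_ring R)" using carrier_polynomial_shell[OF subfieldE(1)[OF K] I(1)] .
  have I0: "?I \<noteq> []" using I(3) I(2) by (auto simp: pirreducibleE(1)[OF subfieldE(1)[OF K] I(1)])
  have roots_f: "roots ?f = replicate_mset m x" by (rule roots_linear_power[OF x(1)])
  have "is_root ?f x" using roots_f f(2) roots_mem_iff_is_root[OF fR, of x] by simp
  then have "eval ?f x = \<zero>" unfolding is_root_def by blast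
  then have div: "?I pdivides ?f" using Irr_minimal[OF K x(1) alg fK] by simp
  have len: "length (linear_product cs) = length cs" for cs by (induction cs) (auto simp: linear_product_def)
  have "splitted ?f" using roots_f by (simp add: splitted_def len)
  then have spl: "splitted ?I" using pdivides_imp_splitted[OF IR fR _ _ div] by simp
  have sub: "roots ?I \<subseteq># replicate_mset m x" using pdivides_imp_roots_incl[OF IR fR _ div] roots_f by simp
  have "is_root ?I x" using I(4) x I0 by (simp add: is_root_def)
  then have "[\<one>, \<ominus> x] pdivides ?I" by (rule is_root_imp_pdivides[OF IR])
  \<comment> \<open>The minimal polynomial is \<open>t - x\<close> times \<open>w\<close>; whether
    \<open>x\<close> is a multiple root is decided by the roots of \<open>w\<close>.\<close>
  then obtain w where w: "w \<in> carrier (poly_ring R)" "?I = [\<one>, \<ominus> x] \<otimes>\<^bsub>poly_ring R\<^esub> w"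
    by (auto simp: pdivides_def factor_def)
  have "w \<noteq> []" using w I0 by (auto simp: univ_poly_mult poly_mult_zero)
  have wc: "set w \<subseteq> carrier R" using w(1) by (auto simp: sym[OF univ_poly_carrier] polynomial_def)
  have wp: "polynomial (carrier R) w" using w(1) by (simp add: univ_poly_carrier)
  have lp: "polynomial (carrier R) [\<one>, \<ominus> x]" using x by (auto simp: polynomial_def)
  have "lead_coeff ?I = \<one> \<otimes> lead_coeff w"
    using poly_mult_lead_coeff[OF carrier_is_subring lp wp] w(2) \<open>w \<noteq> []\<close> by (simp add: univ_poly_mult)
  then have "lead_coeff w = \<one>" using I(3) wc \<open>w \<noteq> []\<close> by (cases w) auto
  moreover define w' where "w' = rev (tl w)"
  ultimately have w': "w = \<one> # rev w'" "set w' \<subseteq> carrier R"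
    using wc \<open>w \<noteq> []\<close> by (cases w; simp)+
  have rI: "roots ?I = add_mset x (roots w)"
    using poly_mult_degree_one_monic_imp_same_roots[OF x(1) w(1) \<open>w \<noteq> []\<close>] w(2) by simp
  have Iw: "?I = \<one> # rev (rlin x \<zero> w')" using poly_mult_rlin[OF x(1) w'(2)] w w' by simp
  show ?thesis
  proof (cases "w' = []")
    case True
    then have "?I = [\<one>, \<ominus> x]" using Iw x by (simp add: minus_eq)
    then have "\<ominus> x \<in> K" using I(1) by (auto simp: sym[OF univ_poly_carrier] polynomial_def)
    then have "\<ominus> (\<ominus> x) \<in> K" using subringE(5)[OF subfieldE(1)[OF K]] by blast
    then show ?thesis using x by simp
  next
    case False
    have "size (roots w) = degree w" using spl rI Iw w' by (simp add: splitted_def)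
    then have "roots w \<noteq> {#}" using False w' by auto
    moreover have "set_mset (roots w) \<subseteq> {x}"
      using set_mset_mono[OF sub] rI by (auto split: if_splits)
    ultimately have "x \<in># roots w" by (metis set_mset_eq_empty_iff subset_singletonD singletonI)
    then have "eval w x = \<zero>" using roots_mem_iff_is_root[OF w(1)] by (simp add: is_root_def)
    then have d0: "eval (formal_deriv R ?I) x = \<zero>"
      using eval_formal_deriv_rlin[OF w'(2) x(1) zero_closed] Iw w' by simp
    let ?d = "normalize (formal_deriv R ?I)"
    have dK: "set (formal_deriv R ?I) \<subseteq> K"
    proof -
      interpret K: ring "R\<lparr>carrier := K\<rparr>" using subring_is_ring[OF subfieldE(1)[OF K]] .
      have "set ?I \<subseteq> K" using I(1) by (auto simp: sym[OF univ_poly_carrier] polynomial_def)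
      then have "set (formal_deriv (R\<lparr>carrier := K\<rparr>) ?I) \<subseteq> K" using K.formal_deriv_closed by simp
      moreover have "formal_deriv (R\<lparr>carrier := K\<rparr>) p = formal_deriv R p" for p
        by (induction p rule: induct_list012) (auto simp: add_pow_def nat_pow_def)
      ultimately show ?thesis by simp
    qed
    have dKX: "?d \<in> carrier (K[X])"
      using normalize_gives_polynomial[OF dK] by (simp add: univ_poly_carrier)
    have "eval ?d x = \<zero>" using d0 eval_normalize[OF _ x(1), of "formal_deriv R ?I"] dK subfieldE(3)[OF K] by auto
    \<comment> \<open>By minimality \<open>?I\<close> divides its own derivative, even if that is
      zero; separability then makes it a unit, against irreducibility.\<close>
    then have "?I pdivides ?d" using Irr_minimal[OF K x(1) alg dKX] by simp
    then have "?I divides\<^bsub>K[X]\<^esub> ?d" using pdivides_iff_shell[OF K I(1) dKX] by simp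
    moreover have "?I divides\<^bsub>K[X]\<^esub> ?I"
      using monoid.divides_refl[OF _ I(1)] ring.is_monoid[OF univ_poly_is_ring[OF subfieldE(1)[OF K]]] by blast
    ultimately have "?I \<in> Units (K[X])" using x(3) I(1) unfolding separable_poly_def by blast
    then show ?thesis using pirreducibleE(2)[OF subfieldE(1)[OF K] I(1,2)] by blast
  qed
qed

end

section \<open>Valued division rings\<close>

locale valued_skew_field = skew_field D for D :: "('a, 'b) ring_scheme" (structure) +
  fixes v :: "'a \<Rightarrow> 'g::linordered_ab_group_add"
  assumes valuation: "valuation D v"
begin

abbreviation "V \<equiv> val_ring D v"
abbreviation "M \<equiv> val_ideal D v"
abbreviation "E \<equiv> residue_ring D v"
abbreviation "res \<equiv> residue D v"

lemma val_mult [simp]: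
  assumes "x \<in> carrier D" "x \<noteq> \<zero>" "y \<in> carrier D" "y \<noteq> \<zero>"
  shows "v (x \<otimes> y) = v x + v y"
  using valuation assms by (simp add: valuation_def)

lemma val_add:
  assumes "x \<in> carrier D" "x \<noteq> \<zero>" "y \<in> carrier D" "y \<noteq> \<zero>" "x \<oplus> y \<noteq> \<zero>"
  shows "min (v x) (v y) \<le> v (x \<oplus> y)"
  using valuation assms by (simp add: valuation_def)

lemma val_one [simp]: "v \<one> = 0"
proof -
  have "v (\<one> \<otimes> \<one>) = v \<one> + v \<one>" by (rule val_mult) (auto simp: one_neq_zero)
  then show ?thesis by simp
qed

lemma val_inv [simp]: "x \<in> carrier D \<Longrightarrow> x \<noteq> \<zero> \<Longrightarrow> v (inv x) = - v x"
proof -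
  assume x: "x \<in> carrier D" "x \<noteq> \<zero>"
  then have "v (x \<otimes> inv x) = v x + v (inv x)" by (intro val_mult) auto
  then show ?thesis using x by (simp add: add_eq_0_iff)
qed

text \<open>Twice \<open>v (\<ominus> \<one>)\<close> is \<open>v \<one>\<close>, and an ordered
  group has no torsion.\<close>

lemma val_minus [simp]: "x \<in> carrier D \<Longrightarrow> v (\<ominus> x) = v x"
proof (cases "x = \<zero>")
  case False
  assume x: "x \<in> carrier D"
  have n: "\<ominus> \<one> \<noteq> \<zero>" using one_neq_zero by (metis minus_zero minus_minus one_closed)
  have "v (\<ominus> \<one> \<otimes> \<ominus> \<one>) = v (\<ominus> \<one>) + v (\<ominus> \<one>)" by (rule val_mult) (use n in auto)
  moreover have "\<ominus> \<one> \<otimes> \<ominus> \<one> = \<one>" by (simp add: l_minus)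
  ultimately have "v (\<ominus> \<one>) = 0" by simp
  moreover have "v (\<ominus> \<one> \<otimes> x) = v (\<ominus> \<one>) + v x" by (rule val_mult) (use n x False in auto)
  moreover have "\<ominus> \<one> \<otimes> x = \<ominus> x" using x by (simp add: l_minus)
  ultimately show ?thesis by simp
qed simp

lemma minus_nonzero: "x \<in> carrier D \<Longrightarrow> x \<noteq> \<zero> \<Longrightarrow> \<ominus> x \<noteq> \<zero>"
  by (metis minus_minus minus_zero)

lemma val_add_less:
  assumes "x \<in> carrier D" "x \<noteq> \<zero>" "y \<in> carrier D" "y \<noteq> \<zero>" "v x < v y"
  shows "x \<oplus> y \<noteq> \<zero>" "v (x \<oplus> y) = v x"
proof -
  show nz: "x \<oplus> y \<noteq> \<zero>"
  proof
    assume "x \<oplus> y = \<zero>"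
    then have "x = \<ominus> y" using assms by (simp add: minus_equality)
    then show False using assms by simp
  qed
  have "v x \<le> v (x \<oplus> y)" using val_add[OF assms(1-4) nz] assms(5) by simp
  moreover have "v (x \<oplus> y) \<le> v x"
  proof (rule ccontr)
    assume *: "\<not> v (x \<oplus> y) \<le> v x"
    have eq: "(x \<oplus> y) \<oplus> \<ominus> y = x" using assms by (simp add: a_assoc r_neg)
    have "min (v (x \<oplus> y)) (v (\<ominus> y)) \<le> v ((x \<oplus> y) \<oplus> \<ominus> y)"
      by (rule val_add) (use assms nz eq minus_nonzero in auto)
    then show False using * assms unfolding eq by (auto simp: min_def split: if_splits)
  qed
  ultimately show "v (x \<oplus> y) = v x" by simp
qed

lemma val_add_distinct:
  assumes "x \<in> carrier D" "x \<noteq> \<zero>" "y \<in> carrier D" "y \<noteq> \<zero>" "v x \<noteq> v y"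
  shows "x \<oplus> y \<noteq> \<zero>" "v (x \<oplus> y) = v x \<or> v (x \<oplus> y) = v y"
  using val_add_less[of x y] val_add_less[of y x] assms
  by (auto simp: neq_iff a_comm)

lemma val_pow:
  "x \<in> carrier D \<Longrightarrow> x \<noteq> \<zero> \<Longrightarrow> y \<in> carrier D \<Longrightarrow> y \<noteq> \<zero> \<Longrightarrow> v x = v y \<Longrightarrow> v (x [^] (n::nat)) = v (y [^] n)"
  by (induction n) auto

lemma val_ring_memI: "x \<in> carrier D \<Longrightarrow> (x \<noteq> \<zero> \<Longrightarrow> 0 \<le> v x) \<Longrightarrow> x \<in> V"
  by (auto simp: val_ring_def)

lemma val_ring_carrier: "x \<in> V \<Longrightarrow> x \<in> carrier D"
  by (auto simp: val_ring_def)

lemma val_ring_subring: "subring V D"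
proof (rule subringI)
  show "V \<subseteq> carrier D" using val_ring_carrier by auto
  show "\<one> \<in> V" by (auto simp: val_ring_def)
next
  fix x assume "x \<in> V" then show "\<ominus> x \<in> V" by (auto simp: val_ring_def)
next
  fix x y assume xy: "x \<in> V" "y \<in> V"
  then show "x \<otimes> y \<in> V"
    by (cases "x = \<zero>"; cases "y = \<zero>") (auto simp: val_ring_def)
  show "x \<oplus> y \<in> V"
  proof (cases "x = \<zero> \<or> y = \<zero> \<or> x \<oplus> y = \<zero>")
    case True
    then show ?thesis using xy by (auto simp: val_ring_def)
  next
    case False
    then have "0 \<le> min (v x) (v y)" using xy by (auto simp: val_ring_def)
    also have "\<dots> \<le> v (x \<oplus> y)" using False xy by (intro val_add) (auto simp: val_ring_def)
    finally show ?thesis using xy by (auto simp: val_ring_def)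
  qed
qed

lemmas val_ring_closed = subringE(5-7)[OF val_ring_subring]

lemma val_ring_one [simp]: "\<one> \<in> V" and val_ring_zero [simp]: "\<zero> \<in> V"
  by (auto simp: val_ring_def)

lemma val_ring_ring: "ring (D\<lparr>carrier := V\<rparr>)"
  by (rule subring_is_ring[OF val_ring_subring])

lemma val_ideal_ideal: "ideal M (D\<lparr>carrier := V\<rparr>)"
proof -
  interpret V: ring "D\<lparr>carrier := V\<rparr>" by (rule val_ring_ring)
  have MV: "M \<subseteq> V" by (auto simp: val_ideal_def val_ring_def)
  have closed: "x \<oplus> y \<in> M" if "x \<in> M" "y \<in> M" for x y
  proof (cases "x = \<zero> \<or> y = \<zero> \<or> x \<oplus> y = \<zero>")
    case True
    then show ?thesis using that by (auto simp: val_ideal_def)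
  next
    case False
    then have "0 < min (v x) (v y)" using that by (auto simp: val_ideal_def)
    also have "\<dots> \<le> v (x \<oplus> y)" using False that by (intro val_add) (auto simp: val_ideal_def)
    finally show ?thesis using that by (auto simp: val_ideal_def)
  qed
  have mult: "x \<otimes> y \<in> M" "y \<otimes> x \<in> M" if "x \<in> M" "y \<in> V" for x y
    using that by (cases "x = \<zero>"; cases "y = \<zero>";
        auto simp: val_ideal_def val_ring_def add_pos_nonneg add_nonneg_pos)+
  have minv: "\<ominus>\<^bsub>D\<lparr>carrier := V\<rparr>\<^esub> x = \<ominus> x" if "x \<in> M" for x
  proof (rule V.minus_equality)
    show "\<ominus> x \<oplus>\<^bsub>D\<lparr>carrier := V\<rparr>\<^esub> x = \<zero>\<^bsub>D\<lparr>carrier := V\<rparr>\<^esub>"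
      using that by (auto simp: val_ideal_def l_neg)
  qed (use that MV val_ring_closed in \<open>auto simp: val_ideal_def\<close>)
  have "subgroup M (add_monoid (D\<lparr>carrier := V\<rparr>))"
  proof (rule V.add.subgroupI)
    show "M \<noteq> {}" by (auto simp: val_ideal_def)
    fix a assume a: "a \<in> M"
    have "\<ominus> a \<in> M" using a by (auto simp: val_ideal_def)
    then show "\<ominus>\<^bsub>D\<lparr>carrier := V\<rparr>\<^esub> a \<in> M" using minv[OF a] by simp
  qed (use MV closed in auto)
  then show ?thesis
    by (intro idealI val_ring_ring) (use mult in auto)
qed

section \<open>The residue ring and the residues of subfields\<close>

lemma residue_hom: "res \<in> ring_hom (D\<lparr>carrier := V\<rparr>) E"
proof -
  have "(+>\<^bsub>D\<lparr>carrier := V\<rparr>\<^esub>) M \<in> ring_hom (D\<lparr>carrier := V\<rparr>) ((D\<lparr>carrier := V\<rparr>) Quot M)"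
    by (rule ideal.rcos_ring_hom[OF val_ideal_ideal])
  moreover have "(+>\<^bsub>D\<lparr>carrier := V\<rparr>\<^esub>) M = res"
    by (intro ext) (simp add: residue_def a_r_coset_def r_coset_def)
  ultimately show ?thesis by (simp add: residue_ring_def)
qed

lemma residue_ring_ring: "ring E"
  unfolding residue_ring_def by (rule ideal.quotient_is_ring[OF val_ideal_ideal])

sublocale E: ring E by (rule residue_ring_ring)

lemma residue_carrier: "carrier E = res ` V"
  by (auto simp: residue_ring_def FactRing_def A_RCOSETS_def RCOSETS_def residue_def a_r_coset_def r_coset_def)

lemma res_closed [simp]: "x \<in> V \<Longrightarrow> res x \<in> carrier E"
  by (auto simp: residue_carrier)

lemma res_mult: "x \<in> V \<Longrightarrow> y \<in> V \<Longrightarrow> res (x \<otimes> y) = res x \<otimes>\<^bsub>E\<^esub> res y"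
  using ring_hom_mult[OF residue_hom] by simp

lemma res_add: "x \<in> V \<Longrightarrow> y \<in> V \<Longrightarrow> res (x \<oplus> y) = res x \<oplus>\<^bsub>E\<^esub> res y"
  using ring_hom_add[OF residue_hom] by simp

lemma res_one [simp]: "res \<one> = \<one>\<^bsub>E\<^esub>"
  using ring_hom_one[OF residue_hom] by simp

lemma res_zero [simp]: "res \<zero> = \<zero>\<^bsub>E\<^esub>"
  using ring_hom_zero[OF residue_hom val_ring_ring residue_ring_ring] by simp

lemma res_eq_zero_iff: "x \<in> V \<Longrightarrow> res x = \<zero>\<^bsub>E\<^esub> \<longleftrightarrow> x \<in> M"
proof -
  assume x: "x \<in> V"
  interpret V: ring "D\<lparr>carrier := V\<rparr>" by (rule val_ring_ring)
  interpret I: ideal M "D\<lparr>carrier := V\<rparr>" by (rule val_ideal_ideal)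
  have eq: "M +>\<^bsub>D\<lparr>carrier := V\<rparr>\<^esub> y = res y" for y
    by (simp add: residue_def a_r_coset_def r_coset_def)
  have "\<zero>\<^bsub>E\<^esub> = M" by (simp add: residue_ring_def FactRing_def)
  then show ?thesis
    using I.rcos_const_imp_mem[of x] V.a_rcos_zero[OF val_ideal_ideal, of x] x by (auto simp: eq)
qed

lemma res_minus: "x \<in> V \<Longrightarrow> res (\<ominus> x) = \<ominus>\<^bsub>E\<^esub> res x"
proof -
  assume x: "x \<in> V"
  have "res (\<ominus> x) \<oplus>\<^bsub>E\<^esub> res x = \<zero>\<^bsub>E\<^esub>"
    using x val_ring_closed val_ring_carrier res_add[of "\<ominus> x" x] by (simp add: l_neg)
  then show ?thesis using x val_ring_closed by (metis E.minus_equality res_closed)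
qed

lemma res_eq_iff: "x \<in> V \<Longrightarrow> y \<in> V \<Longrightarrow> res x = res y \<longleftrightarrow> x \<ominus> y \<in> M"
proof -
  assume xy: "x \<in> V" "y \<in> V"
  have "res x = res y \<longleftrightarrow> res x \<ominus>\<^bsub>E\<^esub> res y = \<zero>\<^bsub>E\<^esub>" using xy by (simp add: E.r_right_minus_eq)
  also have "res x \<ominus>\<^bsub>E\<^esub> res y = res (x \<ominus> y)"
    using xy val_ring_closed by (simp add: minus_eq E.minus_eq res_add res_minus)
  also have "\<dots> = \<zero>\<^bsub>E\<^esub> \<longleftrightarrow> x \<ominus> y \<in> M"
    using xy val_ring_closed by (intro res_eq_zero_iff) (auto simp: minus_eq)
  finally show ?thesis .
qed

lemma unit_val_ring: "x \<in> carrier D \<Longrightarrow> x \<noteq> \<zero> \<Longrightarrow> v x = 0 \<Longrightarrow> x \<in> V"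
  by (auto simp: val_ring_def)

lemma res_nonzero_iff: "x \<in> V \<Longrightarrow> res x \<noteq> \<zero>\<^bsub>E\<^esub> \<longleftrightarrow> x \<noteq> \<zero> \<and> v x = 0"
  using res_eq_zero_iff[of x] by (auto simp: val_ring_def val_ideal_def)

lemma res_inv:
  assumes "x \<in> carrier D" "x \<noteq> \<zero>" "v x = 0"
  shows "res x \<otimes>\<^bsub>E\<^esub> res (inv x) = \<one>\<^bsub>E\<^esub>" "res (inv x) \<otimes>\<^bsub>E\<^esub> res x = \<one>\<^bsub>E\<^esub>"
  using assms unit_val_ring by (simp_all add: res_mult[symmetric])

lemma E_one_nonzero: "\<one>\<^bsub>E\<^esub> \<noteq> \<zero>\<^bsub>E\<^esub>"
  using res_nonzero_iff[of \<one>] by (simp add: one_neq_zero)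

lemma subring_val: "subring K D \<Longrightarrow> subring (V \<inter> K) (D\<lparr>carrier := V\<rparr>)"
proof -
  assume K: "subring K D"
  interpret V: ring "D\<lparr>carrier := V\<rparr>" by (rule val_ring_ring)
  have "ring (D\<lparr>carrier := V \<inter> K\<rparr>)"
    using subring_is_ring[OF subring_inter[OF val_ring_subring K]] .
  then show ?thesis by (intro V.ring_incl_imp_subring) auto
qed


lemma residue_ring_hom_ring: "ring_hom_ring (D\<lparr>carrier := V\<rparr>) E res"
  by (rule ring_hom_ringI2[OF val_ring_ring residue_ring_ring residue_hom])

lemma subfield_inv: "subfield K D \<Longrightarrow> x \<in> K \<Longrightarrow> x \<noteq> \<zero> \<Longrightarrow> inv x \<in> K"
  using subfield_m_inv(1)[of K x] by auto

lemma sub_residue_subring: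
  assumes "subring K D" shows "subring (sub_residue D v K) E"
  unfolding sub_residue_def
  by (rule ring_hom_ring.img_is_subring[OF residue_ring_hom_ring subring_val[OF assms]])

lemma sub_residue_subfield:
  assumes "field E" "subfield K D" shows "subfield (sub_residue D v K) E"
proof -
  interpret F: field E by (rule assms)
  show ?thesis
  proof (rule F.subfieldI'[OF sub_residue_subring[OF subfieldE(1)[OF assms(2)]]])
    fix k assume k: "k \<in> sub_residue D v K - {\<zero>\<^bsub>E\<^esub>}"
    then obtain x where x: "x \<in> V" "x \<in> K" "k = res x" by (auto simp: sub_residue_def)
    then have nz: "x \<in> carrier D" "x \<noteq> \<zero>" "v x = 0" using k res_nonzero_iff[of x] val_ring_carrier by auto
    have ix: "inv x \<in> V" "inv x \<in> K" using nz x subfield_inv[OF assms(2)] by (auto intro: unit_val_ring)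
    have "inv\<^bsub>E\<^esub> k = res (inv x)"
      using res_inv[OF nz] x ix by (intro E.inv_char) auto
    then show "inv\<^bsub>E\<^esub> k \<in> sub_residue D v K" using ix by (auto simp: sub_residue_def)
  qed
qed

section \<open>Conjugation acting on residues\<close>

definition conj_by :: "'a \<Rightarrow> 'a \<Rightarrow> 'a" where
  "conj_by x d = x \<otimes> d \<otimes> inv x"

text \<open>The map \<theta>_D of the theorem, indexed by elements of \<open>D\<close> instead of
  classes of values. \<open>theta_res\<close> removes the choice of the lift, and
  \<open>theta_cong\<close> shows that only the class of the value matters.\<close>

definition theta :: "'a \<Rightarrow> 'a set \<Rightarrow> 'a set" where
  "theta x = (\<lambda>e\<in>carrier E. res (conj_by x (SOME d. d \<in> V \<and> res d = e)))"

context
  fixes x assumes x: "x \<in> carrier D" "x \<noteq> \<zero>"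
begin

lemma conj_by_closed [simp]: "d \<in> carrier D \<Longrightarrow> conj_by x d \<in> carrier D"
  using x by (simp add: conj_by_def)

lemma conj_by_nonzero [simp]: "d \<in> carrier D \<Longrightarrow> d \<noteq> \<zero> \<Longrightarrow> conj_by x d \<noteq> \<zero>"
  using x by (simp add: conj_by_def)

lemma val_conj_by [simp]: "d \<in> carrier D \<Longrightarrow> d \<noteq> \<zero> \<Longrightarrow> v (conj_by x d) = v d"
  using x by (simp add: conj_by_def)

lemma conj_by_mult: "d \<in> carrier D \<Longrightarrow> e \<in> carrier D \<Longrightarrow> conj_by x (d \<otimes> e) = conj_by x d \<otimes> conj_by x e"
  using x by (simp add: conj_by_def m_assoc)

lemma conj_by_add: "d \<in> carrier D \<Longrightarrow> e \<in> carrier D \<Longrightarrow> conj_by x (d \<oplus> e) = conj_by x d \<oplus> conj_by x e"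
  using x by (simp add: conj_by_def r_distr l_distr)

lemma conj_by_one [simp]: "conj_by x \<one> = \<one>"
  using x by (simp add: conj_by_def)

lemma conj_by_zero [simp]: "conj_by x \<zero> = \<zero>"
  using x by (simp add: conj_by_def)

lemma conj_by_hom: "conj_by x \<in> ring_hom D D"
  by (rule ring_hom_memI) (auto simp: conj_by_mult conj_by_add)

lemma conj_by_val_ring: "d \<in> V \<Longrightarrow> conj_by x d \<in> V"
  by (cases "d = \<zero>") (auto simp: val_ring_def)

lemma conj_by_minus: "d \<in> carrier D \<Longrightarrow> conj_by x (\<ominus> d) = \<ominus> conj_by x d"
  using x by (simp add: conj_by_def l_minus r_minus)

lemma conj_by_val_ideal: "d \<in> M \<Longrightarrow> conj_by x d \<in> M"
  by (cases "d = \<zero>") (auto simp: val_ideal_def)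

lemma theta_res: assumes d: "d \<in> V" shows "theta x (res d) = res (conj_by x d)"
proof -
  define d' where "d' = (SOME d'. d' \<in> V \<and> res d' = res d)"
  have d': "d' \<in> V" "res d' = res d"
    using someI[of "\<lambda>d'. d' \<in> V \<and> res d' = res d" d] d by (auto simp: d'_def)
  then have "d' \<ominus> d \<in> M" using d res_eq_iff by simp
  then have "conj_by x (d' \<ominus> d) \<in> M" by (rule conj_by_val_ideal)
  moreover have "conj_by x (d' \<ominus> d) = conj_by x d' \<ominus> conj_by x d"
    using d d' val_ring_carrier by (simp add: minus_eq conj_by_add conj_by_minus)
  ultimately have "res (conj_by x d') = res (conj_by x d)"
    using conj_by_val_ring d d' by (simp add: res_eq_iff)
  then show ?thesis using d by (simp add: theta_def d'_def)
qed

lemma theta_hom: "theta x \<in> ring_hom E E"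
proof (rule ring_hom_memI)
  fix a assume "a \<in> carrier E"
  then show "theta x a \<in> carrier E" using conj_by_val_ring by (auto simp: residue_carrier theta_res)
next
  fix a b assume "a \<in> carrier E" "b \<in> carrier E"
  then obtain d e where de: "d \<in> V" "e \<in> V" "a = res d" "b = res e" by (auto simp: residue_carrier)
  have "theta x (a \<otimes>\<^bsub>E\<^esub> b) = theta x (res (d \<otimes> e))" using de by (simp add: res_mult)
  also have "\<dots> = res (conj_by x d \<otimes> conj_by x e)"
    using de val_ring_closed val_ring_carrier by (simp add: theta_res conj_by_mult)
  finally show "theta x (a \<otimes>\<^bsub>E\<^esub> b) = theta x a \<otimes>\<^bsub>E\<^esub> theta x b"
    using de conj_by_val_ring by (simp add: theta_res res_mult)
  have "theta x (a \<oplus>\<^bsub>E\<^esub> b) = theta x (res (d \<oplus> e))" using de by (simp add: res_add)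
  also have "\<dots> = res (conj_by x d \<oplus> conj_by x e)"
    using de val_ring_closed val_ring_carrier by (simp add: theta_res conj_by_add)
  finally show "theta x (a \<oplus>\<^bsub>E\<^esub> b) = theta x a \<oplus>\<^bsub>E\<^esub> theta x b"
    using de conj_by_val_ring by (simp add: theta_res res_add)
next
  show "theta x \<one>\<^bsub>E\<^esub> = \<one>\<^bsub>E\<^esub>" using theta_res[of \<one>] by simp
qed

lemma theta_closed: "a \<in> carrier E \<Longrightarrow> theta x a \<in> carrier E"
  using theta_hom by (rule ring_hom_closed)

end

lemma theta_extensional: "theta x \<in> extensional (carrier E)"
  by (simp add: theta_def)

lemma theta_mult:
  assumes "x \<in> carrier D" "x \<noteq> \<zero>" "y \<in> carrier D" "y \<noteq> \<zero>" "a \<in> carrier E"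
  shows "theta (x \<otimes> y) a = theta x (theta y a)"
proof -
  obtain d where d: "d \<in> V" "a = res d" using assms(5) by (auto simp: residue_carrier)
  have "conj_by (x \<otimes> y) d = conj_by x (conj_by y d)"
    using assms d val_ring_carrier by (simp add: conj_by_def m_assoc)
  then show ?thesis using assms d conj_by_val_ring by (simp add: theta_res)
qed

lemma theta_central:
  assumes "x \<in> ring_center D" "x \<noteq> \<zero>" "a \<in> carrier E"
  shows "theta x a = a"
proof -
  obtain d where d: "d \<in> V" "a = res d" using assms(3) by (auto simp: residue_carrier)
  have x: "x \<in> carrier D" "d \<in> carrier D" "x \<otimes> d = d \<otimes> x"
    using assms d val_ring_carrier by (auto simp: ring_center_def)
  have "conj_by x d = d" using x assms by (simp add: conj_by_def m_assoc)
  then show ?thesis using d x assms by (simp add: theta_res)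
qed

lemma theta_in_gal:
  assumes "x \<in> carrier D" "x \<noteq> \<zero>"
  shows "theta x \<in> carrier (gal_group E (sub_residue D v (ring_center D)))"
proof (rule E.gal_group_memI[where g = "theta (inv x)"])
  fix a assume "a \<in> sub_residue D v (ring_center D)"
  then obtain d where d: "d \<in> V" "d \<in> ring_center D" "a = res d" by (auto simp: sub_residue_def)
  have "conj_by x d = d" using d assms by (auto simp: conj_by_def ring_center_def m_assoc)
  then show "theta x a = a" using d assms by (simp add: theta_res)
next
  have one: "theta \<one> a = a" if "a \<in> carrier E" for a
    using that theta_central[of \<one> a] one_neq_zero by (auto simp: ring_center_def)
  show "theta x (theta (inv x) a) = a" "theta (inv x) (theta x a) = a" if "a \<in> carrier E" for a
    using theta_mult[of x "inv x" a] theta_mult[of "inv x" x a] assms one that by auto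
qed (use assms theta_hom theta_extensional theta_closed[of "inv x"] in auto)

text \<open>Conjugation by a unit of the valuation ring reduces to conjugation inside the residue
  ring, which is trivial because that ring is commutative.\<close>

lemma theta_unit:
  assumes "field E" "x \<in> carrier D" "x \<noteq> \<zero>" "v x = 0" "a \<in> carrier E"
  shows "theta x a = a"
proof -
  interpret F: field E by (rule assms)
  obtain d where d: "d \<in> V" "a = res d" using assms(5) by (auto simp: residue_carrier)
  have x: "x \<in> V" "inv x \<in> V" using assms by (auto intro: unit_val_ring)
  have "res (conj_by x d) = res x \<otimes>\<^bsub>E\<^esub> res d \<otimes>\<^bsub>E\<^esub> res (inv x)"
    using x d val_ring_closed by (simp add: conj_by_def res_mult)
  also have "\<dots> = res d \<otimes>\<^bsub>E\<^esub> (res x \<otimes>\<^bsub>E\<^esub> res (inv x))"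
    using x d by (simp add: F.m_ac)
  finally show ?thesis using d x assms res_inv[of x] by (simp add: theta_res)
qed

section \<open>Value classes and the fundamental inequality\<close>

definition val_of :: "'a set \<Rightarrow> 'g set" where
  "val_of K = v ` (K - {\<zero>})"

lemma val_of_subfield:
  assumes "subfield K D"
  shows "0 \<in> val_of K" "a \<in> val_of K \<Longrightarrow> b \<in> val_of K \<Longrightarrow> a + b \<in> val_of K"
    "a \<in> val_of K \<Longrightarrow> - a \<in> val_of K" "a \<in> val_of K \<Longrightarrow> b \<in> val_of K \<Longrightarrow> a - b \<in> val_of K"
proof -
  have K: "K \<subseteq> carrier D" "\<one> \<in> K" using subfieldE(3)[OF assms] subringE(3)[OF subfieldE(1)[OF assms]] by auto
  show "0 \<in> val_of K" unfolding val_of_def using K one_neq_zero val_one by (metis DiffI imageI singletonD)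
  show add: "a + b \<in> val_of K" if ab: "a \<in> val_of K" "b \<in> val_of K" for a b
  proof -
    obtain x y where xy: "x \<in> K - {\<zero>}" "y \<in> K - {\<zero>}" "a = v x" "b = v y"
      using ab by (auto simp: val_of_def)
    then have xD: "x \<in> carrier D" "y \<in> carrier D" using K by auto
    have "x \<otimes> y \<in> K - {\<zero>}" using xy xD subringE(6)[OF subfieldE(1)[OF assms]] mult_nonzero[of x y] by auto
    moreover have "v (x \<otimes> y) = a + b" using xy xD by auto
    ultimately show ?thesis unfolding val_of_def by (metis imageI)
  qed
  show neg: "- a \<in> val_of K" if a: "a \<in> val_of K" for a
  proof -
    obtain x where x: "x \<in> K - {\<zero>}" "a = v x" using a by (auto simp: val_of_def)
    have "inv x \<in> K - {\<zero>}" using x K subfield_inv[OF assms, of x] inv_nonzero[of x] by auto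
    moreover have "v (inv x) = - a" using x K by auto
    ultimately show ?thesis unfolding val_of_def by (metis imageI)
  qed
  show "a - b \<in> val_of K" if "a \<in> val_of K" "b \<in> val_of K"
    using add[OF that(1) neg[OF that(2)]] by simp
qed

text \<open>An infinite index would be recorded by \<open>card\<close> as 0, so positivity of
  \<open>value_index\<close> supplies the finiteness of the set of representatives.\<close>

lemma value_index_representatives:
  assumes K: "subfield K D" and pos: "value_index D v K > 0"
  obtains Y where "finite Y" "card Y = value_index D v K" "Y \<subseteq> carrier D - {\<zero>}"
    "\<And>x y. x \<in> Y \<Longrightarrow> y \<in> Y \<Longrightarrow> v x - v y \<in> val_of K \<Longrightarrow> x = y"
    "\<And>x. x \<in> carrier D \<Longrightarrow> x \<noteq> \<zero> \<Longrightarrow> \<exists>y\<in>Y. v x - v y \<in> val_of K"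
proof -
  define C where "C g = (\<lambda>h. h + g) ` val_of K" for g
  define I where "I = (\<lambda>x. C (v x)) ` (carrier D - {\<zero>})"
  have rc: "rcosets\<^bsub>value_group D v\<^esub> (carrier (value_group (D\<lparr>carrier := K\<rparr>) v)) = I"
    by (auto simp: RCOSETS_def r_coset_def value_group_def I_def C_def val_of_def)
  have card: "card I = value_index D v K" by (simp add: value_index_def rc)
  have Ceq: "C g = C h \<longleftrightarrow> g - h \<in> val_of K" for g h
  proof
    assume "C g = C h"
    moreover have "g \<in> C g" unfolding C_def using val_of_subfield(1)[OF K] by (metis add_0 imageI)
    ultimately obtain k where "k \<in> val_of K" "g = k + h" by (auto simp: C_def)
    then show "g - h \<in> val_of K" by simp
  next
    assume gh: "g - h \<in> val_of K"
    show "C g = C h"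
    proof (intro equalityI subsetI)
      fix z assume "z \<in> C g"
      then obtain k where k: "k \<in> val_of K" "z = k + g" by (auto simp: C_def)
      have "z = (k + (g - h)) + h" using k by simp
      then show "z \<in> C h" unfolding C_def using val_of_subfield(2)[OF K k(1) gh] by blast
    next
      fix z assume "z \<in> C h"
      then obtain k where k: "k \<in> val_of K" "z = k + h" by (auto simp: C_def)
      have "z = (k - (g - h)) + g" using k by simp
      then show "z \<in> C g" unfolding C_def using val_of_subfield(4)[OF K k(1) gh] by blast
    qed
  qed
  define rep where "rep c = (SOME x. x \<in> carrier D - {\<zero>} \<and> C (v x) = c)" for c
  have rep: "rep c \<in> carrier D - {\<zero>}" "C (v (rep c)) = c" if "c \<in> I" for c
  proof -
    have "\<exists>x. x \<in> carrier D - {\<zero>} \<and> C (v x) = c" using that by (auto simp: I_def)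
    from someI_ex[OF this] show "rep c \<in> carrier D - {\<zero>}" "C (v (rep c)) = c"
      unfolding rep_def by blast+
  qed
  have inj: "inj_on rep I" using rep(2) by (metis inj_onI)
  show thesis
  proof (rule that[of "rep ` I"])
    have "finite I" using pos card by (intro card_ge_0_finite) simp
    then show "finite (rep ` I)" by simp
    show "card (rep ` I) = value_index D v K" using card_image[OF inj] card by simp
    show "rep ` I \<subseteq> carrier D - {\<zero>}" using rep by auto
  next
    fix x y assume xy: "x \<in> rep ` I" "y \<in> rep ` I" "v x - v y \<in> val_of K"
    obtain c d where cd: "c \<in> I" "d \<in> I" "x = rep c" "y = rep d" using xy by auto
    have "C (v x) = C (v y)" using xy Ceq by simp
    then show "x = y" using rep(2) cd by simp
  next
    fix x assume x: "x \<in> carrier D" "x \<noteq> \<zero>"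
    have "C (v x) \<in> I" using x by (auto simp: I_def)
    then have "C (v x) = C (v (rep (C (v x))))" using rep(2) by simp
    then have "v x - v (rep (C (v x))) \<in> val_of K" using Ceq by blast
    then show "\<exists>y\<in>rep ` I. v x - v y \<in> val_of K" using \<open>C (v x) \<in> I\<close> by blast
  qed
qed

lemma combine_val_ring:
  "set Ks \<subseteq> V \<Longrightarrow> set Us \<subseteq> V \<Longrightarrow>
   combine Ks Us \<in> V \<and> res (combine Ks Us) = E.combine (map res Ks) (map res Us)"
  by (induction Ks Us rule: combine.induct) (auto simp: res_add res_mult val_ring_closed)

text \<open>Scaling by a coefficient of least value reduces a combination to one with integral coefficients
  and nonzero residue.\<close>

lemma combine_value:
  assumes K: "subfield K D" and Us: "set Us \<subseteq> V"
    and E: "field E" and ind: "E.independent (sub_residue D v K) (map res Us)"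
    and Ks: "set Ks \<subseteq> K" "length Ks = length Us" "\<not> set Ks \<subseteq> {\<zero>}"
  shows "combine Ks Us \<noteq> \<zero> \<and> v (combine Ks Us) \<in> val_of K"
proof -
  have KD: "K \<subseteq> carrier D" using subfieldE(3)[OF K] .
  have UD: "set Us \<subseteq> carrier D" using Us val_ring_carrier by auto
  let ?S = "set Ks - {\<zero>}"
  have "finite (v ` ?S)" "v ` ?S \<noteq> {}" using Ks by auto
  then obtain k where k: "k \<in> ?S" "v k = Min (v ` ?S)" using Min_in[of "v ` ?S"] by fastforce
  have kmin: "v k \<le> v k'" if "k' \<in> ?S" for k' using that k \<open>finite (v ` ?S)\<close> by auto
  have kc: "k \<in> carrier D" "k \<noteq> \<zero>" "k \<in> K" using k Ks KD by auto
  have ik: "inv k \<in> K" using subfield_inv[OF K] kc by auto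
  define Ls where "Ls = map ((\<otimes>) (inv k)) Ks"
  have LV: "set Ls \<subseteq> V"
  proof
    fix l assume "l \<in> set Ls"
    then obtain k' where k': "k' \<in> set Ks" "l = inv k \<otimes> k'" by (auto simp: Ls_def)
    have "k' \<in> carrier D" using k' Ks KD by auto
    then show "l \<in> V" using k' kc kmin[of k'] by (cases "k' = \<zero>") (auto intro!: val_ring_memI)
  qed
  have LK: "set Ls \<subseteq> K" using Ks ik subringE(6)[OF subfieldE(1)[OF K]] by (auto simp: Ls_def)
  \<comment> \<open>The coefficient of least value becomes \<open>\<one>\<close>, so the reduced
    combination has a nonzero coefficient and independence over the residue field applies.\<close>
  have one: "\<one> \<in> set Ls" unfolding Ls_def using k kc by (auto intro!: image_eqI[of _ _ k])
  have lc: "combine Ls Us \<in> V" "res (combine Ls Us) = E.combine (map res Ls) (map res Us)"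
    using combine_val_ring[OF LV Us] by auto
  have "E.combine (map res Ls) (map res Us) \<noteq> \<zero>\<^bsub>E\<^esub>"
  proof
    assume z: "E.combine (map res Ls) (map res Us) = \<zero>\<^bsub>E\<^esub>"
    have "set (take (length (map res Us)) (map res Ls)) \<subseteq> {\<zero>\<^bsub>E\<^esub>}"
      by (rule E.independent_imp_trivial_combine[OF sub_residue_subfield[OF E K] ind _ z])
        (use LK LV in \<open>auto simp: sub_residue_def\<close>)
    moreover have "take (length (map res Us)) (map res Ls) = map res Ls" using Ks by (simp add: Ls_def)
    ultimately have "res \<one> = \<zero>\<^bsub>E\<^esub>" using one by (metis image_eqI list.set_map singletonD subsetD)
    then show False using E_one_nonzero by simp
  qed
  then have l: "combine Ls Us \<noteq> \<zero>" "v (combine Ls Us) = 0" using lc res_nonzero_iff by auto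
  have "combine Ls Us = inv k \<otimes> combine Ks Us"
    unfolding Ls_def using Ks KD UD kc by (intro combine_r_distr[symmetric]) auto
  moreover have cc: "combine Ks Us \<in> carrier D" using Ks KD UD by auto
  ultimately have eq: "combine Ks Us = k \<otimes> combine Ls Us" using kc by simp
  then have "combine Ks Us \<noteq> \<zero>" "v (combine Ks Us) = v k"
    using l kc lc(1) val_ring_carrier by auto
  then show ?thesis using kc by (auto simp: val_of_def)
qed

end

lemma (in ring) peval_shift:
  assumes "set p \<subseteq> carrier R" "l \<in> carrier R" "y \<in> carrier R" "b \<in> carrier R"
  shows "peval l p (y \<otimes> b) b = peval l p y b \<otimes> b"
  using assms by (induction p) (simp_all add: l_distr m_assoc)

lemma (in ring) combine_powers:
  assumes "set Ks \<subseteq> carrier R" "y \<in> carrier R" "b \<in> carrier R"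
  shows "combine Ks (map (\<lambda>i. y \<otimes> b [^] i) [0..<length Ks]) = peval \<zero> Ks y b"
  using assms
proof (induction Ks arbitrary: y)
  case (Cons a Ks)
  have pow: "b [^] i \<otimes> b = b \<otimes> b [^] i" for i :: nat
    using nat_pow_Suc2[OF Cons.prems(3), of i] by simp
  have *: "map (\<lambda>i. y \<otimes> b [^] i) [0..<length (a # Ks)] =
    y \<otimes> b [^] (0::nat) # map (\<lambda>i. (y \<otimes> b) \<otimes> b [^] i) [0..<length Ks]"
    using Cons.prems pow
    by (simp add: upt_conv_Cons map_Suc_upt[symmetric] comp_def m_assoc del: upt_Suc)
  show ?case unfolding * using Cons.IH[of "y \<otimes> b"] Cons.prems by (simp add: peval_shift)
qed simp

text \<open>The first \<open>N + 1\<close> powers of \<open>d\<close> lie in a space of dimension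
  \<open>N\<close>, so they are dependent over \<open>K\<close>.\<close>

lemma (in skew_field) exists_vanishing:
  assumes K: "subfield K R" and dim: "dimension N K B" and d: "d \<in> carrier R" "\<And>i::nat. d [^] i \<in> B"
  obtains f where "set f \<subseteq> K" "peval \<one> f \<one> d = \<zero>"
proof -
  have KR: "K \<subseteq> carrier R" using subfieldE(3)[OF K] .
  define Us where "Us = map (\<lambda>i. \<one> \<otimes> d [^] i) [0..<Suc N]"
  have Us: "set Us \<subseteq> carrier R" "set Us \<subseteq> B" "length Us = Suc N" using d by (auto simp: Us_def)
  have "dependent K Us"
  proof
    assume "independent K Us"
    then have "length Us \<le> N" using independent_length_le_dimension[OF K dim] Us by blast
    then show False using Us by simp
  qed
  then obtain Ks where Ks: "length Ks = length Us" "combine Ks Us = \<zero>" "set Ks \<subseteq> K" "set Ks \<noteq> {\<zero>}"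
    using dependent_imp_non_trivial_combine[OF K Us(1)] by metis
  have nz: "\<not> set Ks \<subseteq> {\<zero>}"
  proof
    assume "set Ks \<subseteq> {\<zero>}"
    then have "set Ks = {\<zero>}" using Ks(1) Us(3) by (cases Ks) auto
    then show False using Ks by simp
  qed
  have KsR: "set Ks \<subseteq> carrier R" using Ks KR by auto
  have z: "peval \<zero> Ks \<one> d = \<zero>"
    using combine_powers[OF KsR one_closed d(1)] Ks(1,2) Us(3) unfolding Us_def by simp
  obtain q u where q: "u \<in> carrier R" "u \<noteq> \<zero>" "inv u \<in> set Ks" "set q \<subseteq> (\<otimes>) u ` set Ks"
    "\<And>y b. y \<in> carrier R \<Longrightarrow> b \<in> carrier R \<Longrightarrow> peval \<one> q y b = u \<otimes> peval \<zero> Ks y b"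
    using peval_normalise[OF KsR nz] by metis
  \<comment> \<open>The leading coefficient \<open>inv u\<close> is one of the coefficients in
    \<open>K\<close>, so making the polynomial monic does not leave \<open>K\<close>.\<close>
  have "inv u \<in> K - {\<zero>}" using q(1-3) Ks(3) inv_nonzero[of u] by blast
  then have "inv (inv u) \<in> K" using subfield_m_inv(1)[OF K] by blast
  then have "u \<in> K" using q by simp
  then have "set q \<subseteq> K" using q(4) Ks(3) subringE(6)[OF subfieldE(1)[OF K]] by blast
  moreover have "peval \<one> q \<one> d = \<zero>" using q d z by simp
  ultimately show thesis by (rule that)
qed

lemma (in ring) peval_consistent: "subring H R \<Longrightarrow> ring.peval (R\<lparr>carrier := H\<rparr>) l p y b = peval l p y b"
  by (induction p) (simp_all add: ring.peval.simps[OF subring_is_ring])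

lemma (in ring) a_inv_consistent:
  assumes "subring H R" "x \<in> H" shows "\<ominus>\<^bsub>R\<lparr>carrier := H\<rparr>\<^esub> x = \<ominus> x"
proof -
  interpret H: ring "R\<lparr>carrier := H\<rparr>" by (rule subring_is_ring[OF assms(1)])
  have "x \<in> carrier R" using assms subringE(1) by blast
  then show ?thesis using assms subringE(5)[OF assms(1)] by (intro H.minus_equality) (auto simp: l_neg)
qed

lemma (in ring) linear_product_consistent:
  assumes H: "subring H R" "set cs \<subseteq> H"
  shows "ring.linear_product (R\<lparr>carrier := H\<rparr>) cs = linear_product cs"
proof -
  interpret H: ring "R\<lparr>carrier := H\<rparr>" by (rule subring_is_ring[OF H(1)])
  have rlin: "H.rlin c s q = rlin c s q" if "c \<in> H" "s \<in> H" "set q \<subseteq> H" for c s q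
    using that by (induction q arbitrary: s)
      (simp_all add: a_minus_def a_inv_consistent[OF H(1)] subringE(6)[OF H(1)])
  have "H.linear_product cs = linear_product cs \<and> set (H.linear_product cs) \<subseteq> H"
    using H(2)
  proof (induction cs)
    case (Cons c cs)
    have "set (H.linear_product (c # cs)) \<subseteq> H" using H.linear_product_closed[of "c # cs"] Cons.prems by simp
    moreover have IH: "H.linear_product cs = linear_product cs" "set (linear_product cs) \<subseteq> H"
      using Cons by auto
    moreover have "H.rlin c \<zero> (linear_product cs) = rlin c \<zero> (linear_product cs)"
      using rlin[of c \<zero> "linear_product cs"] IH Cons.prems subringE(2)[OF H(1)] by simp
    moreover have "H.linear_product (c # cs) = H.rlin c \<zero> (H.linear_product cs)"
      "linear_product (c # cs) = rlin c \<zero> (linear_product cs)"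
      by (simp_all add: H.linear_product_def linear_product_def)
    ultimately show ?case by simp
  qed (simp add: H.linear_product_def linear_product_def)
  then show ?thesis by simp
qed

context valued_skew_field
begin

lemma independent_lift:
  assumes K: "subfield K D" and Us: "set Us \<subseteq> V"
    and E: "field E" and ind: "E.independent (sub_residue D v K) (map res Us)"
  shows "independent K Us"
proof (rule ccontr)
  assume "\<not> independent K Us"
  moreover have UD: "set Us \<subseteq> carrier D" using Us val_ring_carrier by auto
  ultimately obtain Ks where Ks: "length Ks = length Us" "combine Ks Us = \<zero>" "set Ks \<subseteq> K" "set Ks \<noteq> {\<zero>}"
    using dependent_imp_non_trivial_combine[OF K UD] by metis
  have "Us \<noteq> []" using \<open>\<not> independent K Us\<close> by auto
  then have "\<not> set Ks \<subseteq> {\<zero>}" using Ks by (cases Ks) auto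
  then show False using combine_value[OF K Us E ind Ks(3,1)] Ks(2) by simp
qed

text \<open>Independent residues have independent lifts, and residues of elements of
  \<open>L\<close> can be lifted inside \<open>L\<close>.\<close>

lemma dimension_residue_le:
  assumes K: "subfield K D" and E: "field E"
    and "dimension n K L" "E.dimension m (sub_residue D v K) (sub_residue D v L)"
  shows "m \<le> n"
proof -
  obtain Es where Es: "E.independent (sub_residue D v K) Es" "length Es = m"
    "E.Span (sub_residue D v K) Es = sub_residue D v L" "set Es \<subseteq> carrier E"
    using E.exists_base[OF sub_residue_subfield[OF E K] assms(4)] by blast
  have EL: "set Es \<subseteq> res ` (V \<inter> L)"
    using E.Span_base_incl[OF sub_residue_subfield[OF E K] Es(4)] unfolding Es(3) unfolding sub_residue_def .
  define Us where "Us = map (inv_into (V \<inter> L) res) Es"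
  have Us: "set Us \<subseteq> V \<inter> L"
    unfolding Us_def set_map by (rule image_subsetI, rule inv_into_into, erule subsetD[OF EL])
  have "map res Us = Es" unfolding Us_def map_map
  proof (rule map_idI)
    fix e assume "e \<in> set Es"
    then show "(res \<circ> inv_into (V \<inter> L) res) e = e" using f_inv_into_f[OF subsetD[OF EL]] by simp
  qed
  then have "independent K Us" using independent_lift[OF K _ E, of Us] Us Es by simp
  then have "length Us \<le> n" using independent_length_le_dimension[OF K assms(3)] Us by blast
  then show ?thesis using Es by (simp add: Us_def)
qed

text \<open>The representatives are added one at a time. Nonzero combinations of the products of
  \<open>Us\<close> with \<open>y\<close> have value in the class of \<open>y\<close>, all earlier
  ones in the earlier classes, so the two spans meet only in \<open>\<zero>\<close>. The clause on
  values in the conclusion is the invariant that carries this induction.\<close>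

lemma ramified_independent:
  assumes K: "subfield K D" and Us: "set Us \<subseteq> V"
    and E: "field E" and ind: "E.independent (sub_residue D v K) (map res Us)"
    and ys: "set ys \<subseteq> carrier D - {\<zero>}" "distinct ys"
      "\<And>x y. x \<in> set ys \<Longrightarrow> y \<in> set ys \<Longrightarrow> v x - v y \<in> val_of K \<Longrightarrow> x = y"
  shows "\<exists>Zs. independent K Zs \<and> length Zs = length Us * length ys \<and>
    (\<forall>w\<in>Span K Zs. w \<noteq> \<zero> \<longrightarrow> (\<exists>y\<in>set ys. v w - v y \<in> val_of K))"
  using ys
proof (induction ys)
  case Nil
  then show ?case by (intro exI[of _ "[]"]) auto
next
  case (Cons y ys)
  have KD: "K \<subseteq> carrier D" using subfieldE(3)[OF K] .
  have UD: "set Us \<subseteq> carrier D" using Us val_ring_carrier by auto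
  have y: "y \<in> carrier D" "y \<noteq> \<zero>" using Cons.prems by auto
  obtain Zs where Zs: "independent K Zs" "length Zs = length Us * length ys"
    "\<forall>w\<in>Span K Zs. w \<noteq> \<zero> \<longrightarrow> (\<exists>y\<in>set ys. v w - v y \<in> val_of K)"
    using Cons.IH Cons.prems by auto
  have ZD: "set Zs \<subseteq> carrier D" using independent_in_carrier[OF Zs(1)] .
  define Ws where "Ws = map (\<lambda>u. u \<otimes> y) Us"
  have WD: "set Ws \<subseteq> carrier D" using UD y by (auto simp: Ws_def)
  have cW: "combine Ks Ws = combine Ks Us \<otimes> y" if "set Ks \<subseteq> K" for Ks
    unfolding Ws_def using that KD UD y by (intro combine_l_distr[symmetric]) auto
  have val: "w \<noteq> \<zero> \<longrightarrow> v w - v y \<in> val_of K" if wS: "w \<in> Span K Ws" for w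
  proof
    assume w: "w \<noteq> \<zero>"
    obtain Ks where Ks: "set Ks \<subseteq> K" "length Ks = length Ws" "w = combine Ks Ws"
      using iffD1[OF Span_mem_iff_length_version[OF K WD] wS] by blast
    have c: "combine Ks Us \<in> carrier D" using Ks KD UD by auto
    then have nz: "combine Ks Us \<noteq> \<zero>" using w Ks cW y by auto
    have "\<not> set Ks \<subseteq> {\<zero>}"
    proof
      assume *: "set Ks \<subseteq> {\<zero>}"
      have "Ks = replicate (length Us) \<zero>" using * Ks(2) by (intro replicate_eqI) (auto simp: Ws_def)
      then have "combine Ks Us = \<zero>" using combine_replicate[OF UD] by simp
      then show False using nz by simp
    qed
    then have "v (combine Ks Us) \<in> val_of K"
      using combine_value[OF K Us E ind Ks(1)] Ks(2) by (simp add: Ws_def)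
    moreover have "v w = v (combine Ks Us) + v y" using Ks cW c nz y by simp
    ultimately show "v w - v y \<in> val_of K" by simp
  qed
  have "independent K Ws"
  proof (rule ccontr)
    assume dep: "\<not> independent K Ws"
    then obtain Ks where Ks: "length Ks = length Ws" "combine Ks Ws = \<zero>" "set Ks \<subseteq> K" "set Ks \<noteq> {\<zero>}"
      using dependent_imp_non_trivial_combine[OF K WD] by metis
    have "combine Ks Us \<in> carrier D" using Ks KD UD by auto
    then have z: "combine Ks Us = \<zero>" using Ks(2) cW[OF Ks(3)] y mult_nonzero by metis
    have "Ws \<noteq> []" using dep by auto
    then have "\<not> set Ks \<subseteq> {\<zero>}" using Ks by (cases Ks) auto
    then show False using combine_value[OF K Us E ind Ks(3)] Ks(1) z by (simp add: Ws_def)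
  qed
  have different: "\<not> (v w - v y \<in> val_of K \<and> v w - v y' \<in> val_of K)" if "y' \<in> set ys" for w y'
  proof
    assume "v w - v y \<in> val_of K \<and> v w - v y' \<in> val_of K"
    then have "(v w - v y') - (v w - v y) \<in> val_of K" using val_of_subfield(4)[OF K] by blast
    then have "v y - v y' \<in> val_of K" by simp
    then show False using Cons.prems that by auto
  qed
  have "Span K Ws \<inter> Span K Zs = {\<zero>}"
  proof (intro equalityI subsetI)
    fix w assume w: "w \<in> Span K Ws \<inter> Span K Zs"
    then show "w \<in> {\<zero>}" using val[of w] Zs(3) different by blast
  next
    fix w assume "w \<in> {\<zero>}"
    then show "w \<in> Span K Ws \<inter> Span K Zs"
      using Span_subgroup_props(2)[OF K WD] Span_subgroup_props(2)[OF K ZD] by simp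
  qed
  then have "independent K (Ws @ Zs)" using independent_append[OF K \<open>independent K Ws\<close> Zs(1)] by simp
  moreover have "length (Ws @ Zs) = length Us * length (y # ys)" using Zs by (simp add: Ws_def)
  moreover have "\<exists>y\<in>set (y # ys). v w - v y \<in> val_of K" if w: "w \<in> Span K (Ws @ Zs)" "w \<noteq> \<zero>" for w
  proof -
    obtain a b where ab: "a \<in> Span K Ws" "b \<in> Span K Zs" "w = a \<oplus> b"
      using w Span_append_eq_set_add[OF K WD ZD] by (auto simp: set_add_def set_mult_def)
    have c: "a \<in> carrier D" "b \<in> carrier D"
      using ab Span_subgroup_props(1)[OF K WD] Span_subgroup_props(1)[OF K ZD] by auto
    show ?thesis
    proof (cases "a = \<zero> \<or> b = \<zero>")
      case True
      then show ?thesis using ab c w val[of a] Zs(3) by auto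
    next
      case False
      then obtain y' where y': "y' \<in> set ys" "v b - v y' \<in> val_of K" using ab Zs(3) by blast
      have va: "v a - v y \<in> val_of K" using val ab False by blast
      \<comment> \<open>Values in distinct classes modulo those of \<open>K\<close> are distinct, so
        the sum has the smaller of the two values and no new class arises.\<close>
      then have "v a \<noteq> v b" using different[OF y'(1), of b] y' by auto
      then have "v w = v a \<or> v w = v b" using val_add_distinct(2)[of a b] c False ab by auto
      then show ?thesis using va y' by auto
    qed
  qed
  ultimately show ?case by blast
qed

text \<open>The products of a lifted residue basis with the value representatives are independent.
  Scalars act from the left, so \<open>K\<close> may be a noncentral subfield; the inequality is
  applied with \<open>L\<close> as \<open>K\<close>.\<close>

lemma fundamental_inequality:
  assumes K: "subfield K D" and E: "field E"
    and dim: "dimension n K (carrier D)" "E.dimension f (sub_residue D v K) (carrier E)"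
    and Y: "finite Y" "Y \<subseteq> carrier D - {\<zero>}"
      "\<And>x y. x \<in> Y \<Longrightarrow> y \<in> Y \<Longrightarrow> v x - v y \<in> val_of K \<Longrightarrow> x = y"
  shows "f * card Y \<le> n"
proof -
  obtain Es where Es: "E.independent (sub_residue D v K) Es" "length Es = f" "set Es \<subseteq> carrier E"
    using E.exists_base[OF sub_residue_subfield[OF E K] dim(2)] by blast
  define Us where "Us = map (inv_into V res) Es"
  have EV: "set Es \<subseteq> res ` V" using Es(3) by (simp add: residue_carrier)
  have Us: "set Us \<subseteq> V"
    unfolding Us_def set_map by (rule image_subsetI, rule inv_into_into, erule subsetD[OF EV])
  have "map res Us = Es" unfolding Us_def map_map
  proof (rule map_idI)
    fix e assume "e \<in> set Es"
    then show "(res \<circ> inv_into V res) e = e" using f_inv_into_f[OF subsetD[OF EV]] by simp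
  qed
  moreover obtain ys where ys: "set ys = Y" "distinct ys" using finite_distinct_list[OF Y(1)] by blast
  ultimately obtain Zs where Zs: "independent K Zs" "length Zs = length Us * length ys"
    using ramified_independent[OF K Us E, of ys] Es(1) Y by auto
  have "length Zs \<le> n"
    using independent_length_le_dimension[OF K dim(1) Zs(1) independent_in_carrier[OF Zs(1)]] .
  then show ?thesis using Zs Es ys distinct_card[OF ys(2)] by (simp add: Us_def)
qed

lemma res_linear_product:
  assumes "set cs \<subseteq> V"
  shows "set (linear_product cs) \<subseteq> V \<and> map res (linear_product cs) = E.linear_product (map res cs)"
proof -
  have rlin: "set (rlin c s q) \<subseteq> V \<and> map res (rlin c s q) = E.rlin (res c) (res s) (map res q)"
    if "c \<in> V" "s \<in> V" "set q \<subseteq> V" for c s q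
    using that by (induction q arbitrary: s)
      (simp_all add: minus_eq E.minus_eq res_add res_mult res_minus val_ring_closed)
  show ?thesis using assms
  proof (induction cs)
    case (Cons c cs)
    then show ?case using rlin[of c \<zero> "linear_product cs"] by (simp add: linear_product_def E.linear_product_def)
  qed (simp add: linear_product_def E.linear_product_def)
qed

text \<open>Reducing the product of the factors \<open>t - c\<close> gives a power of
  \<open>t - e\<close> over the residue field of \<open>K\<close>; separability of \<open>e\<close>
  then leaves only a linear minimal polynomial.\<close>

lemma residue_in_subfield:
  assumes E: "field E" and K: "subfield K D"
    and sep: "separable_extension E (sub_residue D v K) (carrier E)"
    and cs: "set cs \<subseteq> V" "cs \<noteq> []" "\<And>c. c \<in> set cs \<Longrightarrow> res c = e" "set (linear_product cs) \<subseteq> K"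
  shows "e \<in> sub_residue D v K"
proof -
  interpret F: field E by (rule E)
  have e: "e \<in> carrier E" using cs by (metis last_in_set res_closed subsetD)
  have map: "map res cs = replicate (length cs) e" using cs(3) by (intro replicate_eqI) auto
  have "set (E.linear_product (replicate (length cs) e)) \<subseteq> sub_residue D v K"
  proof -
    have lp: "set (linear_product cs) \<subseteq> V" "map res (linear_product cs) = E.linear_product (map res cs)"
      using res_linear_product[OF cs(1)] by auto
    have "set (E.linear_product (replicate (length cs) e)) = res ` set (linear_product cs)"
      using lp(2) unfolding map by (metis set_map)
    then show ?thesis using cs(4) lp(1) by (auto simp: sub_residue_def)
  qed
  then show ?thesis
    using F.separable_linear_power[OF sub_residue_subfield[OF E K] e, of "length cs"] sep e cs(2)
    by (auto simp: separable_extension_def)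
qed

end

section \<open>Wedderburn factors over the center\<close>

locale semiramified = valued_skew_field D v for D :: "('a, 'b) ring_scheme" (structure)
    and v :: "'a \<Rightarrow> 'g::linordered_ab_group_add" +
  fixes F :: "'a set" and n :: nat
  assumes F_center: "F = ring_center D" and F_subfield: "subfield F D"
    and E_field: "field E"
    and dim_D: "dimension (n\<^sup>2) F (carrier D)"
    and dim_E: "ring.dimension E n (sub_residue D v F) (carrier E)"
    and index: "value_index D v F = n"
    and sep: "separable_extension E (sub_residue D v F) (carrier E)"
begin

sublocale E: field E by (rule E_field)

lemma F_commute: "x \<in> F \<Longrightarrow> y \<in> carrier D \<Longrightarrow> x \<otimes> y = y \<otimes> x"
  by (simp add: F_center ring_center_def)

lemma F_carrier: "x \<in> F \<Longrightarrow> x \<in> carrier D"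
  by (simp add: F_center ring_center_def)

lemma conj_by_F:
  assumes "x \<in> carrier D" "x \<noteq> \<zero>" "a \<in> F" shows "conj_by x a = a"
  using assms F_commute[of a x, symmetric] F_carrier[of a] by (simp add: conj_by_def m_assoc)

lemma conj_by_trans:
  assumes "x \<in> carrier D" "x \<noteq> \<zero>" "y \<in> carrier D" "y \<noteq> \<zero>" "d \<in> carrier D"
  shows "conj_by (x \<otimes> y) d = conj_by x (conj_by y d)"
  using assms by (simp add: conj_by_def m_assoc)

lemma conj_by_inv:
  assumes "x \<in> carrier D" "x \<noteq> \<zero>" "d \<in> carrier D"
  shows "conj_by x (conj_by (inv x) d) = d" "conj_by (inv x) (conj_by x d) = d"
  using assms by (simp_all add: conj_by_def m_assoc)

text \<open>Take for \<open>A\<close> all conjugates of \<open>d\<close>. A polynomial over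
  \<open>F\<close> that kills \<open>d\<close> kills them all, so one of least degree exists; its
  coefficients are fixed by every conjugation and hence central.\<close>

lemma wedderburn:
  assumes d: "d \<in> carrier D"
  obtains cs where "set (linear_product cs) \<subseteq> F" "cs \<noteq> []" "peval \<one> (linear_product cs) \<one> d = \<zero>"
    "\<And>c. c \<in> set cs \<Longrightarrow> \<exists>x\<in>carrier D - {\<zero>}. c = conj_by x d"
proof -
  define A where "A = (\<lambda>x. conj_by x d) ` (carrier D - {\<zero>})"
  have AD: "A \<subseteq> carrier D" using d conj_by_closed unfolding A_def by blast
  have dA: "d \<in> A" unfolding A_def using d one_neq_zero
    by (intro image_eqI[of _ _ \<one>]) (auto simp: conj_by_def)
  obtain f where f: "set f \<subseteq> F" "peval \<one> f \<one> d = \<zero>"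
    by (rule exists_vanishing[OF F_subfield dim_D d]) (use d in auto)
  have fD: "set f \<subseteq> carrier D" using f F_carrier by auto
  have van: "vanishes_on f A"
    unfolding vanishes_on_def
  proof (intro conjI fD ballI)
    fix b assume "b \<in> A"
    then obtain x where x: "x \<in> carrier D" "x \<noteq> \<zero>" "b = conj_by x d" by (auto simp: A_def)
    have "peval (conj_by x \<one>) (map (conj_by x) f) (conj_by x \<one>) (conj_by x d) = conj_by x (peval \<one> f \<one> d)"
      by (rule peval_ring_hom[OF conj_by_hom ring_axioms]) (use x d fD in auto)
    moreover have "map (conj_by x) f = f" by (rule map_idI) (use x f conj_by_F in auto)
    ultimately show "peval \<one> f \<one> b = \<zero>" using x f by simp
  qed
  obtain cs where cs: "vanishes_on (linear_product cs) A"
    "\<And>\<phi> a. \<phi> \<in> conj_by ` (carrier D - {\<zero>}) \<Longrightarrow> a \<in> set (linear_product cs) \<Longrightarrow> \<phi> a = a"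
    "\<And>c. c \<in> set cs \<Longrightarrow> \<exists>b\<in>A. \<exists>z\<in>carrier D - {\<zero>}. c = z \<otimes> b \<otimes> inv z"
  proof (rule invariant_splitting_polynomial[OF AD van, of "conj_by ` (carrier D - {\<zero>})"])
    show "\<phi> \<in> ring_hom D D" if "\<phi> \<in> conj_by ` (carrier D - {\<zero>})" for \<phi>
      using that conj_by_hom by auto
    show "A \<subseteq> \<phi> ` A" if \<phi>: "\<phi> \<in> conj_by ` (carrier D - {\<zero>})" for \<phi>
    proof
      fix b assume "b \<in> A"
      then obtain y where y: "y \<in> carrier D" "y \<noteq> \<zero>" "b = conj_by y d" by (auto simp: A_def)
      obtain x where x: "x \<in> carrier D" "x \<noteq> \<zero>" "\<phi> = conj_by x" using \<phi> by auto
      have "b = \<phi> (conj_by (inv x \<otimes> y) d)" using x y d conj_by_inv(1)[of x b] by (simp add: conj_by_trans)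
      moreover have "conj_by (inv x \<otimes> y) d \<in> A" unfolding A_def using x y by auto
      ultimately show "b \<in> \<phi> ` A" by blast
    qed
  qed blast
  show thesis
  proof (rule that[of cs])
    show "set (linear_product cs) \<subseteq> F"
    proof
      fix a assume a: "a \<in> set (linear_product cs)"
      then have aD: "a \<in> carrier D" using cs(1) by (auto simp: vanishes_on_def)
      have "a \<otimes> x = x \<otimes> a" if x: "x \<in> carrier D" for x
      proof (cases "x = \<zero>")
        case False
        then have "x \<otimes> a \<otimes> inv x = a" using cs(2)[of "conj_by x" a] a x by (auto simp: conj_by_def)
        then have "x \<otimes> a \<otimes> inv x \<otimes> x = a \<otimes> x" by simp
        then show ?thesis using x False aD by (simp add: m_assoc)
      qed (use aD in simp)
      then show "a \<in> F" using aD by (simp add: F_center ring_center_def)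
    qed
    show v: "peval \<one> (linear_product cs) \<one> d = \<zero>" using cs(1) dA by (simp add: vanishes_on_def)
    show "cs \<noteq> []" using v one_neq_zero by (auto simp: linear_product_def)
    fix c assume "c \<in> set cs"
    then obtain b z where bz: "b \<in> A" "z \<in> carrier D" "z \<noteq> \<zero>" "c = conj_by z b"
      using cs(3)[of c] by (auto simp: conj_by_def)
    then obtain x where x: "x \<in> carrier D" "x \<noteq> \<zero>" "b = conj_by x d" by (auto simp: A_def)
    have "c = conj_by (z \<otimes> x) d" using bz x d by (simp add: conj_by_trans)
    then show "\<exists>x\<in>carrier D - {\<zero>}. c = conj_by x d" using bz x by (intro bexI[of _ "z \<otimes> x"]) auto
  qed
qed

text \<open>If conjugation fixes \<open>e\<close>, every conjugate of a lift of \<open>e\<close>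
  again has residue \<open>e\<close>, and so do all Wedderburn factors of the lift.\<close>

lemma theta_fixed:
  assumes e: "e \<in> carrier E" and fixed: "\<And>x. x \<in> carrier D \<Longrightarrow> x \<noteq> \<zero> \<Longrightarrow> theta x e = e"
  shows "e \<in> sub_residue D v F"
proof -
  obtain d where d: "d \<in> V" "e = res d" using e by (auto simp: residue_carrier)
  obtain cs where cs: "set (linear_product cs) \<subseteq> F" "cs \<noteq> []"
    "\<And>c. c \<in> set cs \<Longrightarrow> \<exists>x\<in>carrier D - {\<zero>}. c = conj_by x d"
    using wedderburn[OF val_ring_carrier[OF d(1)]] by metis
  show ?thesis
  proof (rule residue_in_subfield[OF E_field F_subfield sep _ cs(2) _ cs(1)])
    show "set cs \<subseteq> V" using cs(3) conj_by_val_ring d by fastforce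
    fix c assume "c \<in> set cs"
    then obtain x where "x \<in> carrier D" "x \<noteq> \<zero>" "c = conj_by x d" using cs(3) by blast
    then show "res c = e" using theta_res[of x d] d fixed[of x] by simp
  qed
qed

end

section \<open>Hilbert 90 and the structure of semiramified algebras\<close>

lemma (in cring) one_plus_power:
  assumes y: "y \<in> carrier R"
  shows "(\<one> \<oplus> y) [^] n = (\<Oplus>k\<in>{..n}. [(n choose k)] \<cdot> (y [^] k))"
proof (induction n)
  case 0
  then show ?case using y by simp
next
  case (Suc n)
  let ?s = "\<Oplus>k\<in>{..n}. [(n choose k)] \<cdot> (y [^] k)"
  have s: "?s \<in> carrier R" using y by (intro finsum_closed) auto
  have "(\<Oplus>k\<in>{..Suc n}. [(Suc n choose k)] \<cdot> (y [^] k))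
    = (\<Oplus>k\<in>{..n}. [(Suc n choose Suc k)] \<cdot> (y [^] Suc k)) \<oplus> \<one>"
    using y by (subst finsum_Suc2) auto
  also have "(\<Oplus>k\<in>{..n}. [(Suc n choose Suc k)] \<cdot> (y [^] Suc k))
    = (\<Oplus>k\<in>{..n}. [(n choose k)] \<cdot> (y [^] Suc k) \<oplus> [(n choose Suc k)] \<cdot> (y [^] Suc k))"
    using y by (intro finsum_cong') (auto simp: add.nat_pow_mult simp del: nat_pow_Suc)
  also have "\<dots> = (\<Oplus>k\<in>{..n}. [(n choose k)] \<cdot> (y [^] Suc k)) \<oplus> (\<Oplus>k\<in>{..n}. [(n choose Suc k)] \<cdot> (y [^] Suc k))"
    using y by (intro finsum_addf) auto
  also have "(\<Oplus>k\<in>{..n}. [(n choose k)] \<cdot> (y [^] Suc k)) = ?s \<otimes> y"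
    using y by (subst finsum_ldistr) (auto intro!: finsum_cong' simp: add_pow_ldistr)
  finally have 1: "(\<Oplus>k\<in>{..Suc n}. [(Suc n choose k)] \<cdot> (y [^] k))
    = (?s \<otimes> y \<oplus> (\<Oplus>k\<in>{..n}. [(n choose Suc k)] \<cdot> (y [^] Suc k))) \<oplus> \<one>" .
  have "(\<Oplus>k\<in>{..Suc n}. [(n choose k)] \<cdot> (y [^] k)) = (\<Oplus>k\<in>{..n}. [(n choose Suc k)] \<cdot> (y [^] Suc k)) \<oplus> \<one>"
    using y by (subst finsum_Suc2) auto
  moreover have "(\<Oplus>k\<in>{..Suc n}. [(n choose k)] \<cdot> (y [^] k)) = ?s"
    using y s by (subst finsum_Suc) (auto simp: binomial_eq_0)
  ultimately have 2: "?s = (\<Oplus>k\<in>{..n}. [(n choose Suc k)] \<cdot> (y [^] Suc k)) \<oplus> \<one>" by simp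
  have c: "(\<Oplus>k\<in>{..n}. [(n choose Suc k)] \<cdot> (y [^] Suc k)) \<in> carrier R" using y by (intro finsum_closed) auto
  have "(\<one> \<oplus> y) [^] Suc n = ?s \<otimes> (\<one> \<oplus> y)" using Suc by simp
  also have "\<dots> = ?s \<otimes> y \<oplus> ?s" using s y by (simp add: r_distr a_comm)
  also have "\<dots> = (?s \<otimes> y \<oplus> (\<Oplus>k\<in>{..n}. [(n choose Suc k)] \<cdot> (y [^] Suc k))) \<oplus> \<one>"
    using c s y arg_cong[OF 2, of "\<lambda>w. ?s \<otimes> y \<oplus> w"] by (simp only: a_assoc m_closed one_closed)
  finally show ?case using 1 by simp
qed

text \<open>Division by \<open>d\<close> reduces the claim to \<open>x [^] p = \<one>\<close>. With
  \<open>x = \<one> \<oplus> y\<close> the inner binomial coefficients vanish in characteristic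
  \<open>p\<close>, which leaves \<open>y [^] p = \<zero>\<close>.\<close>

lemma (in field) frobenius_inj:
  fixes p :: nat
  assumes p: "Factorial_Ring.prime p" and char: "[p] \<cdot> \<one> = \<zero>"
    and cd: "c \<in> carrier R" "d \<in> carrier R" "d \<noteq> \<zero>" "c [^] p = d [^] p"
  shows "c = d"
proof -
  have du: "d \<in> Units R" using cd field_Units by auto
  define x where "x = c \<otimes> inv d"
  have x: "x \<in> carrier R" using cd du by (simp add: x_def)
  have "x [^] p = c [^] p \<otimes> (inv d) [^] p" using cd du by (simp add: x_def nat_pow_distrib)
  also have "\<dots> = (d \<otimes> inv d) [^] p" using cd du nat_pow_distrib[of d "inv d" p] by (simp del: Units_r_inv)
  finally have xp: "x [^] p = \<one>" using du by simp
  define y where "y = x \<ominus> \<one>"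
  have y: "y \<in> carrier R" using x by (simp add: y_def)
  have xy: "x = \<one> \<oplus> y" using x by (simp add: y_def minus_eq a_ac r_neg)
  obtain q where q: "p = Suc q" using prime_gt_0_nat[OF p] by (cases p) auto
  have zero: "[(p choose Suc k)] \<cdot> (y [^] Suc k) = \<zero>" if "k < q" for k
  proof -
    have "p dvd (p choose Suc k)" using that q p by (intro dvd_choose_prime) auto
    then obtain m where m: "p choose Suc k = p * m" by (auto simp: dvd_def)
    have "[(p * m)] \<cdot> (y [^] Suc k) = [m] \<cdot> ([p] \<cdot> (y [^] Suc k))"
      using y by (simp add: add.nat_pow_pow mult.commute)
    also have "[p] \<cdot> (y [^] Suc k) = ([p] \<cdot> \<one>) \<otimes> y [^] Suc k" using y by (subst add_pow_ldistr) auto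
    finally show ?thesis using m char y by simp
  qed
  have "x [^] p = (\<Oplus>k\<in>{..q}. [(p choose Suc k)] \<cdot> (y [^] Suc k)) \<oplus> \<one>"
    unfolding xy one_plus_power[OF y] q using y by (subst finsum_Suc2) auto
  also have "(\<Oplus>k\<in>{..q}. [(p choose Suc k)] \<cdot> (y [^] Suc k)) = y [^] p"
  proof -
    have "{..q} = insert q {..<q}" by auto
    then have "(\<Oplus>k\<in>{..q}. [(p choose Suc k)] \<cdot> (y [^] Suc k)) =
      [(p choose Suc q)] \<cdot> (y [^] Suc q) \<oplus> (\<Oplus>k\<in>{..<q}. [(p choose Suc k)] \<cdot> (y [^] Suc k))"
      using y by (simp only:) (rule finsum_insert, auto)
    also have "(\<Oplus>k\<in>{..<q}. [(p choose Suc k)] \<cdot> (y [^] Suc k)) = (\<Oplus>k\<in>{..<q}. \<zero>)"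
      using zero by (intro finsum_cong') auto
    finally show ?thesis using y q by simp
  qed
  finally have "y [^] p \<oplus> \<one> = \<one>" using xp by simp
  then have "y [^] p = \<zero>" using y add.r_cancel_one[of "\<one>" "y [^] p"] by (simp add: a_comm)
  then have "y = \<zero>" using y by (induction p) (auto simp: integral_iff)
  then have "x = \<one>" using xy by simp
  then have "c \<otimes> inv d \<otimes> d = d" using cd du by (simp add: x_def)
  then show ?thesis using cd du by (simp add: m_assoc)
qed

text \<open>Noether's form, for a subgroup \<open>H\<close>: in the resolvent, the sum of the terms
  \<open>c h \<otimes> h e\<close>, applying \<open>g\<close> and multiplying by \<open>c g\<close>
  only permutes the terms. Independence of characters supplies an \<open>e\<close> for which it is
  nonzero.\<close>

lemma (in field) hilbert90:
  assumes K: "K \<subseteq> carrier R" and H: "subgroup H (gal_group R K)" "finite H"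
    and c: "\<And>g. g \<in> H \<Longrightarrow> c g \<in> carrier R" "\<And>g. g \<in> H \<Longrightarrow> c g \<noteq> \<zero>"
    and cocycle: "\<And>g h. g \<in> H \<Longrightarrow> h \<in> H \<Longrightarrow> c (g \<otimes>\<^bsub>gal_group R K\<^esub> h) = c g \<otimes> g (c h)"
  obtains b where "b \<in> carrier R" "b \<noteq> \<zero>" "\<And>g. g \<in> H \<Longrightarrow> c g \<otimes> g b = b"
proof -
  let ?G = "gal_group R K"
  interpret G: group ?G by (rule group_gal_group[OF K])
  have HG: "H \<subseteq> carrier ?G" using subgroup.subset[OF H(1)] .
  have hom: "h \<in> ring_hom R R" if "h \<in> H" for h using that HG gal_group_ring_hom[of h R K] by auto
  have hc: "h x \<in> carrier R" if "h \<in> H" "x \<in> carrier R" for h x using ring_hom_closed[OF hom] that by auto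
  have ext: "h \<in> extensional (carrier R)" if "h \<in> H" for h using that HG by (auto simp: gal_group_carrier)
  have one: "\<one>\<^bsub>?G\<^esub> \<in> H" using subgroup.one_closed[OF H(1)] .
  have "\<exists>e\<in>carrier R. (\<Oplus>h\<in>H. c h \<otimes> h e) \<noteq> \<zero>"
  proof (rule ccontr)
    assume *: "\<not> (\<exists>e\<in>carrier R. (\<Oplus>h\<in>H. c h \<otimes> h e) \<noteq> \<zero>)"
    have "c \<one>\<^bsub>?G\<^esub> = \<zero>"
    proof (rule characters_independent[OF monoid_axioms H(2) _ _ _ _ _ one])
      fix h assume h: "h \<in> H"
      show "h \<in> hom R R" using hom[OF h] by (auto simp: hom_def ring_hom_def)
      show "h \<one> = \<one>" by (rule ring_hom_one[OF hom[OF h]])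
      show "h \<in> extensional (carrier R)" by (rule ext[OF h])
    qed (use c * in auto)
    then show False using c one by simp
  qed
  then obtain e where e: "e \<in> carrier R" "(\<Oplus>h\<in>H. c h \<otimes> h e) \<noteq> \<zero>" by blast
  define b where "b = (\<Oplus>h\<in>H. c h \<otimes> h e)"
  have bc: "b \<in> carrier R" unfolding b_def using c hc e by (intro finsum_closed) auto
  have "c g \<otimes> g b = b" if g: "g \<in> H" for g
  proof -
    interpret g: ring_hom_ring R R g
      by (intro ring_hom_ringI2 ring_axioms hom[OF g])
    have "g b = (\<Oplus>h\<in>H. g (c h \<otimes> h e))"
      unfolding b_def using hc c e by (subst g.hom_finsum) (auto simp: comp_def)
    then have "c g \<otimes> g b = (\<Oplus>h\<in>H. c g \<otimes> g (c h \<otimes> h e))"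
      using hc c e g H by (simp only:) (rule finsum_rdistr, auto)
    also have "\<dots> = (\<Oplus>h\<in>H. c (g \<otimes>\<^bsub>?G\<^esub> h) \<otimes> (g \<otimes>\<^bsub>?G\<^esub> h) e)"
    proof (rule finsum_cong'[OF refl])
      fix h assume h: "h \<in> H"
      have "(g \<otimes>\<^bsub>?G\<^esub> h) e = g (h e)" using g h HG e by (intro gal_group_apply) auto
      then show "c g \<otimes> g (c h \<otimes> h e) = c (g \<otimes>\<^bsub>?G\<^esub> h) \<otimes> (g \<otimes>\<^bsub>?G\<^esub> h) e"
        using cocycle[OF g h] c(1)[OF h] c(1)[OF g] hc[OF g] hc[OF h e(1)] by (simp add: m_assoc)
    next
      show "(\<lambda>h. c (g \<otimes>\<^bsub>?G\<^esub> h) \<otimes> (g \<otimes>\<^bsub>?G\<^esub> h) e) \<in> H \<rightarrow> carrier R"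
        using c(1) hc e subgroup.m_closed[OF H(1) g] by blast
    qed
    also have "\<dots> = (\<Oplus>h\<in>(\<lambda>h. g \<otimes>\<^bsub>?G\<^esub> h) ` H. c h \<otimes> h e)"
    proof (rule finsum_reindex[symmetric])
      show "inj_on (\<lambda>h. g \<otimes>\<^bsub>?G\<^esub> h) H" using g HG by (intro inj_onI) (auto simp: subset_iff)
      show "(\<lambda>h. c h \<otimes> h e) \<in> (\<lambda>h. g \<otimes>\<^bsub>?G\<^esub> h) ` H \<rightarrow> carrier R"
        using subgroup.m_closed[OF H(1) g] hc c(1) e by blast
    qed
    also have "(\<lambda>h. g \<otimes>\<^bsub>?G\<^esub> h) ` H = H"
      using endo_inj_surj[OF H(2), of "\<lambda>h. g \<otimes>\<^bsub>?G\<^esub> h"] subgroup.m_closed[OF H(1) g] g HG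
      by (auto simp: inj_on_def subset_iff)
    finally show "c g \<otimes> g b = b" by (simp add: b_def)
  qed
  then show thesis using that bc e by (auto simp: b_def)
qed

section \<open>Value classes and the residue Galois group\<close>

context semiramified
begin

abbreviation "F' \<equiv> sub_residue D v F"
abbreviation "G \<equiv> residue_gal D v F"

lemma F'_subfield: "subfield F' E"
  by (rule sub_residue_subfield[OF E_field F_subfield])

lemma F'_carrier: "F' \<subseteq> carrier E"
  using subfieldE(3)[OF F'_subfield] .

sublocale G: group G
  unfolding residue_gal_def by (rule E.group_gal_group[OF F'_carrier])

lemma theta_gal: "x \<in> carrier D \<Longrightarrow> x \<noteq> \<zero> \<Longrightarrow> theta x \<in> carrier G"
  using theta_in_gal by (simp add: residue_gal_def F_center)

lemma G_apply: "s \<in> carrier G \<Longrightarrow> t \<in> carrier G \<Longrightarrow> a \<in> carrier E \<Longrightarrow> (s \<otimes>\<^bsub>G\<^esub> t) a = s (t a)"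
  unfolding residue_gal_def by (rule gal_group_apply)

lemma G_eqI: "s \<in> carrier G \<Longrightarrow> t \<in> carrier G \<Longrightarrow> (\<And>a. a \<in> carrier E \<Longrightarrow> s a = t a) \<Longrightarrow> s = t"
  unfolding residue_gal_def by (rule gal_group_eqI)

lemma theta_mult_G:
  assumes "x \<in> carrier D" "x \<noteq> \<zero>" "y \<in> carrier D" "y \<noteq> \<zero>"
  shows "theta (x \<otimes> y) = theta x \<otimes>\<^bsub>G\<^esub> theta y"
proof (rule G_eqI)
  fix a assume "a \<in> carrier E"
  then show "theta (x \<otimes> y) a = (theta x \<otimes>\<^bsub>G\<^esub> theta y) a"
    using assms theta_gal[of x] theta_gal[of y] theta_mult[of x y a] by (simp add: G_apply)
qed (use assms theta_gal[of x] theta_gal[of y] theta_gal[of "x \<otimes> y"] in simp_all)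

lemma theta_one: "theta \<one> = \<one>\<^bsub>G\<^esub>"
proof -
  have "theta \<one> \<otimes>\<^bsub>G\<^esub> theta \<one> = theta \<one>" using theta_mult_G[of \<one> \<one>] one_neq_zero by simp
  then show ?thesis using theta_gal[of \<one>] one_neq_zero by simp
qed

lemma theta_pow:
  "x \<in> carrier D \<Longrightarrow> x \<noteq> \<zero> \<Longrightarrow> theta (x [^] (j::nat)) = theta x [^]\<^bsub>G\<^esub> j"
  by (induction j) (auto simp: theta_one theta_mult_G)

lemma theta_F: "x \<in> F \<Longrightarrow> x \<noteq> \<zero> \<Longrightarrow> theta x = \<one>\<^bsub>G\<^esub>"
proof -
  assume x: "x \<in> F" "x \<noteq> \<zero>"
  have "theta x = theta \<one>"
  proof (rule G_eqI)
    fix a assume "a \<in> carrier E"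
    moreover have "\<one> \<in> ring_center D" by (simp add: ring_center_def)
    ultimately show "theta x a = theta \<one> a"
      using x one_neq_zero theta_central[of x a] theta_central[of \<one> a] by (simp add: F_center)
  qed (use x F_carrier[of x] theta_gal[of x] theta_gal[of \<one>] one_neq_zero in simp_all)
  then show ?thesis by (simp add: theta_one)
qed

lemma theta_val_unit: "x \<in> carrier D \<Longrightarrow> x \<noteq> \<zero> \<Longrightarrow> v x = 0 \<Longrightarrow> theta x = \<one>\<^bsub>G\<^esub>"
proof -
  assume x: "x \<in> carrier D" "x \<noteq> \<zero>" "v x = 0"
  have "theta x = theta \<one>"
  proof (rule G_eqI)
    fix a assume "a \<in> carrier E"
    then show "theta x a = theta \<one> a"
      using x one_neq_zero theta_unit[OF E_field, of x a] theta_unit[OF E_field, of \<one> a] by simp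
  qed (use x theta_gal[of x] theta_gal[of \<one>] one_neq_zero in simp_all)
  then show ?thesis by (simp add: theta_one)
qed

text \<open>An element of \<open>F\<close> corrects the quotient of \<open>x\<close> and
  \<open>y\<close> to a unit. The factor \<open>f\<close> is central and \<open>u\<close> has a
  nonzero residue, so both have trivial \<open>theta\<close>.\<close>

lemma unit_decomposition:
  assumes "x \<in> carrier D" "x \<noteq> \<zero>" "y \<in> carrier D" "y \<noteq> \<zero>" "v x - v y \<in> val_of F"
  obtains f u where "f \<in> F" "f \<noteq> \<zero>" "u \<in> carrier D" "u \<noteq> \<zero>" "v u = 0" "x = f \<otimes> (u \<otimes> y)"
proof -
  obtain f where f: "f \<in> F" "f \<noteq> \<zero>" "v x - v y = v f" using assms(5) by (auto simp: val_of_def)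
  note fc = F_carrier[OF f(1)]
  show thesis
  proof (rule that[of f "inv f \<otimes> (x \<otimes> inv y)"])
    show "v (inv f \<otimes> (x \<otimes> inv y)) = 0" using f fc assms by simp
    show "x = f \<otimes> (inv f \<otimes> (x \<otimes> inv y) \<otimes> y)" using f fc assms by (simp add: m_assoc)
  qed (use f fc assms in auto)
qed

lemma theta_cong:
  assumes "x \<in> carrier D" "x \<noteq> \<zero>" "y \<in> carrier D" "y \<noteq> \<zero>" "v x - v y \<in> val_of F"
  shows "theta x = theta y"
proof -
  obtain f u where fu: "f \<in> F" "f \<noteq> \<zero>" "u \<in> carrier D" "u \<noteq> \<zero>" "v u = 0" "x = f \<otimes> (u \<otimes> y)"
    using unit_decomposition[OF assms] by metis
  show ?thesis using fu assms F_carrier[OF fu(1)] theta_gal[of y]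
    by (simp add: theta_mult_G theta_F theta_val_unit)
qed

lemma n_pos: "n > 0"
proof (rule ccontr)
  assume "\<not> n > 0"
  then have "carrier E = {\<zero>\<^bsub>E\<^esub>}" using E.dimension_zero[OF F'_subfield] dim_E by simp
  then show False using E.one_closed E_one_nonzero by blast
qed

text \<open>One count yields all four claims, hence the joint statement. There are \<open>n\<close>
  value classes, so the image of \<open>theta\<close> has at most \<open>n\<close> elements; its
  fixed field is \<open>F'\<close> by \<open>theta_fixed\<close>, so Artin's bound gives at least
  \<open>n\<close>; and the whole Galois group has at most \<open>n\<close> by Dedekind's
  bound.\<close>

lemma theta_facts:
  shows theta_inj: "\<And>x y. x \<in> carrier D \<Longrightarrow> x \<noteq> \<zero> \<Longrightarrow> y \<in> carrier D \<Longrightarrow> y \<noteq> \<zero> \<Longrightarrow> theta x = theta y \<Longrightarrow>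
      v x - v y \<in> val_of F"
    and finite_G: "finite (carrier G)" and card_G: "card (carrier G) = n"
    and theta_surj: "carrier G = theta ` (carrier D - {\<zero>})"
proof -
  have "value_index D v F > 0" using n_pos index by simp
  from value_index_representatives[OF F_subfield this]
  obtain Y where Y: "finite Y" "card Y = n" "Y \<subseteq> carrier D - {\<zero>}"
    "\<And>x y. x \<in> Y \<Longrightarrow> y \<in> Y \<Longrightarrow> v x - v y \<in> val_of F \<Longrightarrow> x = y"
    "\<And>x. x \<in> carrier D \<Longrightarrow> x \<noteq> \<zero> \<Longrightarrow> \<exists>y\<in>Y. v x - v y \<in> val_of F"
    unfolding index by metis
  define H where "H = theta ` (carrier D - {\<zero>})"
  have HY: "H = theta ` Y"
  proof (intro equalityI subsetI)
    fix h assume "h \<in> H"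
    then obtain x where x: "x \<in> carrier D" "x \<noteq> \<zero>" "h = theta x" by (auto simp: H_def)
    obtain y where y: "y \<in> Y" "v x - v y \<in> val_of F" using Y(5) x by blast
    then have "theta x = theta y" using x Y(3) theta_cong by blast
    then show "h \<in> theta ` Y" using x y by simp
  qed (use Y(3) in \<open>auto simp: H_def\<close>)
  have sub: "subgroup H G"
  proof (rule G.subgroupI)
    show "H \<subseteq> carrier G" using theta_gal by (auto simp: H_def)
    show "H \<noteq> {}" using one_neq_zero by (auto simp: H_def)
    fix h assume "h \<in> H"
    then obtain x where x: "x \<in> carrier D" "x \<noteq> \<zero>" "h = theta x" by (auto simp: H_def)
    have "theta (inv x) \<otimes>\<^bsub>G\<^esub> theta x = \<one>\<^bsub>G\<^esub>" using theta_mult_G[of "inv x" x] x by (simp add: theta_one)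
    then have "inv\<^bsub>G\<^esub> h = theta (inv x)" using x theta_gal G.inv_equality by simp
    then show "inv\<^bsub>G\<^esub> h \<in> H" using x by (auto simp: H_def)
  next
    fix g h assume "g \<in> H" "h \<in> H"
    then obtain x y where "x \<in> carrier D" "x \<noteq> \<zero>" "g = theta x" "y \<in> carrier D" "y \<noteq> \<zero>" "h = theta y"
      by (auto simp: H_def)
    then show "g \<otimes>\<^bsub>G\<^esub> h \<in> H" unfolding H_def
      by (intro image_eqI[of _ _ "x \<otimes> y"]) (auto simp: theta_mult_G)
  qed
  have "n \<le> card H"
  proof (rule E.artin_bound[OF F'_subfield _ _ _ dim_E])
    show "subgroup H (gal_group E F')" using sub by (simp add: residue_gal_def)
    show "finite H" using HY Y by simp
    show "x \<in> F'" if "x \<in> carrier E" "\<And>h. h \<in> H \<Longrightarrow> h x = x" for x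
      using theta_fixed[OF that(1)] that(2) by (auto simp: H_def)
  qed
  moreover have "card H \<le> card Y" using HY card_image_le Y by blast
  ultimately have cH: "card H = n" using Y by simp
  then have inj: "inj_on theta Y" using HY Y eq_card_imp_inj_on by metis
  show "v x - v y \<in> val_of F"
    if xy: "x \<in> carrier D" "x \<noteq> \<zero>" "y \<in> carrier D" "y \<noteq> \<zero>" "theta x = theta y" for x y
  proof -
    obtain a b where ab: "a \<in> Y" "v x - v a \<in> val_of F" "b \<in> Y" "v y - v b \<in> val_of F" using Y(5) xy by metis
    have "theta x = theta a" "theta y = theta b" using ab xy Y(3) theta_cong by blast+
    then have "a = b" using inj ab xy by (metis inj_onD)
    then have "(v x - v a) - (v y - v b) = v x - v y" by simp
    then show ?thesis using val_of_subfield(4)[OF F_subfield ab(2,4)] by simp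
  qed
  have bound: "finite (carrier G) \<and> card (carrier G) \<le> n"
  proof (rule E.embeddings_bound[OF F'_subfield E.carrier_is_subfield F'_carrier dim_E])
    fix s assume s: "s \<in> carrier G"
    show "s \<in> ring_hom (E\<lparr>carrier := carrier E\<rparr>) E" "s \<in> extensional (carrier E)"
      using s gal_group_ring_hom[of s E F'] by (auto simp: residue_gal_def gal_group_carrier)
    show "s x = x" if "x \<in> F'" for x using s that by (auto simp: residue_gal_def gal_group_carrier)
  qed
  then show "finite (carrier G)" by simp
  have HG: "H \<subseteq> carrier G" using subgroup.subset[OF sub] .
  then have "H = carrier G" using card_seteq[of "carrier G" H] bound cH by simp
  then show "card (carrier G) = n" "carrier G = theta ` (carrier D - {\<zero>})" using cH by (auto simp: H_def)
qed

text \<open>Commutativity comes from the value group: \<open>x \<otimes> y\<close> and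
  \<open>y \<otimes> x\<close> have equal values, and \<open>theta\<close> depends only on the class
  of the value.\<close>

sublocale G: comm_group G
proof (rule G.group_comm_groupI)
  fix s t assume "s \<in> carrier G" "t \<in> carrier G"
  then obtain x y where xy: "x \<in> carrier D" "x \<noteq> \<zero>" "s = theta x" "y \<in> carrier D" "y \<noteq> \<zero>" "t = theta y"
    using theta_surj by auto
  have "theta (x \<otimes> y) = theta (y \<otimes> x)"
    by (rule theta_cong) (use xy val_of_subfield(1)[OF F_subfield] in \<open>auto simp: add.commute\<close>)
  then show "s \<otimes>\<^bsub>G\<^esub> t = t \<otimes>\<^bsub>G\<^esub> s" using xy by (simp add: theta_mult_G)
qed

text \<open>Lagrange's theorem in the Galois group of order \<open>n\<close>, carried back by
  injectivity of \<open>theta\<close> on value classes.\<close>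

lemma val_pow_n: "x \<in> carrier D \<Longrightarrow> x \<noteq> \<zero> \<Longrightarrow> v (x [^] n) \<in> val_of F"
proof -
  assume x: "x \<in> carrier D" "x \<noteq> \<zero>"
  have "theta (x [^] n) = theta \<one>"
    using theta_pow[OF x, of n] G.pow_order_eq_1[OF theta_gal[OF x]] card_G by (simp add: order_def theta_one)
  then have "v (x [^] n) - v \<one> \<in> val_of F" using x one_neq_zero by (intro theta_inj) auto
  then show ?thesis by simp
qed

end

section \<open>Strong degeneracy\<close>

text \<open>In a finite group every element generated by \<open>\<sigma> i\<close> is a power with
  natural exponent, which is the form that \<open>monomial\<close> expects.\<close>

lemma (in comm_group) internal_basis_monomial:
  assumes "finite (carrier G)" "internal_basis G r \<sigma>" "s \<in> carrier G"
  obtains m where "s = monomial G r \<sigma> m"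
proof -
  have \<sigma>: "\<sigma> i \<in> carrier G" if "i < r" for i using assms(2) that by (simp add: internal_basis_def)
  have "(\<lambda>y. \<Otimes>i\<in>{..<r}. y i) ` carrier (product_group {..<r} (\<lambda>i. subgroup_generated G {\<sigma> i})) = carrier G"
    using assms(2) by (auto simp: internal_basis_def iso_def bij_betw_def)
  then obtain y where y: "y \<in> carrier (product_group {..<r} (\<lambda>i. subgroup_generated G {\<sigma> i}))"
    "s = (\<Otimes>i\<in>{..<r}. y i)" using assms(3) by blast
  have "\<exists>k::nat. y i = \<sigma> i [^] k" if i: "i < r" for i
  proof -
    have "y i \<in> carrier (subgroup_generated G {\<sigma> i})" using y(1) i by auto
    then have "y i \<in> generate G {\<sigma> i}" using \<sigma>[OF i] by (simp add: carrier_subgroup_generated)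
    then show ?thesis using generate_pow_on_finite_carrier[OF assms(1) \<sigma>[OF i]] by blast
  qed
  then obtain m where m: "\<And>i. i < r \<Longrightarrow> y i = \<sigma> i [^] (m i :: nat)" by metis
  have "(\<Otimes>i\<in>{..<j}. y i) = monomial G j \<sigma> m" if "j \<le> r" for j
    using that
  proof (induction j)
    case (Suc j)
    have yc: "y i \<in> carrier G" if "i \<le> j" for i using m[of i] \<sigma>[of i] that Suc.prems by simp
    have "(\<Otimes>i\<in>{..<Suc j}. y i) = y j \<otimes> (\<Otimes>i\<in>{..<j}. y i)"
      unfolding lessThan_Suc using yc by (intro finprod_insert) auto
    also have "\<dots> = (\<Otimes>i\<in>{..<j}. y i) \<otimes> y j" using yc by (intro m_comm finprod_closed) auto
    finally show ?case using Suc m by simp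
  qed simp
  then show thesis using y(2) that by simp
qed

section \<open>Monomials, residues of commutators and the degeneracy criterion\<close>

context semiramified
begin

lemma monomial_nonzero:
  "(\<And>i. i < r \<Longrightarrow> \<pi> i \<in> carrier D \<and> \<pi> i \<noteq> \<zero>) \<Longrightarrow> monomial D r \<pi> m \<in> carrier D \<and> monomial D r \<pi> m \<noteq> \<zero>"
  by (induction r) (auto simp: one_neq_zero)

lemma monomial_unit_vec:
  assumes "\<And>i. i < r \<Longrightarrow> \<pi> i \<in> carrier D" "i < r"
  shows "monomial D r \<pi> (unit_vec i) = \<pi> i"
proof -
  have "monomial D j \<pi> (unit_vec i) = (if i < j then \<pi> i else \<one>)" if "j \<le> r" for j
    using that assms by (induction j) (auto simp: unit_vec_def less_Suc_eq)
  then show ?thesis using assms by simp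
qed

lemma basis_theta:
  assumes "basis_with_lifts D v F r \<tau> \<pi>" "i < r"
  shows "\<pi> i \<in> carrier D" "\<pi> i \<noteq> \<zero>" "\<tau> i = theta (\<pi> i)"
proof -
  show \<pi>: "\<pi> i \<in> carrier D" "\<pi> i \<noteq> \<zero>" using assms by (auto simp: basis_with_lifts_def)
  have "\<tau> i \<in> carrier G" using assms by (auto simp: basis_with_lifts_def internal_basis_def)
  then show "\<tau> i = theta (\<pi> i)"
  proof (rule G_eqI[OF _ theta_gal[OF \<pi>]])
    fix a assume "a \<in> carrier E"
    then obtain d where "d \<in> V" "a = res d" by (auto simp: residue_carrier)
    then show "\<tau> i a = theta (\<pi> i) a"
      using assms theta_res[OF \<pi>, of d] by (simp add: basis_with_lifts_def conj_by_def)
  qed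
qed

lemma theta_monomial:
  assumes "\<And>i. i < r \<Longrightarrow> \<pi> i \<in> carrier D \<and> \<pi> i \<noteq> \<zero>" "\<And>i. i < r \<Longrightarrow> \<tau> i = theta (\<pi> i)"
  shows "theta (monomial D r \<pi> m) = monomial G r \<tau> m"
  using assms
proof (induction r)
  case (Suc r)
  have "monomial D r \<pi> m \<in> carrier D \<and> monomial D r \<pi> m \<noteq> \<zero>"
    by (rule monomial_nonzero) (use Suc.prems in simp)
  moreover have "\<pi> r \<in> carrier D" "\<pi> r \<noteq> \<zero>" "\<tau> r = theta (\<pi> r)" using Suc.prems by auto
  ultimately show ?case using Suc by (simp add: theta_mult_G theta_pow)
qed (simp add: theta_one)

text \<open>\<open>u_bar\<close> is this residue for two monomials. It is defined for arbitrary
  elements so that a monomial can be exchanged for another element with the same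
  \<open>theta\<close>.\<close>

definition comm_res :: "'a \<Rightarrow> 'a \<Rightarrow> 'a set" where
  "comm_res x y = res (x \<otimes> y \<otimes> inv x \<otimes> inv y)"

lemma commutator_unit:
  assumes "x \<in> carrier D" "x \<noteq> \<zero>" "y \<in> carrier D" "y \<noteq> \<zero>"
  shows "x \<otimes> y \<otimes> inv x \<otimes> inv y \<in> carrier D" "x \<otimes> y \<otimes> inv x \<otimes> inv y \<noteq> \<zero>"
    "v (x \<otimes> y \<otimes> inv x \<otimes> inv y) = 0" "x \<otimes> y \<otimes> inv x \<otimes> inv y \<in> V"
proof -
  show *: "x \<otimes> y \<otimes> inv x \<otimes> inv y \<in> carrier D" "x \<otimes> y \<otimes> inv x \<otimes> inv y \<noteq> \<zero>"
    "v (x \<otimes> y \<otimes> inv x \<otimes> inv y) = 0"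
    using assms by (auto simp: algebra_simps)
  then show "x \<otimes> y \<otimes> inv x \<otimes> inv y \<in> V" by (rule unit_val_ring)
qed

lemma comm_res_closed:
  assumes "x \<in> carrier D" "x \<noteq> \<zero>" "y \<in> carrier D" "y \<noteq> \<zero>"
  shows "comm_res x y \<in> carrier E" "comm_res x y \<noteq> \<zero>\<^bsub>E\<^esub>"
  using commutator_unit[OF assms] res_nonzero_iff by (auto simp: comm_res_def)

text \<open>The commutator of \<open>x \<otimes> x'\<close> with \<open>y\<close> is the conjugate
  by \<open>x\<close> of the commutator of \<open>x'\<close>, times that of \<open>x\<close>. So in
  its first argument \<open>comm_res\<close> is a crossed homomorphism for \<open>theta\<close>,
  which opens the way to Hilbert 90.\<close>

lemma comm_res_mult:
  assumes "x \<in> carrier D" "x \<noteq> \<zero>" "x' \<in> carrier D" "x' \<noteq> \<zero>" "y \<in> carrier D" "y \<noteq> \<zero>"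
  shows "comm_res (x \<otimes> x') y = theta x (comm_res x' y) \<otimes>\<^bsub>E\<^esub> comm_res x y"
proof -
  let ?c = "x' \<otimes> y \<otimes> inv x' \<otimes> inv y" and ?d = "x \<otimes> y \<otimes> inv x \<otimes> inv y"
  have "x \<otimes> x' \<otimes> y \<otimes> inv (x \<otimes> x') \<otimes> inv y = conj_by x ?c \<otimes> ?d"
    using assms by (simp add: conj_by_def m_assoc)
  then show ?thesis
    using commutator_unit(4)[OF assms(1,2,5,6)] commutator_unit(4)[OF assms(3-6)] assms(1,2) conj_by_val_ring
    by (simp add: comm_res_def theta_res res_mult)
qed

lemma comm_res_swap:
  assumes "x \<in> carrier D" "x \<noteq> \<zero>" "y \<in> carrier D" "y \<noteq> \<zero>"
  shows "comm_res x y \<otimes>\<^bsub>E\<^esub> comm_res y x = \<one>\<^bsub>E\<^esub>"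
proof -
  have "(x \<otimes> y \<otimes> inv x \<otimes> inv y) \<otimes> (y \<otimes> x \<otimes> inv y \<otimes> inv x) = \<one>"
    using assms by (simp add: m_assoc)
  then show ?thesis
    using commutator_unit(4)[OF assms] commutator_unit(4)[OF assms(3,4,1,2)]
    by (simp add: comm_res_def res_mult[symmetric])
qed

lemma comm_res_F:
  assumes "f \<in> F" "f \<noteq> \<zero>" "y \<in> carrier D" "y \<noteq> \<zero>"
  shows "comm_res f y = \<one>\<^bsub>E\<^esub>"
proof -
  note fc = F_carrier[OF assms(1)]
  have "f \<otimes> y \<otimes> inv f = y" using F_commute[OF assms(1,3)] assms fc by (simp add: m_assoc)
  then show ?thesis using assms by (simp add: comm_res_def)
qed

lemma G_one_apply [simp]: "a \<in> carrier E \<Longrightarrow> \<one>\<^bsub>G\<^esub> a = a"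
  by (simp add: residue_gal_def gal_group_one)

text \<open>The central factor \<open>f\<close> contributes nothing to a commutator, and
  \<open>theta u\<close> is trivial, so the only correction comes from \<open>u\<close>
  itself.\<close>

lemma comm_res_left_cong:
  assumes "f \<in> F" "f \<noteq> \<zero>" "u \<in> carrier D" "u \<noteq> \<zero>" "v u = 0" "x \<in> carrier D" "x \<noteq> \<zero>"
    "y \<in> carrier D" "y \<noteq> \<zero>"
  shows "comm_res (f \<otimes> (u \<otimes> x)) y = comm_res x y \<otimes>\<^bsub>E\<^esub> comm_res u y"
proof -
  note fc = F_carrier[OF assms(1)]
  have "comm_res (f \<otimes> (u \<otimes> x)) y = theta f (comm_res (u \<otimes> x) y) \<otimes>\<^bsub>E\<^esub> comm_res f y"
    by (rule comm_res_mult) (use assms fc in auto)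
  also have "\<dots> = comm_res (u \<otimes> x) y"
    using assms fc comm_res_closed[of "u \<otimes> x" y] by (simp add: comm_res_F theta_F)
  also have "\<dots> = theta u (comm_res x y) \<otimes>\<^bsub>E\<^esub> comm_res u y" by (rule comm_res_mult) (use assms in auto)
  also have "theta u (comm_res x y) = comm_res x y"
    using assms comm_res_closed[of x y] by (simp add: theta_val_unit)
  finally show ?thesis .
qed

text \<open>For a unit the commutator is a coboundary; this is the origin of the terms with
  \<open>l\<close> in strong degeneracy.\<close>

lemma comm_res_unit:
  assumes "u \<in> carrier D" "u \<noteq> \<zero>" "v u = 0" "y \<in> carrier D" "y \<noteq> \<zero>"
  shows "comm_res u y = res u \<otimes>\<^bsub>E\<^esub> theta y (res (inv u))"
proof -
  have V: "u \<in> V" "inv u \<in> V" using assms by (auto intro: unit_val_ring)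
  have "u \<otimes> y \<otimes> inv u \<otimes> inv y = u \<otimes> conj_by y (inv u)" using assms by (simp add: conj_by_def m_assoc)
  then show ?thesis using V assms conj_by_val_ring[of y "inv u"] by (simp add: comm_res_def res_mult theta_res)
qed

text \<open>\<open>theta \<alpha>\<close> has order \<open>p\<close>, and \<open>\<alpha>\<close>
  differs from some monomial \<open>P\<close> by a central factor and a unit \<open>u\<close>. Along
  the powers of \<open>\<alpha>\<close> the commutator residues with a fixed \<open>y\<close> form a
  cocycle, which closes up at the exponent \<open>p\<close> since \<open>f\<close> is central and
  \<open>w\<close> has residue 1. Hilbert 90 splits it and gives the elements \<open>k\<close>,
  while \<open>u\<close> gives \<open>l\<close>.\<close>

lemma strongly_degenerateI:
  fixes p r :: nat and \<pi> :: "nat \<Rightarrow> 'a" and \<tau> :: "nat \<Rightarrow> 'a set \<Rightarrow> 'a set"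
  assumes basis: "basis_with_lifts D v F r \<tau> \<pi>" and p: "Factorial_Ring.prime p"
    and \<alpha>: "\<alpha> \<in> carrier D" "\<alpha> \<noteq> \<zero>" "v \<alpha> \<notin> val_of F"
    and w: "f \<in> F" "f \<noteq> \<zero>" "w \<in> V" "res w = \<one>\<^bsub>E\<^esub>" "\<alpha> [^] p = f \<otimes> w"
  shows "strongly_degenerate D v F r \<tau> \<pi>"
proof -
  have wu: "w \<in> carrier D" "w \<noteq> \<zero>" "v w = 0"
    using w(3,4) res_nonzero_iff[of w] E_one_nonzero val_ring_carrier by auto
  note fc = F_carrier[OF w(1)]
  note \<pi> = basis_theta(1,2)[OF basis] and \<tau> = basis_theta(3)[OF basis]
  define s where "s = theta \<alpha>"
  have s: "s \<in> carrier G" using theta_gal \<alpha> by (simp add: s_def)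
  have sp: "s [^]\<^bsub>G\<^esub> p = \<one>\<^bsub>G\<^esub>"
    using theta_pow[OF \<alpha>(1,2), of p] w fc wu by (simp add: s_def theta_mult_G theta_F theta_val_unit)
  have "s \<noteq> \<one>\<^bsub>G\<^esub>"
  proof
    assume "s = \<one>\<^bsub>G\<^esub>"
    then have "v \<alpha> - v \<one> \<in> val_of F" using \<alpha> one_neq_zero by (intro theta_inj) (auto simp: s_def theta_one)
    then show False using \<alpha> by simp
  qed
  then have "G.ord s \<noteq> 1" using G.ord_eq_1[OF s] by simp
  moreover have "G.ord s dvd p" using G.pow_eq_id[OF s, of p] sp by simp
  ultimately have ord: "G.ord s = p" using p by (metis prime_nat_iff)
  obtain m where m: "s = monomial G r \<tau> m"
    using G.internal_basis_monomial[OF finite_G _ s] basis unfolding basis_with_lifts_def by metis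
  define P where "P = monomial D r \<pi> m"
  have P: "P \<in> carrier D" "P \<noteq> \<zero>" using monomial_nonzero[of r \<pi> m] \<pi> by (auto simp: P_def)
  have "theta P = s" unfolding P_def m using \<pi> \<tau> by (intro theta_monomial) auto
  then have "v \<alpha> - v P \<in> val_of F" using theta_inj[of \<alpha> P] \<alpha> P by (simp add: s_def)
  then obtain g u where gu: "g \<in> F" "g \<noteq> \<zero>" "u \<in> carrier D" "u \<noteq> \<zero>" "v u = 0" "\<alpha> = g \<otimes> (u \<otimes> P)"
    using unit_decomposition[OF \<alpha>(1,2) P] by metis
  have uV: "u \<in> V" "inv u \<in> V" using gu by (auto intro: unit_val_ring)
  \<comment> \<open>\<open>l\<close> depends only on the comparison of \<open>\<alpha>\<close> with
    \<open>P\<close> and not on \<open>y\<close>: strong degeneracy asks for one \<open>l\<close>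
    serving all basis elements, while \<open>k\<close> may vary with them.\<close>
  define l where "l = res (inv u)"
  have l: "l \<in> carrier E" "l \<noteq> \<zero>\<^bsub>E\<^esub>" using uV gu res_nonzero_iff[of "inv u"] by (auto simp: l_def)
  have lu: "inv\<^bsub>E\<^esub> l = res u" unfolding l_def
    using res_inv[OF gu(3-5)] uV by (intro E.inv_char) auto
  have K: "\<exists>k. k \<in> carrier E \<and> k \<noteq> \<zero>\<^bsub>E\<^esub> \<and> comm_res y P =
      s k \<otimes>\<^bsub>E\<^esub> inv\<^bsub>E\<^esub> k \<otimes>\<^bsub>E\<^esub> (theta y l \<otimes>\<^bsub>E\<^esub> inv\<^bsub>E\<^esub> l)"
    if y: "y \<in> carrier D" "y \<noteq> \<zero>" for y
  proof -
    have pow: "\<alpha> [^] j \<in> carrier D" "\<alpha> [^] j \<noteq> \<zero>" for j :: nat using \<alpha> by auto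
    define B where "B j = comm_res (\<alpha> [^] j) y" for j :: nat
    have Bc: "B j \<in> carrier E" "B j \<noteq> \<zero>\<^bsub>E\<^esub>" for j
      using comm_res_closed[OF pow y] by (auto simp: B_def)
    have B_add: "B (i + j) = theta (\<alpha> [^] i) (B j) \<otimes>\<^bsub>E\<^esub> B i" for i j
      using comm_res_mult[OF pow pow y, of i j] \<alpha>(1) by (simp add: B_def nat_pow_mult)
    have wres: "comm_res w y = \<one>\<^bsub>E\<^esub>"
    proof -
      have wV: "inv w \<in> V" using wu by (auto intro: unit_val_ring)
      have "res (inv w) = \<one>\<^bsub>E\<^esub>" using res_inv(1)[OF wu] w(4) wV by simp
      then show ?thesis using comm_res_unit[OF wu y] w(4) ring_hom_one[OF theta_hom[OF y]] by simp
    qed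
    have Bp: "B p = \<one>\<^bsub>E\<^esub>"
      using comm_res_mult[OF fc w(2) wu(1,2) y] w wres comm_res_F[OF w(1,2) y]
        ring_hom_one[OF theta_hom[OF fc w(2)]] by (simp add: B_def)
    have Bpt: "B (p * t) = \<one>\<^bsub>E\<^esub>" for t
    proof (induction t)
      case 0
      then show ?case using y one_neq_zero by (simp add: B_def comm_res_def)
    next
      case (Suc t)
      then show ?case using B_add[of "p * t" p] Bp ring_hom_one[OF theta_hom[OF pow]] by (simp add: add.commute)
    qed
    \<comment> \<open>Hilbert 90 needs a function on the group generated by \<open>s\<close>, while
      \<open>B\<close> is indexed by exponents; period \<open>p\<close> makes \<open>B\<close>
      descend.\<close>
    have periodic: "B j = B i" if "i \<le> j" "s [^]\<^bsub>G\<^esub> i = s [^]\<^bsub>G\<^esub> j" for i j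
    proof -
      have "s [^]\<^bsub>G\<^esub> j = s [^]\<^bsub>G\<^esub> i \<otimes>\<^bsub>G\<^esub> s [^]\<^bsub>G\<^esub> (j - i)" using that(1) s by (simp add: G.nat_pow_mult)
      then have "s [^]\<^bsub>G\<^esub> (j - i) = \<one>\<^bsub>G\<^esub>" using that(2) s by simp
      then obtain t where "j - i = p * t" using G.pow_eq_id[OF s] ord by (auto simp: dvd_def)
      then have "j = i + p * t" using that(1) by simp
      then show ?thesis using B_add[of i "p * t"] Bpt ring_hom_one[OF theta_hom[OF pow]] Bc by simp
    qed
    define H where "H = range (\<lambda>j::nat. s [^]\<^bsub>G\<^esub> j)"
    have HG: "H \<subseteq> carrier G" using s by (auto simp: H_def)
    have Hsub: "subgroup H G"
    proof -
      have "H = generate G {s}" using G.generate_pow_on_finite_carrier[OF finite_G s] by (auto simp: H_def)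
      then show ?thesis using G.generate_is_subgroup[of "{s}"] s by simp
    qed
    define c where "c h = B (SOME j. s [^]\<^bsub>G\<^esub> j = h)" for h
    have c: "c (s [^]\<^bsub>G\<^esub> j) = B j" for j :: nat
    proof -
      define i where "i = (SOME i::nat. s [^]\<^bsub>G\<^esub> i = s [^]\<^bsub>G\<^esub> j)"
      have eq: "s [^]\<^bsub>G\<^esub> i = s [^]\<^bsub>G\<^esub> j" unfolding i_def by (rule someI[of _ j]) simp
      have "B i = B j"
      proof (cases "i \<le> j")
        case True
        then show ?thesis using periodic[OF _ eq] by simp
      next
        case False
        then show ?thesis using periodic[OF _ eq[symmetric]] by simp
      qed
      then show ?thesis unfolding c_def i_def .
    qed
    have th: "theta (\<alpha> [^] j) = s [^]\<^bsub>G\<^esub> j" for j :: nat using theta_pow \<alpha> by (simp add: s_def)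
    obtain b where b: "b \<in> carrier E" "b \<noteq> \<zero>\<^bsub>E\<^esub>" "\<And>h. h \<in> H \<Longrightarrow> c h \<otimes>\<^bsub>E\<^esub> h b = b"
    proof (rule E.hilbert90[OF F'_carrier, of H c])
      show "subgroup H (gal_group E F')" using Hsub by (simp add: residue_gal_def)
      show "finite H" using HG finite_G finite_subset by blast
      show "c h \<in> carrier E" "c h \<noteq> \<zero>\<^bsub>E\<^esub>" if h: "h \<in> H" for h
      proof -
        obtain j :: nat where j: "h = s [^]\<^bsub>G\<^esub> j" using h by (auto simp: H_def)
        show "c h \<in> carrier E" "c h \<noteq> \<zero>\<^bsub>E\<^esub>" unfolding j c by (rule Bc)+
      qed
      show "c (g \<otimes>\<^bsub>gal_group E F'\<^esub> h) = c g \<otimes>\<^bsub>E\<^esub> g (c h)" if gh: "g \<in> H" "h \<in> H" for g h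
      proof -
        obtain i j :: nat where ij: "g = s [^]\<^bsub>G\<^esub> i" "h = s [^]\<^bsub>G\<^esub> j" using gh by (auto simp: H_def)
        have "c (g \<otimes>\<^bsub>G\<^esub> h) = B (i + j)" using ij s c[of "i + j"] by (simp add: G.nat_pow_mult)
        also have "\<dots> = c g \<otimes>\<^bsub>E\<^esub> g (c h)"
          using B_add[of i j] Bc theta_closed[OF pow Bc(1), of i j] th[of i] c ij by (simp add: E.m_comm)
        finally show ?thesis by (simp add: residue_gal_def)
      qed
    qed blast
    have sH: "s \<in> H" unfolding H_def using s by (intro range_eqI[of _ _ "1::nat"]) simp
    have c1: "c s = comm_res \<alpha> y" using c[of 1] s \<alpha> by (simp add: B_def)
    have bs: "comm_res \<alpha> y \<otimes>\<^bsub>E\<^esub> s b = b" using b(3)[OF sH] c1 by simp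
    have sb: "s b \<in> carrier E" using theta_closed[OF \<alpha>(1,2) b(1)] by (simp add: s_def)
    \<comment> \<open>Strong degeneracy has the basis element in the first argument, so the relation
      between \<open>\<alpha>\<close> and \<open>y\<close> is passed on to \<open>P\<close> and then
      inverted by \<open>comm_res_swap\<close>.\<close>
    have "comm_res \<alpha> y = comm_res P y \<otimes>\<^bsub>E\<^esub> (res u \<otimes>\<^bsub>E\<^esub> theta y l)"
      using comm_res_left_cong[OF gu(1-5) P y] comm_res_unit[OF gu(3-5) y] gu(6) by (simp add: l_def)
    moreover have "comm_res y P \<otimes>\<^bsub>E\<^esub> comm_res P y = \<one>\<^bsub>E\<^esub>" by (rule comm_res_swap) (use y P in auto)
    moreover have cl: "comm_res y P \<in> carrier E" "comm_res P y \<in> carrier E" "theta y l \<in> carrier E" "res u \<in> carrier E"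
      using comm_res_closed y P theta_closed[OF y l(1)] uV by auto
    ultimately have "comm_res y P \<otimes>\<^bsub>E\<^esub> comm_res \<alpha> y = res u \<otimes>\<^bsub>E\<^esub> theta y l"
      by (simp add: E.m_assoc[symmetric])
    then have "comm_res y P \<otimes>\<^bsub>E\<^esub> (comm_res \<alpha> y \<otimes>\<^bsub>E\<^esub> s b) = (res u \<otimes>\<^bsub>E\<^esub> theta y l) \<otimes>\<^bsub>E\<^esub> s b"
      using cl comm_res_closed[OF \<alpha>(1,2) y] sb by (simp add: E.m_assoc[symmetric])
    then have eq: "comm_res y P \<otimes>\<^bsub>E\<^esub> b = (res u \<otimes>\<^bsub>E\<^esub> theta y l) \<otimes>\<^bsub>E\<^esub> s b" using bs by simp
    have bU: "b \<in> Units E" using b E.field_Units by auto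
    have "comm_res y P = (comm_res y P \<otimes>\<^bsub>E\<^esub> b) \<otimes>\<^bsub>E\<^esub> inv\<^bsub>E\<^esub> b"
      using bU cl b(1) by (simp add: E.m_assoc)
    also have "\<dots> = (res u \<otimes>\<^bsub>E\<^esub> theta y l) \<otimes>\<^bsub>E\<^esub> s b \<otimes>\<^bsub>E\<^esub> inv\<^bsub>E\<^esub> b" by (simp only: eq)
    also have "\<dots> = s b \<otimes>\<^bsub>E\<^esub> inv\<^bsub>E\<^esub> b \<otimes>\<^bsub>E\<^esub> (theta y l \<otimes>\<^bsub>E\<^esub> inv\<^bsub>E\<^esub> l)"
      unfolding lu using bU cl b(1) sb by (simp add: E.m_ac)
    finally show ?thesis using b by blast
  qed
  have "\<exists>k. \<forall>i<r. k i \<in> carrier E \<and> k i \<noteq> \<zero>\<^bsub>E\<^esub> \<and> comm_res (\<pi> i) P =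
      s (k i) \<otimes>\<^bsub>E\<^esub> inv\<^bsub>E\<^esub> (k i) \<otimes>\<^bsub>E\<^esub> (theta (\<pi> i) l \<otimes>\<^bsub>E\<^esub> inv\<^bsub>E\<^esub> l)"
  proof (intro choice allI)
    fix i
    show "\<exists>k. i < r \<longrightarrow> k \<in> carrier E \<and> k \<noteq> \<zero>\<^bsub>E\<^esub> \<and> comm_res (\<pi> i) P =
      s k \<otimes>\<^bsub>E\<^esub> inv\<^bsub>E\<^esub> k \<otimes>\<^bsub>E\<^esub> (theta (\<pi> i) l \<otimes>\<^bsub>E\<^esub> inv\<^bsub>E\<^esub> l)"
      using K[OF \<pi>, of i] by (cases "i < r") auto
  qed
  then obtain k where k: "\<And>i. i < r \<Longrightarrow> k i \<in> carrier E \<and> k i \<noteq> \<zero>\<^bsub>E\<^esub> \<and> comm_res (\<pi> i) P =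
      s (k i) \<otimes>\<^bsub>E\<^esub> inv\<^bsub>E\<^esub> (k i) \<otimes>\<^bsub>E\<^esub> (theta (\<pi> i) l \<otimes>\<^bsub>E\<^esub> inv\<^bsub>E\<^esub> l)" by blast
  have u_bar: "u_bar D v r \<pi> (unit_vec i) m = comm_res (\<pi> i) P" if "i < r" for i
    using monomial_unit_vec[of r \<pi> i] \<pi> that by (simp add: u_bar_def comm_res_def P_def)
  show ?thesis
    unfolding strongly_degenerate_def Let_def
  proof (intro exI[of _ m] exI[of _ l] exI[of _ k] conjI allI impI)
    show "Factorial_Ring.prime (G.ord (monomial G r \<tau> m))" using ord p m by simp
    fix i assume i: "i < r"
    show "u_bar D v r \<pi> (unit_vec i) m = monomial G r \<tau> m (k i) \<otimes>\<^bsub>E\<^esub> inv\<^bsub>E\<^esub> k i \<otimes>\<^bsub>E\<^esub> (\<tau> i l \<otimes>\<^bsub>E\<^esub> inv\<^bsub>E\<^esub> l)"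
      using k[OF i] u_bar[OF i] \<tau>[OF i] m by simp
  qed (use l k in auto)
qed

end

section \<open>Galois subfields\<close>

context ring
begin

lemma independent_consistent:
  assumes "subring H R" "set Us \<subseteq> H" "independent K Us"
  shows "ring.independent (R\<lparr>carrier := H\<rparr>) K Us"
proof -
  interpret H: ring "R\<lparr>carrier := H\<rparr>" by (rule subring_is_ring[OF assms(1)])
  show ?thesis using assms(2,3)
  proof (induction Us)
    case (Cons u Us)
    have u: "u \<notin> Span K Us" "independent K Us" using independent_backwards[OF Cons.prems(2)] by auto
    then show ?case using Cons Span_consistent[OF assms(1)] by (intro H.li_Cons) auto
  qed (rule H.li_Nil)
qed

lemma dimension_consistent:
  assumes "subring H R" "subfield K R" "A \<subseteq> H" "dimension n K A"
  shows "ring.dimension (R\<lparr>carrier := H\<rparr>) n K A"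
proof -
  interpret H: ring "R\<lparr>carrier := H\<rparr>" by (rule subring_is_ring[OF assms(1)])
  obtain Us where Us: "set Us \<subseteq> carrier R" "independent K Us" "length Us = n" "Span K Us = A"
    using exists_base[OF assms(2,4)] by blast
  have "set Us \<subseteq> H" using Span_base_incl[OF assms(2) Us(1)] Us(4) assms(3) by blast
  then have "H.independent K Us" using independent_consistent[OF assms(1) _ Us(2)] by blast
  then have "H.dimension (length Us) K (H.Span K Us)" by (rule H.dimension_independent)
  then show ?thesis unfolding Span_consistent[OF assms(1)] Us(3,4) .
qed

lemma subfield_consistent:
  assumes "subfield K R" "subfield H R" "K \<subseteq> H"
  shows "subfield K (R\<lparr>carrier := H\<rparr>)"
proof -
  interpret H: ring "R\<lparr>carrier := H\<rparr>" by (rule subring_is_ring[OF subfieldE(1)[OF assms(2)]])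
  show ?thesis by (rule H.subfield_iff(1)) (use subfield_iff(2)[OF assms(1)] assms(3) in auto)
qed

text \<open>A list that spans over \<open>K\<close> still spans over the larger field.\<close>

lemma finite_dimension_extend:
  assumes K: "subfield K R" and H: "subfield H R" "K \<subseteq> H" and fin: "finite_dimension K (carrier R)"
  shows "finite_dimension H (carrier R)"
proof -
  obtain n where "dimension n K (carrier R)" using fin by (auto simp: finite_dimension_def)
  then obtain Us where Us: "set Us \<subseteq> carrier R" "Span K Us = carrier R" using exists_base[OF K] by blast
  have "Span K Us \<subseteq> Span H Us" using Span_eq_combine_set[OF K Us(1)] Span_eq_combine_set[OF H(1) Us(1)] H(2) by blast
  then have "Span H Us = carrier R" using Us Span_subgroup_props(1)[OF H(1) Us(1)] by simp
  then show ?thesis using Span_finite_dimension[OF H(1) Us(1)] by simp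
qed

lemma subfield_subalgebra:
  assumes K: "subfield K R" and H: "subfield H R" "K \<subseteq> H"
  shows "subalgebra K H R"
proof -
  have "subgroup H (add_monoid R)" using subring.axioms(1)[OF subfieldE(1)[OF H(1)]] .
  then show ?thesis using subringE(6)[OF subfieldE(1)[OF H(1)]] H(2)
    by (auto simp: subalgebra_def subalgebra_axioms_def)
qed

end

locale galois_subfield = semiramified D v F n for D :: "('a, 'b) ring_scheme" (structure)
    and v :: "'a \<Rightarrow> 'g::linordered_ab_group_add" and F n +
  fixes L :: "'a set" and p k :: nat
  assumes L_subfield: "subfield L D" and FL: "F \<subseteq> L"
    and galois: "galois_extension (D\<lparr>carrier := L\<rparr>) F"
    and prime_p: "Factorial_Ring.prime p" and n_power: "n = p ^ k"
    and char_E: "add_pow E p \<one>\<^bsub>E\<^esub> = \<zero>\<^bsub>E\<^esub>"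
begin

abbreviation "DL \<equiv> D\<lparr>carrier := L\<rparr>"
abbreviation "GL \<equiv> gal_group DL F"
abbreviation "L' \<equiv> sub_residue D v L"
abbreviation "EL \<equiv> E\<lparr>carrier := L'\<rparr>"
abbreviation "GX \<equiv> gal_group EL F'"

lemma L_subring: "subring L D" by (rule subfieldE(1)[OF L_subfield])

lemma L_carrier: "x \<in> L \<Longrightarrow> x \<in> carrier D" using subfieldE(3)[OF L_subfield] by auto

lemma L_closed: "x \<in> L \<Longrightarrow> y \<in> L \<Longrightarrow> x \<otimes> y \<in> L" "x \<in> L \<Longrightarrow> y \<in> L \<Longrightarrow> x \<oplus> y \<in> L"
  "x \<in> L \<Longrightarrow> \<ominus> x \<in> L" "\<one> \<in> L" "\<zero> \<in> L" "x \<in> L \<Longrightarrow> x \<noteq> \<zero> \<Longrightarrow> inv x \<in> L"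
  using subringE[OF L_subring] subfield_inv[OF L_subfield] by auto

lemma L_pow: "x \<in> L \<Longrightarrow> x [^] (j::nat) \<in> L"
  by (induction j) (auto simp: L_closed)

lemma L_commute: "x \<in> L \<Longrightarrow> y \<in> L \<Longrightarrow> x \<otimes> y = y \<otimes> x"
  by (rule subcring.sub_m_comm[OF subfieldE(2)[OF L_subfield]])

lemma DL_field: "field DL" using galois by (simp add: galois_extension_def)

sublocale DL: field DL by (rule DL_field)

lemma F_subfield_DL: "subfield F DL" using galois by (simp add: galois_extension_def)

sublocale GL: group GL by (rule DL.group_gal_group) (use FL in simp)

lemma galois_fixed: "x \<in> L \<Longrightarrow> (\<And>g. g \<in> carrier GL \<Longrightarrow> g x = x) \<Longrightarrow> x \<in> F"
  using galois by (auto simp: galois_extension_def)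

section \<open>Galois automorphisms preserve the valuation\<close>

context
  fixes g assumes g: "g \<in> carrier GL"
begin

lemma g_ring_hom: "g \<in> ring_hom DL DL" using gal_group_ring_hom[OF g] .

lemma g_closed: "x \<in> L \<Longrightarrow> g x \<in> L" using gal_group_closed[OF g] by simp

lemma g_mult: "x \<in> L \<Longrightarrow> y \<in> L \<Longrightarrow> g (x \<otimes> y) = g x \<otimes> g y" using ring_hom_mult[OF g_ring_hom] by simp

lemma g_add: "x \<in> L \<Longrightarrow> y \<in> L \<Longrightarrow> g (x \<oplus> y) = g x \<oplus> g y" using ring_hom_add[OF g_ring_hom] by simp

lemma g_one: "g \<one> = \<one>" using ring_hom_one[OF g_ring_hom] by simp

lemma g_F: "x \<in> F \<Longrightarrow> g x = x" using g by (simp add: gal_group_carrier)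

lemma g_zero: "g \<zero> = \<zero>" using g_F subringE(2)[OF subfieldE(1)[OF F_subfield]] by simp

lemma g_minus: assumes "x \<in> L" shows "g (\<ominus> x) = \<ominus> g x"
proof -
  have "g (\<ominus> x) \<oplus> g x = \<zero>" using assms g_add[of "\<ominus> x" x] L_closed L_carrier[of x] by (simp add: l_neg g_zero)
  then show ?thesis using assms g_closed L_closed L_carrier by (metis minus_equality)
qed

lemma g_nonzero: "x \<in> L \<Longrightarrow> x \<noteq> \<zero> \<Longrightarrow> g x \<noteq> \<zero>"
proof
  assume x: "x \<in> L" "x \<noteq> \<zero>" "g x = \<zero>"
  have "g (x \<otimes> inv x) = \<zero> \<otimes> g (inv x)" using g_mult[of x "inv x"] x L_closed(6) by simp
  then have "\<one> = \<zero>" using x L_carrier[OF x(1)] L_carrier[OF g_closed[OF L_closed(6)[OF x(1,2)]]] g_one by simp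
  then show False using one_neq_zero by simp
qed

lemma g_pow: "x \<in> L \<Longrightarrow> g (x [^] (j::nat)) = g x [^] j"
  by (induction j) (auto simp: g_one g_mult L_pow)

text \<open>The two elements are roots of the same polynomial over the center, which splits into
  conjugates of the first.\<close>

lemma g_val: assumes a: "a \<in> L" "a \<noteq> \<zero>" shows "v (g a) = v a"
proof -
  have aD: "a \<in> carrier D" using a L_carrier by simp
  obtain cs where cs: "set (linear_product cs) \<subseteq> F" "cs \<noteq> []" "peval \<one> (linear_product cs) \<one> a = \<zero>"
    "\<And>c. c \<in> set cs \<Longrightarrow> \<exists>x\<in>carrier D - {\<zero>}. c = conj_by x a"
    using wedderburn[OF aD] by metis
  have csD: "set cs \<subseteq> carrier D" using cs(4) aD conj_by_closed by blast
  let ?f = "linear_product cs"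
  have "ring.peval DL (g \<one>\<^bsub>DL\<^esub>) (map g ?f) (g \<one>\<^bsub>DL\<^esub>) (g a) = g (ring.peval DL \<one>\<^bsub>DL\<^esub> ?f \<one>\<^bsub>DL\<^esub> a)"
    by (rule skew_field.peval_ring_hom[OF DL.is_skew_field g_ring_hom DL.ring_axioms])
      (use cs(1) FL a L_closed in auto)
  moreover have "map g ?f = ?f" by (rule map_idI) (use cs(1) g_F in auto)
  ultimately have root: "peval \<one> ?f \<one> (g a) = \<zero>"
    using cs(3) by (simp add: peval_consistent[OF L_subring] g_one g_zero)
  have ga: "g a \<in> carrier D" "g a \<noteq> \<zero>" using g_closed g_nonzero a L_carrier by auto
  obtain c z where cz: "c \<in> set cs" "z \<in> carrier D" "z \<noteq> \<zero>" "z \<otimes> g a = c \<otimes> z"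
    using peval_linear_product_root[OF csD one_closed one_neq_zero ga(1) root] by metis
  obtain x where x: "x \<in> carrier D" "x \<noteq> \<zero>" "c = conj_by x a" using cs(4)[OF cz(1)] by blast
  have c: "c \<in> carrier D" "c \<noteq> \<zero>" "v c = v a" using x aD a by auto
  have "v (z \<otimes> g a) = v z + v (g a)" by (rule val_mult[OF cz(2,3) ga])
  moreover have "v (c \<otimes> z) = v c + v z" by (rule val_mult[OF c(1,2) cz(2,3)])
  ultimately show ?thesis using cz(4) c(3) by (simp add: add.commute)
qed

lemma g_V: "a \<in> V \<inter> L \<Longrightarrow> g a \<in> V \<inter> L"
  using g_val[of a] g_closed[of a] L_carrier[of "g a"] g_zero by (cases "a = \<zero>") (auto simp: val_ring_def)

lemma g_M: "a \<in> M \<inter> L \<Longrightarrow> g a \<in> M"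
  using g_val[of a] g_closed[of a] L_carrier[of "g a"] g_zero by (cases "a = \<zero>") (auto simp: val_ideal_def)

end

section \<open>Reduction of the Galois group of L\<close>

definition gbar :: "('a \<Rightarrow> 'a) \<Rightarrow> 'a set \<Rightarrow> 'a set" where
  "gbar g = (\<lambda>e\<in>L'. res (g (SOME a. a \<in> V \<inter> L \<and> res a = e)))"

text \<open>Two lifts of the same residue differ by an element of \<open>M\<close>, and
  \<open>g\<close> preserves \<open>M\<close> because it preserves values.\<close>

lemma gbar_res:
  assumes g: "g \<in> carrier GL" and a: "a \<in> V \<inter> L"
  shows "gbar g (res a) = res (g a)"
proof -
  define b where "b = (SOME b. b \<in> V \<inter> L \<and> res b = res a)"
  have b: "b \<in> V \<inter> L" "res b = res a"
    using someI[of "\<lambda>b. b \<in> V \<inter> L \<and> res b = res a" a] a by (auto simp: b_def)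
  then have "b \<ominus> a \<in> M \<inter> L" using a res_eq_iff L_closed by (simp add: minus_eq)
  then have "g (b \<ominus> a) \<in> M" by (rule g_M[OF g])
  moreover have "g (b \<ominus> a) = g b \<ominus> g a" using a b L_closed g_add[OF g] g_minus[OF g] by (simp add: minus_eq)
  ultimately have "res (g b) = res (g a)" using g_V[OF g] a b by (simp add: res_eq_iff)
  moreover have "res a \<in> L'" using a by (auto simp: sub_residue_def)
  ultimately show ?thesis by (simp add: gbar_def b_def)
qed

lemma L'_subfield: "subfield L' E" by (rule sub_residue_subfield[OF E_field L_subfield])

lemma L'_carrier: "x \<in> L' \<Longrightarrow> x \<in> carrier E" using subfieldE(3)[OF L'_subfield] by auto

lemma F'_L': "F' \<subseteq> L'" using FL by (auto simp: sub_residue_def)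

lemma EL_field: "field EL" by (rule E.subfield_iff(2)[OF L'_subfield])

sublocale EL: field EL by (rule EL_field)

sublocale GX: group GX by (rule EL.group_gal_group) (use F'_L' in simp)

lemma VL_closed: "a \<in> V \<inter> L \<Longrightarrow> b \<in> V \<inter> L \<Longrightarrow> a \<otimes> b \<in> V \<inter> L" "a \<in> V \<inter> L \<Longrightarrow> b \<in> V \<inter> L \<Longrightarrow> a \<oplus> b \<in> V \<inter> L"
  using L_closed val_ring_closed by auto

lemma gbar_hom: "g \<in> carrier GL \<Longrightarrow> gbar g \<in> ring_hom EL EL"
proof (rule ring_hom_memI)
  assume g: "g \<in> carrier GL"
  fix e assume "e \<in> carrier EL"
  then obtain a where a: "a \<in> V \<inter> L" "e = res a" by (auto simp: sub_residue_def)
  show "gbar g e \<in> carrier EL" using gbar_res[OF g a(1)] g_V[OF g a(1)] a(2) by (auto simp: sub_residue_def)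
next
  assume g: "g \<in> carrier GL"
  fix d e assume "d \<in> carrier EL" "e \<in> carrier EL"
  then obtain a b where ab: "a \<in> V \<inter> L" "d = res a" "b \<in> V \<inter> L" "e = res b" by (auto simp: sub_residue_def)
  note gg = gbar_res[OF g ab(1)] gbar_res[OF g ab(3)] g_V[OF g ab(1)] g_V[OF g ab(3)]
    gbar_res[OF g VL_closed(1)[OF ab(1,3)]] gbar_res[OF g VL_closed(2)[OF ab(1,3)]]
  show "gbar g (d \<otimes>\<^bsub>EL\<^esub> e) = gbar g d \<otimes>\<^bsub>EL\<^esub> gbar g e"
    using ab gg g_mult[OF g, of a b] by (simp add: res_mult[symmetric])
  show "gbar g (d \<oplus>\<^bsub>EL\<^esub> e) = gbar g d \<oplus>\<^bsub>EL\<^esub> gbar g e"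
    using ab gg g_add[OF g, of a b] by (simp add: res_add[symmetric])
next
  assume g: "g \<in> carrier GL"
  show "gbar g \<one>\<^bsub>EL\<^esub> = \<one>\<^bsub>EL\<^esub>" using gbar_res[OF g, of \<one>] L_closed g_one[OF g] by simp
qed

lemma gbar_comp:
  assumes "g \<in> carrier GL" "h \<in> carrier GL" "e \<in> L'"
  shows "gbar (g \<otimes>\<^bsub>GL\<^esub> h) e = gbar g (gbar h e)"
proof -
  obtain a where a: "a \<in> V \<inter> L" "e = res a" using assms(3) by (auto simp: sub_residue_def)
  have "(g \<otimes>\<^bsub>GL\<^esub> h) a = g (h a)" using gal_group_apply[OF assms(1,2)] a by simp
  then show ?thesis using gbar_res[OF GL.m_closed[OF assms(1,2)] a(1)] gbar_res[OF assms(2) a(1)]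
      gbar_res[OF assms(1) g_V[OF assms(2) a(1)]] a by simp
qed

lemma gbar_in_GX: "g \<in> carrier GL \<Longrightarrow> gbar g \<in> carrier GX"
proof (rule EL.gal_group_memI[where g = "gbar (inv\<^bsub>GL\<^esub> g)"])
  assume g: "g \<in> carrier GL"
  show "gbar g \<in> ring_hom EL EL" by (rule gbar_hom[OF g])
  show "gbar g \<in> extensional (carrier EL)" by (simp add: gbar_def)
  show "gbar (inv\<^bsub>GL\<^esub> g) \<in> carrier EL \<rightarrow> carrier EL" using ring_hom_closed[OF gbar_hom[OF GL.inv_closed[OF g]]] by blast
  have one: "gbar \<one>\<^bsub>GL\<^esub> e = e" if e: "e \<in> L'" for e
  proof -
    obtain a where a: "a \<in> V \<inter> L" "e = res a" using e by (auto simp: sub_residue_def)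
    have "\<one>\<^bsub>GL\<^esub> a = a" using a by (simp add: gal_group_one)
    then show ?thesis using gbar_res[OF GL.one_closed a(1)] a by simp
  qed
  fix e
  show "gbar g (gbar (inv\<^bsub>GL\<^esub> g) e) = e" "gbar (inv\<^bsub>GL\<^esub> g) (gbar g e) = e" if "e \<in> carrier EL"
    using gbar_comp[OF g GL.inv_closed[OF g], of e] gbar_comp[OF GL.inv_closed[OF g] g, of e] that one g by auto
  show "gbar g e = e" if "e \<in> F'"
  proof -
    obtain a where a: "a \<in> V" "a \<in> F" "e = res a" using \<open>e \<in> F'\<close> by (auto simp: sub_residue_def)
    then show ?thesis using gbar_res[OF g, of a] g_F[OF g a(2)] FL by auto
  qed
qed

lemma gbar_group_hom: "group_hom GL GX gbar"
proof -
  have "gbar \<in> hom GL GX"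
  proof (rule homI)
    fix g h assume gh: "g \<in> carrier GL" "h \<in> carrier GL"
    show "gbar (g \<otimes>\<^bsub>GL\<^esub> h) = gbar g \<otimes>\<^bsub>GX\<^esub> gbar h"
    proof (rule gal_group_eqI)
      fix e assume "e \<in> carrier EL"
      then show "gbar (g \<otimes>\<^bsub>GL\<^esub> h) e = (gbar g \<otimes>\<^bsub>GX\<^esub> gbar h) e"
        using gbar_comp[OF gh, of e] gal_group_apply[OF gbar_in_GX[OF gh(1)] gbar_in_GX[OF gh(2)], of e] by simp
    qed (use gh gbar_in_GX GL.m_closed[OF gh] GX.m_closed in auto)
  qed (rule gbar_in_GX)
  then show ?thesis by (intro group_hom.intro group_hom_axioms.intro GL.is_group GX.is_group)
qed

text \<open>The argument of \<open>theta_fixed\<close> with the Galois orbit of a lift in place of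
  its conjugates: the coefficients of the splitting polynomial are Galois invariant, and all its
  roots reduce to \<open>e\<close>. It holds before anything is known about ramification, as
  \<open>invariant_leading_term\<close> requires.\<close>

lemma gbar_fixed:
  assumes e: "e \<in> L'" and fixed: "\<And>g. g \<in> carrier GL \<Longrightarrow> gbar g e = e"
  shows "e \<in> F'"
proof -
  obtain a where a: "a \<in> V \<inter> L" "e = res a" using e by (auto simp: sub_residue_def)
  have aD: "a \<in> carrier D" using a L_carrier by simp
  interpret S: skew_field DL by (rule DL.is_skew_field)
  define A where "A = (\<lambda>g. g a) ` carrier GL"
  have AL: "A \<subseteq> L" using g_closed a by (auto simp: A_def)
  obtain f where f: "set f \<subseteq> F" "peval \<one> f \<one> a = \<zero>"
    by (rule exists_vanishing[OF F_subfield dim_D aD]) (use aD in auto)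
  have van: "S.vanishes_on f A"
    unfolding S.vanishes_on_def
  proof (intro conjI ballI)
    show "set f \<subseteq> carrier DL" using f FL by auto
    fix b assume "b \<in> A"
    then obtain g where g: "g \<in> carrier GL" "b = g a" by (auto simp: A_def)
    have "ring.peval DL (g \<one>\<^bsub>DL\<^esub>) (map g f) (g \<one>\<^bsub>DL\<^esub>) (g a) = g (ring.peval DL \<one>\<^bsub>DL\<^esub> f \<one>\<^bsub>DL\<^esub> a)"
      by (rule S.peval_ring_hom[OF g_ring_hom[OF g(1)] DL.ring_axioms]) (use f FL a L_closed in auto)
    moreover have "map g f = f" by (rule map_idI) (use f g_F[OF g(1)] in auto)
    ultimately show "ring.peval DL \<one>\<^bsub>DL\<^esub> f \<one>\<^bsub>DL\<^esub> b = \<zero>\<^bsub>DL\<^esub>"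
      using f(2) g by (simp add: peval_consistent[OF L_subring] g_one g_zero)
  qed
  obtain cs where cs: "S.vanishes_on (DL.linear_product cs) A"
    "\<And>\<phi> c. \<phi> \<in> carrier GL \<Longrightarrow> c \<in> set (DL.linear_product cs) \<Longrightarrow> \<phi> c = c"
    "\<And>c. c \<in> set cs \<Longrightarrow> \<exists>b\<in>A. \<exists>z\<in>carrier DL - {\<zero>\<^bsub>DL\<^esub>}. c = z \<otimes>\<^bsub>DL\<^esub> b \<otimes>\<^bsub>DL\<^esub> inv\<^bsub>DL\<^esub> z"
  proof (rule S.invariant_splitting_polynomial[OF _ van, of "carrier GL"])
    show "A \<subseteq> carrier DL" using AL by simp
    show "\<phi> \<in> ring_hom DL DL" if "\<phi> \<in> carrier GL" for \<phi> using g_ring_hom[OF that] .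
    show "A \<subseteq> \<phi> ` A" if \<phi>: "\<phi> \<in> carrier GL" for \<phi>
    proof
      fix b assume "b \<in> A"
      then obtain g where g: "g \<in> carrier GL" "b = g a" by (auto simp: A_def)
      define h where "h = inv\<^bsub>GL\<^esub> \<phi> \<otimes>\<^bsub>GL\<^esub> g"
      have h: "h \<in> carrier GL" using \<phi> g by (simp add: h_def)
      have "\<phi> \<otimes>\<^bsub>GL\<^esub> h = g" using \<phi> g by (simp add: h_def GL.m_assoc[symmetric])
      then have "b = \<phi> (h a)" using gal_group_apply[OF \<phi> h, of a] a g by simp
      then show "b \<in> \<phi> ` A" using h by (auto simp: A_def)
    qed
  qed blast
  \<comment> \<open>\<open>L\<close> is commutative, so conjugating inside \<open>L\<close> changes
    nothing and the roots lie in the orbit itself.\<close>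
  have csA: "c \<in> A" if c: "c \<in> set cs" for c
  proof -
    obtain b z where bz: "b \<in> A" "z \<in> L" "z \<noteq> \<zero>" "c = z \<otimes> b \<otimes> inv\<^bsub>DL\<^esub> z" using cs(3)[OF c] by auto
    have i: "inv\<^bsub>DL\<^esub> z \<in> L" "z \<otimes> inv\<^bsub>DL\<^esub> z = \<one>" using S.inv_carrier[of z] S.inv_right[of z] bz by auto
    have "b \<in> L" using bz AL by auto
    then have "z \<otimes> b \<otimes> inv\<^bsub>DL\<^esub> z = b \<otimes> (z \<otimes> inv\<^bsub>DL\<^esub> z)"
      using L_commute[of z b] bz i L_carrier by (simp add: m_assoc)
    then show ?thesis using bz i \<open>b \<in> L\<close> L_carrier by simp
  qed
  have lp: "DL.linear_product cs = linear_product cs"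
    by (rule linear_product_consistent[OF L_subring]) (use csA AL in auto)
  show ?thesis
  proof (rule residue_in_subfield[OF E_field F_subfield sep, of cs])
    show "set cs \<subseteq> V" using csA g_V a by (fastforce simp: A_def)
    show "res c = e" if c: "c \<in> set cs" for c
    proof -
      obtain g where "g \<in> carrier GL" "c = g a" using csA[OF c] by (auto simp: A_def)
      then show ?thesis using fixed[of g] gbar_res[of g a] a by simp
    qed
    have "a \<in> A" unfolding A_def using GL.one_closed a by (intro image_eqI[of _ _ "\<one>\<^bsub>GL\<^esub>"]) (auto simp: gal_group_one)
    then have "peval \<one> (linear_product cs) \<one> a = \<zero>"
      using cs(1) by (simp add: S.vanishes_on_def lp peval_consistent[OF L_subring])
    then show "cs \<noteq> []" using one_neq_zero by (auto simp: linear_product_def)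
    show "set (linear_product cs) \<subseteq> F"
    proof
      fix c assume c: "c \<in> set (linear_product cs)"
      then have "c \<in> L" using cs(1) by (auto simp: S.vanishes_on_def lp)
      then show "c \<in> F" using galois_fixed cs(2) c lp by metis
    qed
  qed
qed


section \<open>Excluding ramification in L\<close>

definition GB :: "('a set \<Rightarrow> 'a set) set" where
  "GB = gbar ` carrier GL"

lemma GB_subgroup: "subgroup GB GX"
  unfolding GB_def by (rule group_hom.img_is_subgroup[OF gbar_group_hom])

lemma dim_L: obtains l where "dimension l F L" "DL.dimension l F L" "card (carrier GL) \<le> l" "finite (carrier GL)"
proof -
  have "finite_dimension F (carrier D)" using dim_D by (rule finite_dimensionI)
  moreover have "subalgebra F L D" by (rule subfield_subalgebra[OF F_subfield L_subfield FL])
  ultimately obtain l where l: "dimension l F L"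
    using subalbegra_incl_imp_finite_dimension[OF F_subfield] subfieldE(3)[OF L_subfield]
    by (metis finite_dimension_def)
  have l': "DL.dimension l F L" by (rule dimension_consistent[OF L_subring F_subfield subset_refl l])
  have "finite (carrier GL) \<and> card (carrier GL) \<le> l"
  proof (rule DL.embeddings_bound[OF F_subfield_DL DL.carrier_is_subfield])
    show "F \<subseteq> carrier DL" using FL by simp
    show "DL.dimension l F (carrier DL)" using l' by simp
    fix g assume g: "g \<in> carrier GL"
    show "g \<in> ring_hom (DL\<lparr>carrier := carrier DL\<rparr>) DL" using g_ring_hom[OF g] by simp
    show "g \<in> extensional (carrier DL)" using g by (simp add: gal_group_carrier)
    show "g x = x" if "x \<in> F" for x using g_F[OF g that] .
  qed
  then show thesis using that l l' by blast
qed

lemma finite_GB: "finite GB"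
  using dim_L unfolding GB_def by (metis finite_imageI)

text \<open>Choosing a representative of \<open>\<gamma>\<close> on whose class in the associated graded field the Galois group
  acts trivially.\<close>

lemma invariant_leading_term:
  assumes a0: "a0 \<in> L" "a0 \<noteq> \<zero>" "v (a0 [^] p) \<in> val_of F"
  obtains a f w where "a \<in> L" "a \<noteq> \<zero>" "v a = v a0" "f \<in> F" "f \<noteq> \<zero>" "w \<in> V" "res w = \<one>\<^bsub>E\<^esub>"
    "a [^] p = f \<otimes> w"
proof -
  have a0D: "a0 \<in> carrier D" using a0 L_carrier by simp
  \<comment> \<open>A 1-cocycle with values in the units of the valuation ring of \<open>L\<close>;
    its residue measures how \<open>g\<close> moves the leading term of \<open>a0\<close>.\<close>
  define d where "d g = g a0 \<otimes> inv a0" for g :: "'a \<Rightarrow> 'a"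
  have dL: "d g \<in> V \<inter> L" "d g \<in> carrier D" "d g \<noteq> \<zero>" "v (d g) = 0" "g a0 = d g \<otimes> a0" if g: "g \<in> carrier GL" for g
  proof -
    have ga: "g a0 \<in> L" "g a0 \<in> carrier D" "g a0 \<noteq> \<zero>" "v (g a0) = v a0"
      using g_closed[OF g a0(1)] L_carrier[OF g_closed[OF g a0(1)]] g_nonzero[OF g a0(1,2)] g_val[OF g a0(1,2)] by simp_all
    show *: "d g \<in> carrier D" "d g \<noteq> \<zero>" "v (d g) = 0" unfolding d_def using ga(2-4) a0(2) a0D by simp_all
    have "d g \<in> L" unfolding d_def by (rule L_closed(1)[OF ga(1) L_closed(6)[OF a0(1,2)]])
    then show "d g \<in> V \<inter> L" using unit_val_ring[OF *] by simp
    show "g a0 = d g \<otimes> a0" unfolding d_def using ga(2) a0(2) a0D by (simp add: m_assoc)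
  qed
  have d_mult: "d (g \<otimes>\<^bsub>GL\<^esub> h) = g (d h) \<otimes> d g" if g: "g \<in> carrier GL" and h: "h \<in> carrier GL" for g h
  proof -
    have "(g \<otimes>\<^bsub>GL\<^esub> h) a0 = g (d h \<otimes> a0)" using gal_group_apply[OF g h, of a0] a0 dL(5)[OF h] by simp
    also have "\<dots> = g (d h) \<otimes> g a0" using dL(1)[OF h] a0 by (intro g_mult[OF g]) auto
    finally have "(g \<otimes>\<^bsub>GL\<^esub> h) a0 = g (d h) \<otimes> g a0" .
    moreover have "g (d h) \<in> carrier D" "g a0 \<in> carrier D"
      using L_carrier[OF g_closed[OF g, of "d h"]] L_carrier[OF g_closed[OF g a0(1)]] dL(1)[OF h] by simp_all
    ultimately have "d (g \<otimes>\<^bsub>GL\<^esub> h) = g (d h) \<otimes> (g a0 \<otimes> inv a0)"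
      unfolding d_def[of "g \<otimes>\<^bsub>GL\<^esub> h"] using m_assoc[OF _ _ inv_carrier[OF a0D a0(2)]] by metis
    then show ?thesis by (simp only: d_def[of g])
  qed
  obtain f0 where f0: "f0 \<in> F" "f0 \<noteq> \<zero>" "v (a0 [^] p) = v f0" using a0(3) by (auto simp: val_of_def)
  note f0c = F_carrier[OF f0(1)]
  \<comment> \<open>A unit, because the p-th power of \<open>a0\<close> has a value of
    \<open>F\<close>. Since \<open>f0\<close> is fixed by the Galois group, the action on
    \<open>u\<close> displays the p-th powers of the cocycle.\<close>
  define u where "u = a0 [^] p \<otimes> inv f0"
  have inv_f0: "inv f0 \<in> F" using subfield_inv[OF F_subfield f0(1,2)] .
  have u: "u \<in> carrier D" "u \<noteq> \<zero>" "v u = 0" using a0D a0 f0 f0c by (auto simp: u_def)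
  have uVL: "u \<in> V \<inter> L"
    using unit_val_ring[OF u] L_closed(1)[OF L_pow[OF a0(1)] subsetD[OF FL inv_f0], of p] by (simp add: u_def)
  have DL_pow: "(x \<otimes> y) [^] j = x [^] j \<otimes> y [^] j" if "x \<in> L" "y \<in> L" for x y and j :: nat
    using that by (intro pow_mult_distrib L_commute L_carrier)
  have gu: "g u = d g [^] p \<otimes> u" if g: "g \<in> carrier GL" for g
  proof -
    have "g u = g (a0 [^] p) \<otimes> g (inv f0)"
      unfolding u_def using L_pow[OF a0(1)] inv_f0 FL by (intro g_mult[OF g]) auto
    also have "\<dots> = (d g \<otimes> a0) [^] p \<otimes> inv f0"
      using g_pow[OF g a0(1)] g_F[OF g inv_f0] dL(5)[OF g] by simp
    also have "\<dots> = d g [^] p \<otimes> u" using DL_pow[of "d g" a0] dL(1,2)[OF g] a0 a0D f0 f0c by (simp add: u_def m_assoc)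
    finally show ?thesis .
  qed
  define c where "c g = res (d g)" for g
  have cL: "c g \<in> L'" "c g \<noteq> \<zero>\<^bsub>E\<^esub>" if g: "g \<in> carrier GL" for g
    using dL(1,3,4)[OF g] res_nonzero_iff[of "d g"] by (auto simp: c_def sub_residue_def)
  have res_pow: "x \<in> V \<Longrightarrow> x [^] j \<in> V \<and> res (x [^] j) = res x [^]\<^bsub>E\<^esub> j" for x and j :: nat
    by (induction j) (auto simp: res_mult val_ring_closed(2))
  have cp: "gbar g (res u) = c g [^]\<^bsub>E\<^esub> p \<otimes>\<^bsub>E\<^esub> res u" if g: "g \<in> carrier GL" for g
    using gbar_res[OF g uVL] gu[OF g] res_pow[of "d g" p] dL(1)[OF g] uVL by (simp add: c_def res_mult)
  have ru: "res u \<in> Units E" using uVL u res_nonzero_iff[of u] E.field_Units by auto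
  \<comment> \<open>\<open>cp\<close> expresses the p-th power of \<open>c g\<close> through the
    action of \<open>gbar g\<close> on \<open>res u\<close>, so equal reductions give equal p-th
    powers, and injectivity of Frobenius removes the power. This lets the cocycle descend to
    \<open>GB\<close>.\<close>
  have c_cong: "c g = c h" if g: "g \<in> carrier GL" and h: "h \<in> carrier GL" and eq: "gbar g = gbar h" for g h
  proof (rule E.frobenius_inj[OF prime_p char_E])
    show c: "c g \<in> carrier E" "c h \<in> carrier E" "c h \<noteq> \<zero>\<^bsub>E\<^esub>" using L'_carrier[OF cL(1)[OF g]] L'_carrier[OF cL(1)[OF h]] cL(2)[OF h] by simp_all
    have "c g [^]\<^bsub>E\<^esub> p \<otimes>\<^bsub>E\<^esub> res u = c h [^]\<^bsub>E\<^esub> p \<otimes>\<^bsub>E\<^esub> res u" using cp[OF g] cp[OF h] eq by simp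
    then show "c g [^]\<^bsub>E\<^esub> p = c h [^]\<^bsub>E\<^esub> p" using ru c by (simp add: E.m_rcancel E.field_Units)
  qed
  define C where "C \<chi> = c (SOME g. g \<in> carrier GL \<and> gbar g = \<chi>)" for \<chi>
  have C: "C (gbar g) = c g" if g: "g \<in> carrier GL" for g
  proof -
    define h where "h = (SOME h. h \<in> carrier GL \<and> gbar h = gbar g)"
    have "h \<in> carrier GL \<and> gbar h = gbar g" unfolding h_def by (rule someI[of _ g]) (use g in simp)
    then have "c h = c g" using c_cong[of h g] g by simp
    then show ?thesis by (simp add: C_def h_def)
  qed
  obtain b where b: "b \<in> carrier EL" "b \<noteq> \<zero>\<^bsub>EL\<^esub>" "\<And>\<chi>. \<chi> \<in> GB \<Longrightarrow> C \<chi> \<otimes>\<^bsub>EL\<^esub> \<chi> b = b"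
  proof (rule EL.hilbert90[OF _ GB_subgroup finite_GB, of C])
    show "F' \<subseteq> carrier EL" using F'_L' by simp
    show "C \<chi> \<in> carrier EL" "C \<chi> \<noteq> \<zero>\<^bsub>EL\<^esub>" if \<chi>: "\<chi> \<in> GB" for \<chi>
    proof -
      obtain g where g: "g \<in> carrier GL" "\<chi> = gbar g" using \<chi> by (auto simp: GB_def)
      show "C \<chi> \<in> carrier EL" "C \<chi> \<noteq> \<zero>\<^bsub>EL\<^esub>" using cL[OF g(1)] C[OF g(1)] g(2) by auto
    qed
    show "C (\<chi> \<otimes>\<^bsub>GX\<^esub> \<eta>) = C \<chi> \<otimes>\<^bsub>EL\<^esub> \<chi> (C \<eta>)" if \<chi>: "\<chi> \<in> GB" and \<eta>: "\<eta> \<in> GB" for \<chi> \<eta>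
    proof -
      obtain g where g: "g \<in> carrier GL" "\<chi> = gbar g" using \<chi> by (auto simp: GB_def)
      obtain h where h: "h \<in> carrier GL" "\<eta> = gbar h" using \<eta> by (auto simp: GB_def)
      have "\<chi> \<otimes>\<^bsub>GX\<^esub> \<eta> = gbar (g \<otimes>\<^bsub>GL\<^esub> h)"
        using group_hom.hom_mult[OF gbar_group_hom g(1) h(1)] g h by simp
      then have "C (\<chi> \<otimes>\<^bsub>GX\<^esub> \<eta>) = c (g \<otimes>\<^bsub>GL\<^esub> h)" using C g h by simp
      also have "\<dots> = res (g (d h)) \<otimes>\<^bsub>E\<^esub> c g"
        using d_mult[OF g(1) h(1)] g_V[OF g(1) dL(1)[OF h(1)]] dL(1)[OF g(1)] by (simp add: c_def res_mult)
      also have "res (g (d h)) = gbar g (c h)" using gbar_res[OF g(1) dL(1)[OF h(1)]] by (simp add: c_def)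
      finally have "C (\<chi> \<otimes>\<^bsub>GX\<^esub> \<eta>) = gbar g (c h) \<otimes>\<^bsub>E\<^esub> c g" .
      moreover have "gbar g (c h) \<in> carrier E"
        using ring_hom_closed[OF gbar_hom[OF g(1)], of "c h"] cL(1)[OF h(1)] L'_carrier[of "gbar g (c h)"] by simp
      ultimately show ?thesis using C[OF g(1)] C[OF h(1)] g h L'_carrier[OF cL(1)[OF g(1)]] by (simp add: E.m_comm)
    qed
  qed blast
  obtain b' where b': "b' \<in> V \<inter> L" "b = res b'" using b(1) by (auto simp: sub_residue_def)
  have b'u: "b' \<in> carrier D" "b' \<noteq> \<zero>" "v b' = 0"
    using b' b(2) res_nonzero_iff[of b'] L_carrier[of b'] by auto
  \<comment> \<open>A lift of the Hilbert 90 element cancels the residue cocycle: each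
    \<open>g a\<close> becomes \<open>w \<otimes> a\<close> with \<open>w\<close> of residue
    1.\<close>
  define a where "a = b' \<otimes> a0"
  have a: "a \<in> L" "a \<noteq> \<zero>" "v a = v a0" "a \<in> carrier D"
    using b' b'u a0 a0D L_closed(1)[of b' a0] by (auto simp: a_def)
  define u' where "u' = a [^] p \<otimes> inv f0"
  have vap: "v (a [^] p) = v f0" using val_pow[OF a(4,2) a0D a0(2) a(3)] f0(3) by simp
  have u': "u' \<in> carrier D" "u' \<noteq> \<zero>" "v u' = 0" using a vap f0 f0c by (auto simp: u'_def)
  have u'VL: "u' \<in> V \<inter> L"
    using unit_val_ring[OF u'] L_closed(1)[OF L_pow[OF a(1)] subsetD[OF FL inv_f0], of p] by (simp add: u'_def)
  have "gbar g (res u') = res u'" if g: "g \<in> carrier GL" for g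
  proof -
    define w where "w = g b' \<otimes> d g \<otimes> inv b'"
    have gb: "g b' \<in> V \<inter> L" using g_V[OF g b'(1)] .
    have ib: "inv b' \<in> V \<inter> L" using b' b'u L_closed(6)[of b'] by (auto intro: unit_val_ring)
    have wVL: "w \<in> V \<inter> L" using gb dL(1)[OF g] ib VL_closed(1) unfolding w_def by blast
    have ga: "g a = w \<otimes> a"
    proof -
      have "g a = g b' \<otimes> (d g \<otimes> a0)" unfolding a_def using g_mult[OF g, of b' a0] b' a0 dL(5)[OF g] by simp
      moreover have "g b' \<in> carrier D" using gb L_carrier[of "g b'"] by simp
      ultimately show ?thesis using dL(2)[OF g] b'u a0D by (simp add: w_def a_def m_assoc)
    qed
    have "res w = gbar g b \<otimes>\<^bsub>E\<^esub> c g \<otimes>\<^bsub>E\<^esub> res (inv b')"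
      using gb dL(1)[OF g] ib gbar_res[OF g b'(1)] b'(2) by (simp add: w_def res_mult c_def val_ring_closed(2))
    also have "gbar g b \<otimes>\<^bsub>E\<^esub> c g = b"
    proof -
      have "c g \<otimes>\<^bsub>E\<^esub> gbar g b = b" using b(3)[of "gbar g"] C[OF g] g by (simp add: GB_def)
      moreover have "gbar g b \<in> carrier E" using ring_hom_closed[OF gbar_hom[OF g] b(1)] L'_carrier[of "gbar g b"] by simp
      ultimately show ?thesis using L'_carrier[OF cL(1)[OF g]] by (simp add: E.m_comm)
    qed
    finally have rw: "res w = \<one>\<^bsub>E\<^esub>" using res_inv(1)[OF b'u] b'(2) by simp
    have "g u' = g (a [^] p) \<otimes> g (inv f0)"
      unfolding u'_def using L_pow[OF a(1)] inv_f0 FL by (intro g_mult[OF g]) auto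
    also have "\<dots> = (w \<otimes> a) [^] p \<otimes> inv f0"
      using g_pow[OF g a(1)] g_F[OF g inv_f0] ga by simp
    also have "\<dots> = w [^] p \<otimes> u'" using DL_pow[of w a] wVL a L_carrier[of w] f0 f0c by (simp add: u'_def m_assoc)
    finally have "res (g u') = res u'" using res_pow[of w p] wVL u'VL rw by (simp add: res_mult)
    then show ?thesis using gbar_res[OF g u'VL] by simp
  qed
  moreover have "res u' \<in> L'" using u'VL by (auto simp: sub_residue_def)
  ultimately have "res u' \<in> F'" using gbar_fixed by blast
  \<comment> \<open>Galois invariance puts the residue of \<open>u'\<close> into that of
    \<open>F\<close>; moving a lift \<open>f1\<close> into the central factor leaves a cofactor of
    residue 1.\<close>
  then obtain f1 where f1: "f1 \<in> V" "f1 \<in> F" "res u' = res f1" by (auto simp: sub_residue_def)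
  have "res u' \<noteq> \<zero>\<^bsub>E\<^esub>" using u' u'VL res_nonzero_iff[of u'] by simp
  then have f1n: "f1 \<noteq> \<zero>" "v f1 = 0" using f1 res_nonzero_iff[of f1] by auto
  note f1c = F_carrier[OF f1(2)]
  have if1: "inv f1 \<in> V" using f1n f1c by (auto intro: unit_val_ring)
  show thesis
  proof (rule that[of a "f0 \<otimes> f1" "inv f1 \<otimes> u'"])
    show "f0 \<otimes> f1 \<in> F" using f0 f1 subringE(6)[OF subfieldE(1)[OF F_subfield]] by blast
    show "f0 \<otimes> f1 \<noteq> \<zero>" using f0 f1n f0c f1c by simp
    show "inv f1 \<otimes> u' \<in> V" using if1 u'VL val_ring_closed(2)[of "inv f1" u'] by simp
    show "res (inv f1 \<otimes> u') = \<one>\<^bsub>E\<^esub>" using if1 u'VL f1(3) res_inv(2)[OF f1c f1n] by (simp add: res_mult)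
    have "u' \<otimes> f0 = a [^] p" using a f0 f0c by (simp add: u'_def m_assoc)
    then show "a [^] p = f0 \<otimes> f1 \<otimes> (inv f1 \<otimes> u')"
      using f1n f1c f0c u' F_commute[OF f0(1) u'(1)] by (simp add: m_assoc)
  qed (use a in auto)
qed

lemma unramified:
  fixes r :: nat and \<pi> :: "nat \<Rightarrow> 'a" and \<tau> :: "nat \<Rightarrow> 'a set \<Rightarrow> 'a set"
  assumes "basis_with_lifts D v F r \<tau> \<pi>" "\<not> strongly_degenerate D v F r \<tau> \<pi>"
  shows "val_of L = val_of F"
proof (rule ccontr)
  assume "val_of L \<noteq> val_of F"
  moreover have "val_of F \<subseteq> val_of L" using FL by (auto simp: val_of_def)
  ultimately obtain a where a: "a \<in> L" "a \<noteq> \<zero>" "v a \<notin> val_of F" by (auto simp: val_of_def)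
  have aD: "a \<in> carrier D" using a L_carrier by simp
  \<comment> \<open>The degree enters as a power of \<open>p\<close>: raising \<open>a\<close> to
    the exponent \<open>n = p ^ k\<close> gives a value of \<open>F\<close>, so at some
    \<open>j\<close> the step from \<open>p ^ j\<close> to the next power enters
    \<open>val_of F\<close>. That single step is a p-th power.\<close>
  define Q where "Q j \<longleftrightarrow> v (a [^] (p ^ j)) \<in> val_of F" for j :: nat
  have "Q k" using val_pow_n[OF aD a(2)] by (simp add: Q_def n_power)
  moreover have "\<not> Q 0" using a aD by (simp add: Q_def)
  ultimately obtain j where j: "\<not> Q j" "Q (Suc j)"
    by (induction k) blast+
  define a0 where "a0 = a [^] (p ^ j)"
  have a0: "a0 \<in> L" "a0 \<noteq> \<zero>" "v a0 \<notin> val_of F" using L_pow[OF a(1)] a aD j by (auto simp: a0_def Q_def)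
  have "a0 [^] p = a [^] (p ^ Suc j)" using aD by (simp add: a0_def nat_pow_pow mult.commute)
  then have "v (a0 [^] p) \<in> val_of F" using j(2) by (simp add: Q_def)
  then obtain b f w where b: "b \<in> L" "b \<noteq> \<zero>" "v b = v a0" "f \<in> F" "f \<noteq> \<zero>" "w \<in> V" "res w = \<one>\<^bsub>E\<^esub>"
    "b [^] p = f \<otimes> w"
    using invariant_leading_term[OF a0(1,2)] by metis
  have "strongly_degenerate D v F r \<tau> \<pi>"
    by (rule strongly_degenerateI[OF assms(1) prime_p _ b(2) _ b(4-8)]) (use b(3) a0(3) L_carrier[OF b(1)] in simp_all)
  then show False using assms(2) by simp
qed


section \<open>Degrees and the map between Galois groups\<close>

lemma residue_degree:
  assumes unr: "val_of L = val_of F"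
  obtains l where "dimension l F L" "E.dimension l F' L'" "card (carrier GL) \<le> l" "finite (carrier GL)"
proof -
  obtain l where l: "dimension l F L" "card (carrier GL) \<le> l" "finite (carrier GL)" using dim_L by metis
  have finE: "E.finite_dimension F' (carrier E)" using dim_E by (rule E.finite_dimensionI)
  have "E.finite_dimension F' L'"
    using E.subalbegra_incl_imp_finite_dimension[OF F'_subfield finE
        E.subfield_subalgebra[OF F'_subfield L'_subfield F'_L']] subfieldE(3)[OF L'_subfield] by simp
  then obtain m where m: "E.dimension m F' L'" by (auto simp: E.finite_dimension_def)
  obtain f where f: "E.dimension f L' (carrier E)"
    using E.finite_dimension_extend[OF F'_subfield L'_subfield F'_L' finE] by (auto simp: E.finite_dimension_def)
  obtain d where d: "dimension d L (carrier D)"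
    using finite_dimension_extend[OF F_subfield L_subfield FL finite_dimensionI[OF dim_D]]
    by (auto simp: finite_dimension_def)
  have ld: "l * d = n\<^sup>2"
    using dimension_is_inj[OF F_subfield telescopic_base[OF F_subfield L_subfield l(1) d] dim_D] .
  have mf: "m * f = n"
    using E.dimension_is_inj[OF F'_subfield E.telescopic_base[OF F'_subfield L'_subfield m f] dim_E] .
  have "value_index D v F > 0" using n_pos index by simp
  from value_index_representatives[OF F_subfield this]
  obtain Y where Y: "finite Y" "card Y = n" "Y \<subseteq> carrier D - {\<zero>}"
    "\<And>x y. x \<in> Y \<Longrightarrow> y \<in> Y \<Longrightarrow> v x - v y \<in> val_of F \<Longrightarrow> x = y"
    unfolding index by metis
  \<comment> \<open>As \<open>L\<close> and \<open>F\<close> have the same values, the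
    \<open>n\<close> representatives for \<open>F\<close> also represent distinct classes over
    \<open>L\<close>.\<close>
  have "f * card Y \<le> d"
    by (rule fundamental_inequality[OF L_subfield E_field d f Y(1,3)]) (use Y(4) unr in auto)
  then have "l * (f * n) \<le> l * d" using Y by simp
  \<comment> \<open>Here \<open>l * d\<close> is \<open>n * n\<close> and one factor
    \<open>n\<close> is \<open>m * f\<close>; cancelling \<open>n\<close> and then \<open>f\<close>
    leaves \<open>l \<le> m\<close>.\<close>
  then have "(l * f) * n \<le> (m * f) * n" using ld mf by (simp add: power2_eq_square mult.assoc)
  then have "l * f \<le> m * f" using n_pos by simp
  moreover have "f > 0" using mf n_pos by (cases f) auto
  ultimately have "l \<le> m" by simp
  moreover have "m \<le> l" by (rule dimension_residue_le[OF F_subfield E_field l(1) m])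
  ultimately show thesis using that l m by simp
qed

text \<open>The chain \<open>l\<close>, \<open>card GB\<close>, \<open>card (carrier GL)\<close>,
  \<open>l\<close> increases weakly by Artin's bound, by taking an image and by hypothesis, so it is
  constant.\<close>

lemma gbar_inj_card:
  assumes dim: "E.dimension l F' L'" and card: "card (carrier GL) \<le> l"
  shows "inj_on gbar (carrier GL)" "card GB = l"
proof -
  have fin: "finite (carrier GL)" using dim_L by metis
  have EL_dim: "EL.dimension l F' L'"
    by (rule E.dimension_consistent[OF subfieldE(1)[OF L'_subfield] F'_subfield subset_refl dim])
  have "l \<le> card GB"
  proof (rule EL.artin_bound[OF _ GB_subgroup finite_GB])
    show "subfield F' EL" by (rule E.subfield_consistent[OF F'_subfield L'_subfield F'_L'])
    show "EL.dimension l F' (carrier EL)" using EL_dim by simp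
    show "e \<in> F'" if "e \<in> carrier EL" "\<And>h. h \<in> GB \<Longrightarrow> h e = e" for e
      using gbar_fixed[of e] that by (auto simp: GB_def)
  qed
  moreover have "card GB \<le> card (carrier GL)" unfolding GB_def by (rule card_image_le[OF fin])
  ultimately have "card GB = l" "card GB = card (carrier GL)" using card by auto
  then show "card GB = l" "inj_on gbar (carrier GL)"
    using eq_card_imp_inj_on[OF fin] by (auto simp: GB_def)
qed

text \<open>Both the reductions of elements of \<open>Gal(L/F)\<close> and the restrictions of residue automorphisms are
  embeddings of the residue field of \<open>L\<close>; counting identifies the two groups.\<close>

lemma residue_gal_epi:
  assumes dim: "E.dimension l F' L'" and card: "card (carrier GL) \<le> l"
  shows "\<exists>h. h \<in> epi G GL"
proof -
  note inj = gbar_inj_card(1)[OF assms] and cardGB = gbar_inj_card(2)[OF assms]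
  define \<rho> where "\<rho> s = restrict s L'" for s :: "'a set \<Rightarrow> 'a set"
  define S where "S = \<rho> ` carrier G"
  have EL_dim: "EL.dimension l F' L'"
    by (rule E.dimension_consistent[OF subfieldE(1)[OF L'_subfield] F'_subfield subset_refl dim])
  have Gs: "s \<in> ring_hom E E" "\<And>x. x \<in> F' \<Longrightarrow> s x = x" if s: "s \<in> carrier G" for s
    using s gal_group_ring_hom[of s E F'] by (auto simp: residue_gal_def gal_group_carrier)
  \<comment> \<open>\<open>GB\<close> already contains the maximal number \<open>l\<close> of
    embeddings, so no restriction can lie outside it. In particular every residue automorphism maps
    \<open>L'\<close> to itself.\<close>
  have "finite (GB \<union> S) \<and> card (GB \<union> S) \<le> l"
  proof (rule E.embeddings_bound[OF F'_subfield L'_subfield F'_L' dim])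
    fix \<chi> assume "\<chi> \<in> GB \<union> S"
    then consider (GB) "\<chi> \<in> GB" | (S) s where "s \<in> carrier G" "\<chi> = \<rho> s" by (auto simp: S_def)
    then have "\<chi> \<in> ring_hom EL E \<and> \<chi> \<in> extensional L' \<and> (\<forall>x\<in>F'. \<chi> x = x)"
    proof cases
      case GB
      then have \<chi>: "\<chi> \<in> carrier GX" using subgroup.subset[OF GB_subgroup] by blast
      have "\<chi> \<in> ring_hom EL EL" by (rule gal_group_ring_hom[OF \<chi>])
      then have "\<chi> \<in> ring_hom EL E" using L'_carrier by (auto simp: ring_hom_def)
      then show ?thesis using \<chi> by (auto simp: gal_group_carrier)
    next
      case (S s)
      have "\<chi> \<in> ring_hom EL E"
      proof (rule ring_hom_memI)
        fix x y assume xy: "x \<in> carrier EL" "y \<in> carrier EL"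
        then have c: "x \<in> L'" "y \<in> L'" "x \<in> carrier E" "y \<in> carrier E" using L'_carrier by auto
        have cl: "x \<otimes>\<^bsub>E\<^esub> y \<in> L'" "x \<oplus>\<^bsub>E\<^esub> y \<in> L'"
          using c subringE(6,7)[OF subfieldE(1)[OF L'_subfield]] by auto
        show "\<chi> (x \<otimes>\<^bsub>EL\<^esub> y) = \<chi> x \<otimes>\<^bsub>E\<^esub> \<chi> y"
          using ring_hom_mult[OF Gs(1)[OF S(1)] c(3,4)] c cl by (simp add: S \<rho>_def)
        show "\<chi> (x \<oplus>\<^bsub>EL\<^esub> y) = \<chi> x \<oplus>\<^bsub>E\<^esub> \<chi> y"
          using ring_hom_add[OF Gs(1)[OF S(1)] c(3,4)] c cl by (simp add: S \<rho>_def)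
      next
        fix x assume x: "x \<in> carrier EL"
        then have "x \<in> L'" "x \<in> carrier E" using L'_carrier by auto
        then show "\<chi> x \<in> carrier E" using ring_hom_closed[OF Gs(1)[OF S(1)], of x] by (simp add: S \<rho>_def)
      next
        show "\<chi> \<one>\<^bsub>EL\<^esub> = \<one>\<^bsub>E\<^esub>"
          using ring_hom_one[OF Gs(1)[OF S(1)]] subringE(3)[OF subfieldE(1)[OF L'_subfield]] by (simp add: S \<rho>_def)
      qed
      moreover have "\<chi> x = x" if x: "x \<in> F'" for x
        using Gs(2)[OF S(1) x] subsetD[OF F'_L' x] by (simp add: S \<rho>_def)
      ultimately show ?thesis by (auto simp: S \<rho>_def)
    qed
    then show "\<chi> \<in> ring_hom (E\<lparr>carrier := L'\<rparr>) E" "\<chi> \<in> extensional L'"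
      and "\<And>x. x \<in> F' \<Longrightarrow> \<chi> x = x" by auto
  qed
  then have "GB \<union> S = GB" using card_seteq[of "GB \<union> S" GB] cardGB by auto
  then have SGB: "S \<subseteq> GB" by blast
  have GBX: "GB \<subseteq> carrier GX" using subgroup.subset[OF GB_subgroup] .
  have \<rho>_hom: "\<rho> \<in> hom G GX"
  proof (rule homI)
    show \<rho>X: "\<rho> s \<in> carrier GX" if "s \<in> carrier G" for s using that SGB GBX by (auto simp: S_def)
    fix s t assume st: "s \<in> carrier G" "t \<in> carrier G"
    show "\<rho> (s \<otimes>\<^bsub>G\<^esub> t) = \<rho> s \<otimes>\<^bsub>GX\<^esub> \<rho> t"
    proof (rule gal_group_eqI[OF \<rho>X[OF G.m_closed[OF st]] GX.m_closed[OF \<rho>X[OF st(1)] \<rho>X[OF st(2)]]])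
      fix x assume "x \<in> carrier EL"
      then have x: "x \<in> L'" "x \<in> carrier E" using L'_carrier by auto
      have "(\<rho> s \<otimes>\<^bsub>GX\<^esub> \<rho> t) x = \<rho> s (\<rho> t x)"
        using gal_group_apply[OF \<rho>X[OF st(1)] \<rho>X[OF st(2)], of x] x by simp
      moreover have "\<rho> t x \<in> L'" using gal_group_closed[OF \<rho>X[OF st(2)], of x] x by simp
      ultimately show "\<rho> (s \<otimes>\<^bsub>G\<^esub> t) x = (\<rho> s \<otimes>\<^bsub>GX\<^esub> \<rho> t) x"
        using G_apply[OF st x(2)] x by (simp add: \<rho>_def)
    qed
  qed
  have S_sub: "subgroup S GX" unfolding S_def
    by (rule group_hom.img_is_subgroup) (intro group_hom.intro group_hom_axioms.intro G.is_group GX.is_group \<rho>_hom)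
  \<comment> \<open>By \<open>theta_fixed\<close> the restrictions have fixed field
    \<open>F'\<close> inside \<open>L'\<close>; Artin's bound then makes \<open>S\<close> as large
    as \<open>GB\<close>.\<close>
  have "l \<le> card S"
  proof (rule EL.artin_bound[OF _ S_sub])
    show "subfield F' EL" by (rule E.subfield_consistent[OF F'_subfield L'_subfield F'_L'])
    show "finite S" using finite_subset[OF SGB finite_GB] .
    show "EL.dimension l F' (carrier EL)" using EL_dim by simp
    show "e \<in> F'" if e: "e \<in> carrier EL" and fixed: "\<And>h. h \<in> S \<Longrightarrow> h e = e" for e
    proof (rule theta_fixed)
      show "e \<in> carrier E" using e L'_carrier by simp
      fix x assume "x \<in> carrier D" "x \<noteq> \<zero>"
      then have "\<rho> (theta x) \<in> S" using theta_gal by (simp add: S_def)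
      then show "theta x e = e" using fixed[of "\<rho> (theta x)"] e by (simp add: \<rho>_def)
    qed
  qed
  then have S_eq: "S = GB" using card_seteq[OF finite_GB SGB] cardGB by simp
  \<comment> \<open>Injectivity of \<open>gbar\<close> makes the lift of a restriction unique, and
    this uniqueness makes \<open>h\<close> multiplicative.\<close>
  define h where "h s = the_inv_into (carrier GL) gbar (\<rho> s)" for s
  have h: "h s \<in> carrier GL" "gbar (h s) = \<rho> s" if s: "s \<in> carrier G" for s
  proof -
    have "\<rho> s \<in> gbar ` carrier GL" using s SGB by (auto simp: S_def GB_def)
    then show "h s \<in> carrier GL" "gbar (h s) = \<rho> s"
      unfolding h_def by (rule the_inv_into_into[OF inj _ subset_refl], rule f_the_inv_into_f[OF inj])
  qed
  have "h \<in> hom G GL"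
  proof (rule homI)
    fix s t assume st: "s \<in> carrier G" "t \<in> carrier G"
    have "gbar (h (s \<otimes>\<^bsub>G\<^esub> t)) = \<rho> s \<otimes>\<^bsub>GX\<^esub> \<rho> t" using h(2)[of "s \<otimes>\<^bsub>G\<^esub> t"] st hom_mult[OF \<rho>_hom st] by simp
    also have "\<dots> = gbar (h s \<otimes>\<^bsub>GL\<^esub> h t)"
      using group_hom.hom_mult[OF gbar_group_hom h(1)[OF st(1)] h(1)[OF st(2)]] h(2) st by simp
    finally show "h (s \<otimes>\<^bsub>G\<^esub> t) = h s \<otimes>\<^bsub>GL\<^esub> h t"
      using inj_onD[OF inj] h(1) st by simp
  qed (rule h(1))
  moreover have "h ` carrier G = carrier GL"
  proof (intro equalityI subsetI)
    fix g assume g: "g \<in> carrier GL"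
    then have "gbar g \<in> S" unfolding S_eq by (simp add: GB_def)
    then obtain s where s: "s \<in> carrier G" "gbar g = \<rho> s" by (auto simp: S_def)
    then have "h s = g" using inj_onD[OF inj, of "h s" g] h[OF s(1)] g by simp
    then show "g \<in> h ` carrier G" using s by blast
  qed (use h(1) in auto)
  ultimately show ?thesis by (auto simp: epi_def)
qed

end

section \<open>The characteristic, and the passage from the hypotheses to Galois subfields\<close>

lemma characteristic_prime:
  assumes "field K" "has_characteristic K p" "p > 0"
  shows "Factorial_Ring.prime p"
proof -
  interpret K: field K by (rule assms)
  have char: "[m] \<cdot>\<^bsub>K\<^esub> \<one>\<^bsub>K\<^esub> = \<zero>\<^bsub>K\<^esub> \<longleftrightarrow> p dvd m" for m :: nat
    using assms(2) by (simp add: has_characteristic_def)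
  have "\<not> p dvd 1" using char[of 1] K.one_not_zero by simp
  then have "1 < p" using assms(3) by (cases "p = 1") auto
  moreover have "m = 1 \<or> m = p" if "m dvd p" for m
  proof -
    obtain q where q: "p = m * q" using \<open>m dvd p\<close> by (auto simp: dvd_def)
    have pos: "m > 0" "q > 0" using q assms(3) by (auto intro: gr0I)
    have "([m] \<cdot>\<^bsub>K\<^esub> \<one>\<^bsub>K\<^esub>) \<otimes>\<^bsub>K\<^esub> ([q] \<cdot>\<^bsub>K\<^esub> \<one>\<^bsub>K\<^esub>) = [m] \<cdot>\<^bsub>K\<^esub> ([q] \<cdot>\<^bsub>K\<^esub> \<one>\<^bsub>K\<^esub>)"
      using K.add_pow_ldistr[of "\<one>\<^bsub>K\<^esub>" "[q] \<cdot>\<^bsub>K\<^esub> \<one>\<^bsub>K\<^esub>" m] by simp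
    also have "\<dots> = [p] \<cdot>\<^bsub>K\<^esub> \<one>\<^bsub>K\<^esub>" using q by (simp add: K.add.nat_pow_pow mult.commute)
    also have "\<dots> = \<zero>\<^bsub>K\<^esub>" using char by simp
    finally have "p dvd m \<or> p dvd q" using K.integral char by fastforce
    then show ?thesis
    proof
      assume "p dvd m"
      then have "m = p" using \<open>m dvd p\<close> dvd_antisym by blast
      then show ?thesis by simp
    next
      assume "p dvd q"
      then have "p \<le> q" using pos dvd_imp_le by blast
      then have "m * q \<le> 1 * q" using q by simp
      then show ?thesis using pos by simp
    qed
  qed
  ultimately show ?thesis by (simp add: prime_nat_iff)
qed

theorem theorem1p2p1:
  fixes D :: "('a, 'b) ring_scheme"
    and v :: "'a \<Rightarrow> 'g::linordered_ab_group_add"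
    and F L :: "'a set"
    and p k r :: nat
    and \<sigma> :: "nat \<Rightarrow> 'a set \<Rightarrow> 'a set"
    and \<pi> :: "nat \<Rightarrow> 'a"
  assumes "central_division_algebra D F (p ^ k)"
    and "valuation D v"
    and "henselian (D\<lparr>carrier := F\<rparr>) v"
    and "has_characteristic (D\<lparr>carrier := F\<rparr>) p" and "p > 0"
    and "semi_ramified D v F"
    and "separable_extension (residue_ring D v) (sub_residue D v F) (carrier (residue_ring D v))"
    and "basis_with_lifts D v F r \<sigma> \<pi>"
    and "\<not> strongly_degenerate D v F r \<sigma> \<pi>"
    and "subfield L D" and "F \<subseteq> L"
    and "galois_extension (D\<lparr>carrier := L\<rparr>) F"
  shows "inertial D v F L \<and>
    (\<exists>h. h \<in> epi (residue_gal D v F) (gal_group (D\<lparr>carrier := L\<rparr>) F))"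
proof -
  have sk: "skew_field D" and center: "F = ring_center D" and dim: "ring.dimension D ((p ^ k)\<^sup>2) F (carrier D)"
    using assms(1) by (auto simp: central_division_algebra_def)
  interpret valued_skew_field D v
    by (intro valued_skew_field.intro valued_skew_field_axioms.intro sk assms(2))
  have field_F: "field (D\<lparr>carrier := F\<rparr>)" using assms(3) by (simp add: henselian_def)
  have F: "subfield F D" by (rule subfield_iff(1)[OF field_F]) (auto simp: center ring_center_def)
  have E: "field E" using assms(6) by (simp add: semi_ramified_def)
  obtain n where n: "E.dimension n (sub_residue D v F) (carrier E)" "value_index D v F = n"
    "dimension (n\<^sup>2) F (carrier D)"
    using assms(6) by (auto simp: semi_ramified_def)
  have "n\<^sup>2 = (p ^ k)\<^sup>2" by (rule dimension_is_inj[OF F n(3) dim])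
  \<comment> \<open>Both numbers square to the dimension of \<open>D\<close> over its center, so the
    common value of index and residue degree is a power of \<open>p\<close>.\<close>
  then have npk: "n = p ^ k" by (simp add: power2_eq_iff_nonneg)
  \<comment> \<open>Multiples of \<open>\<one>\<close> are integral and reduction is a homomorphism,
    so the characteristic of \<open>F\<close> passes to the residue ring.\<close>
  have res_add_pow: "add_pow D m \<one>\<^bsub>D\<^esub> \<in> V \<and> res (add_pow D m \<one>\<^bsub>D\<^esub>) = add_pow E m \<one>\<^bsub>E\<^esub>" for m :: nat
    by (induction m) (auto simp: res_add val_ring_closed(3))
  have "add_pow (D\<lparr>carrier := F\<rparr>) p \<one>\<^bsub>D\<lparr>carrier := F\<rparr>\<^esub> = \<zero>\<^bsub>D\<lparr>carrier := F\<rparr>\<^esub>"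
    using assms(4) by (simp add: has_characteristic_def)
  then have "add_pow D p \<one>\<^bsub>D\<^esub> = \<zero>\<^bsub>D\<^esub>" by (simp add: add_pow_def nat_pow_def)
  then have char_E: "add_pow E p \<one>\<^bsub>E\<^esub> = \<zero>\<^bsub>E\<^esub>" using res_add_pow[of p] by simp
  interpret galois_subfield D v F n L p k
    by (intro galois_subfield.intro semiramified.intro valued_skew_field_axioms
        semiramified_axioms.intro galois_subfield_axioms.intro)
      (use center F E n assms npk char_E characteristic_prime[OF field_F assms(4,5)] in
        \<open>auto simp: valued_skew_field_def\<close>)
  have unr: "val_of L = val_of F" by (rule unramified[OF assms(8,9)])
  obtain l where l: "dimension l F L" "E.dimension l F' L'" "card (carrier GL) \<le> l"
    using residue_degree[OF unr] by metis
  \<comment> \<open>Separability is a condition on single elements, so it is inherited by a smaller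
    top field.\<close>
  have "separable_extension E F' L'"
    using sep L'_carrier by (auto simp: separable_extension_def)
  then have "inertial D v F L" using l by (auto simp: inertial_def)
  moreover have "\<exists>h. h \<in> epi G GL" by (rule residue_gal_epi[OF l(2,3)])
  ultimately show ?thesis by simp
qed

end
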